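(* Let $n\geq 2$, let $\mathbb{K}$ be a field of characteristic different from $2$, and let $m\geq 1$. If $f$ is an $m$-fold presentation of a Lie $n$-algebra $\mathscr{L}$ over $\mathbb{K}$, then $$H_{m+1}(\mathscr{L},\mathsf{ab}_{n}\mathsf{lie})_{\mathbb{H}}\cong\frac{[f_{\varnothing},\dots,f_{\varnothing}]\cap\bigcap_{i\in\langle m\rangle}K[f_{i}]}{\sum_{I_{1}\cup\dots\cup I_{n}=\langle m\rangle}\Bigl[\bigcap_{i\in I_{1}}K[f_{i}],\dots,\bigcap_{i\in I_{n}}K[f_{i}]\Bigr]}.$$
   Context: A Lie $n$-algebra over $\mathbb{K}$ is a $\mathbb{K}$-vector space $\mathscr{L}$ with an $n$-linear operation $[-,\dots,-]\colon\mathscr{L}^n\to\mathscr{L}$ satisfying $$[[l_{1},\dots,l_{n}],l'_{1},\dots,l'_{n-1}]=\sum_{1\leq i\leq n}[l_{1},\dots,l_{i-1},[l_{i},l'_{1},\dots,l'_{n-1}],l_{i+1},\dots,l_{n}]$$ and $[l_1,\dots,l_n]=\mathrm{sgn}(\sigma)[l_{\sigma(1)},\dots,l_{\sigma(n)}]$ for all $\sigma\in S_n$. Homomorphisms are linear maps preserving the bracket. Ideals are subspaces $\mathscr{N}$ such that $[l_1,\dots,l_n]\in\mathscr{N}$ whenever some $l_i\in\mathscr{N}$. For ideals $\mathscr{N}_1,\dots,\mathscr{N}_n$ of $\mathscr{L}$, $[\mathscr{N}_1,\dots,\mathscr{N}_n]$ denotes the ideal of $\mathscr{L}$ generated by the elements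 $[l_1,\dots,l_n]$ with $l_1\in\mathscr{N}_1,\dots,l_n\in\mathscr{N}_n$. The abelianisation functor $\mathsf{ab}_{n}\mathsf{lie}$ from Lie $n$-algebras to vector spaces is $\mathscr{L}\mapsto\mathscr{L}/[\mathscr{L},\dots,\mathscr{L}]$; it is left adjoint to the inclusion of vector spaces as Lie $n$-algebras with zero bracket. Homology. $\mathbb{H}=(G,\delta,\epsilon)$ is the comonad on Lie $n$-algebras induced by the forgetful/free adjunction to sets. For a Lie $n$-algebra $\mathscr{L}$, $\mathbb{H}\mathscr{L}$ is the simplicial object with $G^{k+1}\mathscr{L}$ in degree $k\geq 0$, faces $\partial_i=G^i\epsilon_{G^{k-i}\mathscr{L}}\colon G^{k+1}\mathscr{L}\to G^k\mathscr{L}$ and degeneracies $\sigma_i=G^i\delta_{G^{k-i}\mathscr{L}}$, $0\leq i\leq k$. For a functor $I$, $H_{m+1}(\mathscr{L},I)_{\mathbb{H}}=H_m(N\,I\,\mathbb{H}\mathscr{L})$ for $m\geq 0$, where $N$ is the Moore normalisation: $N_kS=\bigcap_{i=0}^{k-1}\ker(\partial_i\colon S_k\to S_{k-1})$ for $k>0$, $N_0S=S_0$, with differential induced by $\partial_k$. Higher presentations. Let $\langle m\rangle=\{1,\dots,m\}$. An $m$-fold arrow is a functor $f$ from the poset of subsets of $\langle m\rangle$ (ordered by inclusion) to the category of Lie $n$-algebras; write $f_I=f(I)$, and $f_i\colon f_\varnothing\to f_{\{i\}}$ for the map induced by $\varnothing\subseteq\{i\}$; $K[f_i]$ is the kernel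 of $f_i$. It is an $m$-fold extension if for all $I\subsetneq\langle m\rangle$ the induced map $f_I\to\lim_{J\supsetneq I}f_J$ is surjective. An $m$-fold presentation of $\mathscr{L}$ is an $m$-fold extension $f$ with $f_{\langle m\rangle}=\mathscr{L}$ and with $f_I$ projective (with respect to surjective homomorphisms) for all $I\subsetneq\langle m\rangle$. The sum is a sum of ideals of $f_\varnothing$, over all $n$-tuples $(I_1,\dots,I_n)$ of (possibly empty) subsets of $\langle m\rangle$ with union $\langle m\rangle$; an empty intersection means $f_\varnothing$. *)

theory Defs
  imports "HOL-Algebra.Module" "HOL-Algebra.Multiplicative_Group" "HOL-Combinatorics.Permutations"
begin

section \<open>Vector spaces\<close>

text \<open>
  The ground field is a HOL-Algebra field \<open>K\<close>; vector spaces over it are HOL-Algebra modules. The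
  fields \<open>monoid.mult\<close> and \<open>one\<close> that the record type of modules inherits from rings play no role.
\<close>

definition ring_characteristic :: "('k, 'r) ring_scheme \<Rightarrow> nat" where
  "ring_characteristic R = group.ord (add_monoid R) \<one>\<^bsub>R\<^esub>"

definition linear_maps ::
  "('k, 'r) ring_scheme \<Rightarrow> ('k, 'a, 'x) module_scheme \<Rightarrow> ('k, 'b, 'y) module_scheme \<Rightarrow> ('a \<Rightarrow> 'b) set"
  where
  "linear_maps K M N = {h. h \<in> carrier M \<rightarrow> carrier N
     \<and> (\<forall>x\<in>carrier M. \<forall>y\<in>carrier M. h (x \<oplus>\<^bsub>M\<^esub> y) = h x \<oplus>\<^bsub>N\<^esub> h y)
     \<and> (\<forall>c\<in>carrier K. \<forall>x\<in>carrier M. h (c \<odot>\<^bsub>M\<^esub> x) = c \<odot>\<^bsub>N\<^esub> h x)}"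

definition linearly_isomorphic ::
  "('k, 'r) ring_scheme \<Rightarrow> ('k, 'a, 'x) module_scheme \<Rightarrow> ('k, 'b, 'y) module_scheme \<Rightarrow> bool" where
  "linearly_isomorphic K M N \<longleftrightarrow>
     (\<exists>h \<in> linear_maps K M N. bij_betw h (carrier M) (carrier N))"

definition quotient_module :: "('k, 'a, 'x) module_scheme \<Rightarrow> 'a set \<Rightarrow> ('k, 'a set) module" where
  "quotient_module M B =
     \<lparr>carrier = a_rcosets\<^bsub>M\<^esub> B, monoid.mult = undefined, one = undefined,
      zero = B, add = set_add M,
      smult = (\<lambda>c X. \<Union>x\<in>X. B +>\<^bsub>M\<^esub> (c \<odot>\<^bsub>M\<^esub> x))\<rparr>"

text \<open>The quotient \<open>A / B\<close> of two subspaces \<open>B \<subseteq> A\<close> of \<open>M\<close>.\<close>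

definition subquotient ::
  "('k, 'a, 'x) module_scheme \<Rightarrow> 'a set \<Rightarrow> 'a set \<Rightarrow> ('k, 'a set) module" where
  "subquotient M A B = quotient_module (M\<lparr>carrier := A\<rparr>) B"


section \<open>Lie n-algebras\<close>

text \<open>
  An \<open>n\<close>-tuple is a list of length \<open>n\<close>, so its entries are indexed by \<open>0, \<dots>, n - 1\<close>. Only the
  values of \<open>bracket\<close> on lists of length \<open>n\<close> with entries in the carrier are relevant.
\<close>

record ('k, 'a) nlie = "('k, 'a) module" +
  bracket :: "'a list \<Rightarrow> 'a"

definition tuples :: "nat \<Rightarrow> 'a set \<Rightarrow> 'a list set" where
  "tuples n X = {xs. length xs = n \<and> set xs \<subseteq> X}"

locale lie_n_algebra = field K + module K L
  for n :: nat and K :: "('k, 'r) ring_scheme" (structure) and L :: "('k, 'a) nlie" (structure) +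
  assumes bracket_closed:
      "ls \<in> tuples n (carrier L) \<Longrightarrow> bracket L ls \<in> carrier L"
    and bracket_add:
      "\<lbrakk>ls \<in> tuples n (carrier L); i < n; x \<in> carrier L; y \<in> carrier L\<rbrakk> \<Longrightarrow>
       bracket L (ls[i := x \<oplus>\<^bsub>L\<^esub> y]) = bracket L (ls[i := x]) \<oplus>\<^bsub>L\<^esub> bracket L (ls[i := y])"
    and bracket_smult:
      "\<lbrakk>ls \<in> tuples n (carrier L); i < n; c \<in> carrier K; x \<in> carrier L\<rbrakk> \<Longrightarrow>
       bracket L (ls[i := c \<odot>\<^bsub>L\<^esub> x]) = c \<odot>\<^bsub>L\<^esub> bracket L (ls[i := x])"
    and bracket_derivation:
      "\<lbrakk>ls \<in> tuples n (carrier L); ls' \<in> tuples (n - 1) (carrier L)\<rbrakk> \<Longrightarrow>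
       bracket L (bracket L ls # ls') =
         (\<Oplus>\<^bsub>L\<^esub>i\<in>{..<n}. bracket L (ls[i := bracket L ((ls ! i) # ls')]))"
    and bracket_sign:
      "\<lbrakk>ls \<in> tuples n (carrier L); \<sigma> permutes {..<n}\<rbrakk> \<Longrightarrow>
       bracket L ls = ([sign \<sigma>] \<cdot>\<^bsub>K\<^esub> \<one>\<^bsub>K\<^esub>) \<odot>\<^bsub>L\<^esub> bracket L (permute_list \<sigma> ls)"

text \<open>Homomorphisms are only relevant on the carrier of their domain.\<close>

definition lie_hom ::
  "nat \<Rightarrow> ('k, 'r) ring_scheme \<Rightarrow> ('k, 'a) nlie \<Rightarrow> ('k, 'b) nlie \<Rightarrow> ('a \<Rightarrow> 'b) set" where
  "lie_hom n K A B = {h \<in> linear_maps K A B.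
     \<forall>ls \<in> tuples n (carrier A). h (bracket A ls) = bracket B (map h ls)}"

definition lie_ideal :: "nat \<Rightarrow> ('k, 'r) ring_scheme \<Rightarrow> ('k, 'a) nlie \<Rightarrow> 'a set \<Rightarrow> bool" where
  "lie_ideal n K L N \<longleftrightarrow> submodule N K L \<and>
     (\<forall>ls \<in> tuples n (carrier L). (\<exists>i<n. ls ! i \<in> N) \<longrightarrow> bracket L ls \<in> N)"

definition generated_ideal ::
  "nat \<Rightarrow> ('k, 'r) ring_scheme \<Rightarrow> ('k, 'a) nlie \<Rightarrow> 'a set \<Rightarrow> 'a set" where
  "generated_ideal n K L S = \<Inter>{N. lie_ideal n K L N \<and> S \<subseteq> N}"

text \<open>The commutator \<open>[N 0, \<dots>, N (n - 1)]\<close> of a family of ideals of \<open>L\<close>.\<close>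

definition commutator_ideal ::
  "nat \<Rightarrow> ('k, 'r) ring_scheme \<Rightarrow> ('k, 'a) nlie \<Rightarrow> (nat \<Rightarrow> 'a set) \<Rightarrow> 'a set" where
  "commutator_ideal n K L N =
     generated_ideal n K L {bracket L ls |ls. length ls = n \<and> (\<forall>i<n. ls ! i \<in> N i)}"

definition sum_of_ideals :: "('k, 'a) nlie \<Rightarrow> 't set \<Rightarrow> ('t \<Rightarrow> 'a set) \<Rightarrow> 'a set" where
  "sum_of_ideals L T N = {(\<Oplus>\<^bsub>L\<^esub>t\<in>T. x t) |x. \<forall>t\<in>T. x t \<in> N t}"


section \<open>Abelianisation\<close>

definition derived_ideal :: "nat \<Rightarrow> ('k, 'r) ring_scheme \<Rightarrow> ('k, 'a) nlie \<Rightarrow> 'a set" where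
  "derived_ideal n K L = commutator_ideal n K L (\<lambda>_. carrier L)"

definition ab_obj :: "nat \<Rightarrow> ('k, 'r) ring_scheme \<Rightarrow> ('k, 'a) nlie \<Rightarrow> ('k, 'a set) module" where
  "ab_obj n K L = quotient_module L (derived_ideal n K L)"

text \<open>The map induced by \<open>h : A \<rightarrow> B\<close> sends the coset of \<open>x\<close> to the coset of \<open>h x\<close>.\<close>

definition ab_map ::
  "nat \<Rightarrow> ('k, 'r) ring_scheme \<Rightarrow> ('k, 'a) nlie \<Rightarrow> ('k, 'b) nlie \<Rightarrow> ('a \<Rightarrow> 'b) \<Rightarrow> 'a set \<Rightarrow> 'b set"
  where
  "ab_map n K A B h X = (\<Union>x\<in>X. derived_ideal n K B +>\<^bsub>B\<^esub> h x)"


section \<open>The free Lie n-algebra comonad\<close>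

text \<open>
  The comonad has to be iterated arbitrarily often inside one type. The type \<open>('k, 'a) univ\<close>
  consists of formal expressions whose generators \<open>Gen t\<close> are indexed by elements \<open>t\<close> of the type
  itself, so that the free Lie \<open>n\<close>-algebra on a subset of the type has its carrier again in the
  type; \<open>Elem\<close> embeds the elements of an arbitrary type \<open>'a\<close>.

  The free Lie \<open>n\<close>-algebra on \<open>X\<close> is the set of expressions in the generators \<open>Gen x\<close>, \<open>x \<in> X\<close>,
  modulo the congruence generated by the axioms of Lie \<open>n\<close>-algebras. A congruence class is
  represented by a chosen element of it.
\<close>

datatype ('k, 'a) univ =
    Elem (the_Elem: 'a)
  | Gen "('k, 'a) univ"
  | Zero
  | Add "('k, 'a) univ" "('k, 'a) univ"
  | Smult 'k "('k, 'a) univ"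
  | Brk "('k, 'a) univ list"

inductive_set free_terms ::
  "nat \<Rightarrow> ('k, 'r) ring_scheme \<Rightarrow> ('k, 'a) univ set \<Rightarrow> ('k, 'a) univ set"
  for n :: nat and K :: "('k, 'r) ring_scheme" and X :: "('k, 'a) univ set" where
  "x \<in> X \<Longrightarrow> Gen x \<in> free_terms n K X"
| "Zero \<in> free_terms n K X"
| "\<lbrakk>s \<in> free_terms n K X; t \<in> free_terms n K X\<rbrakk> \<Longrightarrow> Add s t \<in> free_terms n K X"
| "\<lbrakk>c \<in> carrier K; t \<in> free_terms n K X\<rbrakk> \<Longrightarrow> Smult c t \<in> free_terms n K X"
| "\<lbrakk>length ts = n; \<forall>t\<in>set ts. t \<in> free_terms n K X\<rbrakk> \<Longrightarrow> Brk ts \<in> free_terms n K X"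

inductive free_cong ::
  "nat \<Rightarrow> ('k, 'r) ring_scheme \<Rightarrow> ('k, 'a) univ set \<Rightarrow> ('k, 'a) univ \<Rightarrow> ('k, 'a) univ \<Rightarrow> bool"
  for n :: nat and K :: "('k, 'r) ring_scheme" and X :: "('k, 'a) univ set" where
  cong_refl: "t \<in> free_terms n K X \<Longrightarrow> free_cong n K X t t"
| cong_sym: "free_cong n K X s t \<Longrightarrow> free_cong n K X t s"
| cong_trans: "\<lbrakk>free_cong n K X s t; free_cong n K X t u\<rbrakk> \<Longrightarrow> free_cong n K X s u"
| cong_Add:
    "\<lbrakk>free_cong n K X s s'; free_cong n K X t t'\<rbrakk> \<Longrightarrow> free_cong n K X (Add s t) (Add s' t')"
| cong_Smult:
    "\<lbrakk>c \<in> carrier K; free_cong n K X t t'\<rbrakk> \<Longrightarrow> free_cong n K X (Smult c t) (Smult c t')"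
| cong_Brk:
    "\<lbrakk>ts \<in> tuples n (free_terms n K X); i < n; free_cong n K X (ts ! i) t'\<rbrakk> \<Longrightarrow>
     free_cong n K X (Brk ts) (Brk (ts[i := t']))"
| Add_assoc:
    "\<lbrakk>s \<in> free_terms n K X; t \<in> free_terms n K X; u \<in> free_terms n K X\<rbrakk> \<Longrightarrow>
     free_cong n K X (Add (Add s t) u) (Add s (Add t u))"
| Add_comm:
    "\<lbrakk>s \<in> free_terms n K X; t \<in> free_terms n K X\<rbrakk> \<Longrightarrow> free_cong n K X (Add s t) (Add t s)"
| Add_Zero: "t \<in> free_terms n K X \<Longrightarrow> free_cong n K X (Add Zero t) t"
| Add_minus:
    "t \<in> free_terms n K X \<Longrightarrow> free_cong n K X (Add (Smult (\<ominus>\<^bsub>K\<^esub> \<one>\<^bsub>K\<^esub>) t) t) Zero"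
| Smult_add_left:
    "\<lbrakk>c \<in> carrier K; d \<in> carrier K; t \<in> free_terms n K X\<rbrakk> \<Longrightarrow>
     free_cong n K X (Smult (c \<oplus>\<^bsub>K\<^esub> d) t) (Add (Smult c t) (Smult d t))"
| Smult_add_right:
    "\<lbrakk>c \<in> carrier K; s \<in> free_terms n K X; t \<in> free_terms n K X\<rbrakk> \<Longrightarrow>
     free_cong n K X (Smult c (Add s t)) (Add (Smult c s) (Smult c t))"
| Smult_assoc:
    "\<lbrakk>c \<in> carrier K; d \<in> carrier K; t \<in> free_terms n K X\<rbrakk> \<Longrightarrow>
     free_cong n K X (Smult (c \<otimes>\<^bsub>K\<^esub> d) t) (Smult c (Smult d t))"
| Smult_one: "t \<in> free_terms n K X \<Longrightarrow> free_cong n K X (Smult \<one>\<^bsub>K\<^esub> t) t"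
| Brk_add:
    "\<lbrakk>ts \<in> tuples n (free_terms n K X); i < n; s \<in> free_terms n K X; t \<in> free_terms n K X\<rbrakk> \<Longrightarrow>
     free_cong n K X (Brk (ts[i := Add s t])) (Add (Brk (ts[i := s])) (Brk (ts[i := t])))"
| Brk_smult:
    "\<lbrakk>ts \<in> tuples n (free_terms n K X); i < n; c \<in> carrier K; t \<in> free_terms n K X\<rbrakk> \<Longrightarrow>
     free_cong n K X (Brk (ts[i := Smult c t])) (Smult c (Brk (ts[i := t])))"
| Brk_derivation:
    "\<lbrakk>ts \<in> tuples n (free_terms n K X); ts' \<in> tuples (n - 1) (free_terms n K X)\<rbrakk> \<Longrightarrow>
     free_cong n K X (Brk (Brk ts # ts'))
       (foldr Add (map (\<lambda>i. Brk (ts[i := Brk ((ts ! i) # ts')])) [0..<n]) Zero)"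
| Brk_sign:
    "\<lbrakk>ts \<in> tuples n (free_terms n K X); \<sigma> permutes {..<n}\<rbrakk> \<Longrightarrow>
     free_cong n K X (Brk ts) (Smult ([sign \<sigma>] \<cdot>\<^bsub>K\<^esub> \<one>\<^bsub>K\<^esub>) (Brk (permute_list \<sigma> ts)))"

definition free_rep ::
  "nat \<Rightarrow> ('k, 'r) ring_scheme \<Rightarrow> ('k, 'a) univ set \<Rightarrow> ('k, 'a) univ \<Rightarrow> ('k, 'a) univ" where
  "free_rep n K X t = (SOME s. free_cong n K X t s)"

definition free_nlie ::
  "nat \<Rightarrow> ('k, 'r) ring_scheme \<Rightarrow> ('k, 'a) univ set \<Rightarrow> ('k, ('k, 'a) univ) nlie" where
  "free_nlie n K X =
     \<lparr>carrier = free_rep n K X ` free_terms n K X, monoid.mult = undefined, one = undefined,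
      zero = free_rep n K X Zero, add = (\<lambda>s t. free_rep n K X (Add s t)),
      smult = (\<lambda>c t. free_rep n K X (Smult c t)),
      bracket = (\<lambda>ts. free_rep n K X (Brk ts))\<rparr>"

definition free_unit ::
  "nat \<Rightarrow> ('k, 'r) ring_scheme \<Rightarrow> ('k, 'a) univ set \<Rightarrow> ('k, 'a) univ \<Rightarrow> ('k, 'a) univ" where
  "free_unit n K X x = free_rep n K X (Gen x)"

text \<open>
  On the carrier of the free Lie \<open>n\<close>-algebra on \<open>X\<close>, \<open>free_lift A h\<close> is the homomorphism to \<open>A\<close>
  that extends \<open>h : X \<rightarrow> carrier A\<close>.
\<close>

primrec free_lift :: "('k, 'b) nlie \<Rightarrow> (('k, 'a) univ \<Rightarrow> 'b) \<Rightarrow> ('k, 'a) univ \<Rightarrow> 'b" where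
  "free_lift A h (Elem a) = undefined"
| "free_lift A h (Gen x) = h x"
| "free_lift A h Zero = \<zero>\<^bsub>A\<^esub>"
| "free_lift A h (Add s t) = free_lift A h s \<oplus>\<^bsub>A\<^esub> free_lift A h t"
| "free_lift A h (Smult c t) = c \<odot>\<^bsub>A\<^esub> free_lift A h t"
| "free_lift A h (Brk ts) = bracket A (map (free_lift A h) ts)"

text \<open>The comonad \<open>(G, \<delta>, \<epsilon>)\<close> on the Lie \<open>n\<close>-algebras whose carrier lies in \<open>('k, 'a) univ\<close>.\<close>

definition G_obj ::
  "nat \<Rightarrow> ('k, 'r) ring_scheme \<Rightarrow> ('k, ('k, 'a) univ) nlie \<Rightarrow> ('k, ('k, 'a) univ) nlie" where
  "G_obj n K A = free_nlie n K (carrier A)"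

definition G_map ::
  "nat \<Rightarrow> ('k, 'r) ring_scheme \<Rightarrow> ('k, ('k, 'a) univ) nlie \<Rightarrow>
   (('k, 'a) univ \<Rightarrow> ('k, 'a) univ) \<Rightarrow> ('k, 'a) univ \<Rightarrow> ('k, 'a) univ" where
  \<comment> \<open>\<open>B\<close> is the codomain of \<open>h\<close>.\<close>
  "G_map n K B h = free_lift (G_obj n K B) (\<lambda>x. free_unit n K (carrier B) (h x))"

definition G_counit :: "('k, ('k, 'a) univ) nlie \<Rightarrow> ('k, 'a) univ \<Rightarrow> ('k, 'a) univ" where
  "G_counit A = free_lift A (\<lambda>x. x)"

definition G_comult ::
  "nat \<Rightarrow> ('k, 'r) ring_scheme \<Rightarrow> ('k, ('k, 'a) univ) nlie \<Rightarrow> ('k, 'a) univ \<Rightarrow> ('k, 'a) univ" where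
  "G_comult n K A = G_map n K (G_obj n K A) (free_unit n K (carrier A))"

primrec G_pow_map ::
  "nat \<Rightarrow> ('k, 'r) ring_scheme \<Rightarrow> nat \<Rightarrow> ('k, ('k, 'a) univ) nlie \<Rightarrow>
   (('k, 'a) univ \<Rightarrow> ('k, 'a) univ) \<Rightarrow> ('k, 'a) univ \<Rightarrow> ('k, 'a) univ" where
  "G_pow_map n K 0 B h = h"
| "G_pow_map n K (Suc i) B h = G_map n K ((G_obj n K ^^ i) B) (G_pow_map n K i B h)"


section \<open>Comonadic homology\<close>

text \<open>
  \<open>sface S k i\<close> is the face \<open>\<partial>\<^sub>i : S\<^sub>k \<rightarrow> S\<^bsub>k-1\<^esub>\<close> and \<open>sdegen S k i\<close> the degeneracy
  \<open>\<sigma>\<^sub>i : S\<^sub>k \<rightarrow> S\<^bsub>k+1\<^esub>\<close>; both are relevant for \<open>i \<le> k\<close> only, and the faces for \<open>k > 0\<close> only.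
\<close>

record ('o, 'h) simplicial =
  sobj :: "nat \<Rightarrow> 'o"
  sface :: "nat \<Rightarrow> nat \<Rightarrow> 'h"
  sdegen :: "nat \<Rightarrow> nat \<Rightarrow> 'h"

definition comonad_resolution ::
  "nat \<Rightarrow> ('k, 'r) ring_scheme \<Rightarrow> ('k, ('k, 'a) univ) nlie \<Rightarrow>
   (('k, ('k, 'a) univ) nlie, ('k, 'a) univ \<Rightarrow> ('k, 'a) univ) simplicial" where
  "comonad_resolution n K A =
     \<lparr>sobj = (\<lambda>k. (G_obj n K ^^ (k + 1)) A),
      sface = (\<lambda>k i. let B = (G_obj n K ^^ (k - i)) A in G_pow_map n K i B (G_counit B)),
      sdegen = (\<lambda>k i. let B = (G_obj n K ^^ (k - i)) A in
        G_pow_map n K i (G_obj n K (G_obj n K B)) (G_comult n K B))\<rparr>"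

text \<open>A functor is given by its action \<open>Fo\<close> on objects and \<open>Fm A B\<close> on maps \<open>A \<rightarrow> B\<close>.\<close>

definition map_simplicial ::
  "('o \<Rightarrow> 'p) \<Rightarrow> ('o \<Rightarrow> 'o \<Rightarrow> 'h \<Rightarrow> 'g) \<Rightarrow> ('o, 'h) simplicial \<Rightarrow> ('p, 'g) simplicial" where
  "map_simplicial Fo Fm S =
     \<lparr>sobj = (\<lambda>k. Fo (sobj S k)),
      sface = (\<lambda>k i. Fm (sobj S k) (sobj S (k - 1)) (sface S k i)),
      sdegen = (\<lambda>k i. Fm (sobj S k) (sobj S (k + 1)) (sdegen S k i))\<rparr>"

definition moore :: "(('k, 'v) module, 'v \<Rightarrow> 'v) simplicial \<Rightarrow> nat \<Rightarrow> 'v set" where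
  "moore S k = carrier (sobj S k) \<inter>
     (\<Inter>i\<in>{..<k}. a_kernel (sobj S k) (sobj S (k - 1)) (sface S k i))"

definition moore_homology ::
  "(('k, 'v) module, 'v \<Rightarrow> 'v) simplicial \<Rightarrow> nat \<Rightarrow> ('k, 'v set) module" where
  "moore_homology S k = subquotient (sobj S k)
     {x \<in> moore S k. k > 0 \<longrightarrow> sface S k k x = \<zero>\<^bsub>sobj S (k - 1)\<^esub>}
     (sface S (k + 1) (k + 1) ` moore S (k + 1))"

text \<open>The isomorphic copy of \<open>L\<close> whose carrier lies in \<open>('k, 'a) univ\<close>.\<close>

definition elem_copy :: "('k, 'a) nlie \<Rightarrow> ('k, ('k, 'a) univ) nlie" where
  "elem_copy L =
     \<lparr>carrier = Elem ` carrier L, monoid.mult = undefined, one = undefined,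
      zero = Elem \<zero>\<^bsub>L\<^esub>, add = (\<lambda>x y. Elem (the_Elem x \<oplus>\<^bsub>L\<^esub> the_Elem y)),
      smult = (\<lambda>c x. Elem (c \<odot>\<^bsub>L\<^esub> the_Elem x)),
      bracket = (\<lambda>xs. Elem (bracket L (map the_Elem xs)))\<rparr>"

text \<open>
  \<open>comonad_homology n K Fo Fm q L\<close> is the \<open>q\<close>-th homology of \<open>L\<close> with coefficients in the functor
  \<open>(Fo, Fm)\<close>, for \<open>q \<ge> 1\<close>; note the shift of the degree by one.
\<close>

definition comonad_homology ::
  "nat \<Rightarrow> ('k, 'r) ring_scheme \<Rightarrow> (('k, ('k, 'a) univ) nlie \<Rightarrow> ('k, 'v) module) \<Rightarrow>
   (('k, ('k, 'a) univ) nlie \<Rightarrow> ('k, ('k, 'a) univ) nlie \<Rightarrow>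
      (('k, 'a) univ \<Rightarrow> ('k, 'a) univ) \<Rightarrow> 'v \<Rightarrow> 'v) \<Rightarrow>
   nat \<Rightarrow> ('k, 'a) nlie \<Rightarrow> ('k, 'v set) module" where
  "comonad_homology n K Fo Fm q L =
     moore_homology (map_simplicial Fo Fm (comonad_resolution n K (elem_copy L))) (q - 1)"


section \<open>Higher presentations\<close>

text \<open>
  Lifting is tested against the Lie \<open>n\<close>-algebras with carrier in \<open>('k, 'a) univ\<close>. This is no
  restriction: the free Lie \<open>n\<close>-algebra on the elements of \<open>P\<close> and a copy of \<open>P\<close> are among these,
  so that \<open>P\<close> is a retract of a free Lie \<open>n\<close>-algebra.
\<close>

definition lie_projective :: "nat \<Rightarrow> ('k, 'r) ring_scheme \<Rightarrow> ('k, 'a) nlie \<Rightarrow> bool" where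
  "lie_projective n K P \<longleftrightarrow>
     (\<forall>(A :: ('k, ('k, 'a) univ) nlie) (B :: ('k, ('k, 'a) univ) nlie).
        \<forall>p \<in> lie_hom n K A B. \<forall>h \<in> lie_hom n K P B.
          lie_n_algebra n K A \<longrightarrow> lie_n_algebra n K B \<longrightarrow> p ` carrier A = carrier B \<longrightarrow>
          (\<exists>g \<in> lie_hom n K P A. \<forall>x \<in> carrier P. p (g x) = h x))"

text \<open>\<open>\<phi> I J\<close> is the map \<open>f\<^sub>I \<rightarrow> f\<^sub>J\<close> for \<open>I \<subseteq> J\<close>.\<close>

locale fold_arrow =
  fixes n :: nat and K :: "('k, 'r) ring_scheme" and m :: nat
    and f :: "nat set \<Rightarrow> ('k, 'a) nlie" and \<phi> :: "nat set \<Rightarrow> nat set \<Rightarrow> 'a \<Rightarrow> 'a"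
  assumes arrow_obj: "I \<subseteq> {1..m} \<Longrightarrow> lie_n_algebra n K (f I)"
    and arrow_map: "\<lbrakk>I \<subseteq> J; J \<subseteq> {1..m}\<rbrakk> \<Longrightarrow> \<phi> I J \<in> lie_hom n K (f I) (f J)"
    and arrow_id: "\<lbrakk>I \<subseteq> {1..m}; x \<in> carrier (f I)\<rbrakk> \<Longrightarrow> \<phi> I I x = x"
    and arrow_comp:
      "\<lbrakk>I \<subseteq> J; J \<subseteq> H; H \<subseteq> {1..m}; x \<in> carrier (f I)\<rbrakk> \<Longrightarrow> \<phi> J H (\<phi> I J x) = \<phi> I H x"

text \<open>
  The underlying set of the limit of the \<open>f J\<close> with \<open>I \<subset> J \<subseteq> {1..m}\<close>: limits of Lie
  \<open>n\<close>-algebras are formed by compatible families, as in sets.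
\<close>

definition upper_limit ::
  "nat \<Rightarrow> (nat set \<Rightarrow> ('k, 'a) nlie) \<Rightarrow> (nat set \<Rightarrow> nat set \<Rightarrow> 'a \<Rightarrow> 'a) \<Rightarrow> nat set \<Rightarrow> (nat set \<Rightarrow> 'a) set"
  where
  "upper_limit m f \<phi> I =
     {x \<in> (\<Pi>\<^sub>E J \<in> {J. I \<subset> J \<and> J \<subseteq> {1..m}}. carrier (f J)).
        \<forall>J H. I \<subset> J \<and> J \<subseteq> H \<and> H \<subseteq> {1..m} \<longrightarrow> \<phi> J H (x J) = x H}"

locale fold_extension = fold_arrow +
  assumes extension:
    "I \<subset> {1..m} \<Longrightarrow>
     (\<lambda>y. \<lambda>J \<in> {J. I \<subset> J \<and> J \<subseteq> {1..m}}. \<phi> I J y) ` carrier (f I) = upper_limit m f \<phi> I"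

locale fold_presentation = fold_extension +
  fixes L
  assumes presented: "f {1..m} = L"
    and projective: "I \<subset> {1..m} \<Longrightarrow> lie_projective n K (f I)"


section \<open>The Hopf quotient\<close>

text \<open>\<open>kernel_meet f \<phi> I\<close> is the intersection of the kernels \<open>K[f\<^sub>i]\<close>, \<open>i \<in> I\<close>; it is \<open>f {}\<close> for empty \<open>I\<close>.\<close>

definition kernel_meet ::
  "(nat set \<Rightarrow> ('k, 'a) nlie) \<Rightarrow> (nat set \<Rightarrow> nat set \<Rightarrow> 'a \<Rightarrow> 'a) \<Rightarrow> nat set \<Rightarrow> 'a set" where
  "kernel_meet f \<phi> I = carrier (f {}) \<inter> (\<Inter>i\<in>I. a_kernel (f {}) (f {i}) (\<phi> {} {i}))"

definition covering_tuples :: "nat \<Rightarrow> nat \<Rightarrow> (nat \<Rightarrow> nat set) set" where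
  "covering_tuples n m = {T \<in> {..<n} \<rightarrow>\<^sub>E Pow {1..m}. (\<Union>j<n. T j) = {1..m}}"

definition hopf_quotient ::
  "nat \<Rightarrow> ('k, 'r) ring_scheme \<Rightarrow> nat \<Rightarrow> (nat set \<Rightarrow> ('k, 'a) nlie) \<Rightarrow>
   (nat set \<Rightarrow> nat set \<Rightarrow> 'a \<Rightarrow> 'a) \<Rightarrow> ('k, 'a set) module" where
  "hopf_quotient n K m f \<phi> = subquotient (f {})
     (commutator_ideal n K (f {}) (\<lambda>_. carrier (f {})) \<inter> kernel_meet f \<phi> {1..m})
     (sum_of_ideals (f {}) (covering_tuples n m)
        (\<lambda>T. commutator_ideal n K (f {}) (\<lambda>j. kernel_meet f \<phi> (T j))))"

end

theory Submission
  imports Defs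
begin

text \<open>
  Write \<open>D\<close> for the derived ideal, \<open>\<inter>K\<close> for the intersection of the kernels \<open>K[f\<^sub>i]\<close> at the initial
  vertex of an \<open>m\<close>-cube, and \<open>S(f)\<close> for the denominator of the Hopf quotient. Both sides of the
  formula are compared with the cube \<open>C\<close> that the comonad resolution \<open>A\<close> itself provides: its vertex
  at \<open>I\<close> is the power of \<open>G\<close> with exponent \<open>m - |I|\<close>, its edges are induced by the counits, and
  its initial vertex is \<open>A\<^bsub>m-1\<^esub>\<close>.

  The key computation concerns a cube \<open>e\<close> of retracts of free algebras that is an extension. Such a
  cube splits: there are homomorphisms \<open>c\<^sub>I : e\<^sub>I \<rightarrow> e\<^sub>\<emptyset>\<close>, with \<open>c\<^sub>\<emptyset>\<close> the identity, such that \<open>c\<^sub>I\<close> and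
  \<open>c\<^sub>J\<close>, composed with the edges out of \<open>e\<^sub>\<emptyset>\<close>, agree modulo \<open>K[e\<^sub>j]\<close> for \<open>J = I \<union> {j}\<close>. The alternating
  sum of these composites over all \<open>I\<close> is a linear projection onto \<open>\<inter>K\<close>. It maps a bracket to a sum
  of brackets whose entries lie in kernels that together cover all directions, so it maps \<open>D\<close> into
  \<open>S(e)\<close> (\<open>alt_sum_bracket\<close>, \<open>split_projection\<close>). In particular \<open>D \<inter> \<inter>K = S(e)\<close>.

  \<^item> The homology is the Hopf quotient of \<open>C\<close>. In the resolution the faces of an element can be
    prescribed arbitrarily, subject to the obvious compatibility (\<open>fill_faces\<close>). The first \<open>m\<close> faces
    of \<open>A\<^sub>m\<close> span a cube of free algebras, and its projection shows that each homology class of the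
    abelianised resolution comes from some \<open>x\<close> in \<open>A\<^sub>m\<close> whose first \<open>m\<close> faces vanish and whose last
    face lies in \<open>D\<close>. The class vanishes if and only if the last face of \<open>x\<close> lies in \<open>S(C)\<close>
    (\<open>normalised_cycle_boundary_iff\<close>), and the last faces that occur are the elements of \<open>D \<inter> \<inter>K\<close>.

  \<^item> The Hopf quotient does not depend on the presentation. Projectivity and the extension property
    yield maps of cubes between \<open>f\<close> and \<open>C\<close> in both directions that are the identity on \<open>L\<close>. Their
    composites are compared with the identity: two maps of cubes \<open>g\<close> and \<open>h\<close> that agree at the terminal
    vertex differ on \<open>D \<inter> \<inter>K\<close> by elements of the denominator (\<open>cube_maps_homotopic\<close>). If \<open>g\<close> and \<open>h\<close> agree
    at all vertices that contain some \<open>i\<close>, the construction of the projection, carried out for \<open>g\<close>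
    and for \<open>h\<close> with the same choices wherever \<open>i\<close> is involved, yields two alternating sums with
    values in the denominator, and on \<open>\<inter>K\<close> they differ by \<open>g - h\<close>. The general case follows by
    changing a map of cubes at one vertex at a time.
\<close>

section \<open>Submodules and cosets\<close>

lemma (in module) submodule_zero:
  assumes "submodule H R M" shows "\<zero>\<^bsub>M\<^esub> \<in> H"
  using assms unfolding submodule_def
  by (metis monoid.simps(2) subgroup.one_closed)

lemma (in module) submodule_minus:
  assumes "submodule H R M" "x \<in> H" "y \<in> H" shows "x \<ominus>\<^bsub>M\<^esub> y \<in> H"
  using submoduleE[OF assms(1)] assms(2,3) by (simp add: a_minus_def)

lemma (in module) submodule_criterion:
  assumes "H \<subseteq> carrier M" "\<zero>\<^bsub>M\<^esub> \<in> H"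
    and "\<And>x y. \<lbrakk>x \<in> H; y \<in> H\<rbrakk> \<Longrightarrow> x \<oplus>\<^bsub>M\<^esub> y \<in> H"
    and "\<And>c x. \<lbrakk>c \<in> carrier R; x \<in> H\<rbrakk> \<Longrightarrow> c \<odot>\<^bsub>M\<^esub> x \<in> H"
  shows "submodule H R M"
proof (rule submoduleI)
  fix a assume a: "a \<in> H"
  have "(\<ominus> \<one>) \<odot>\<^bsub>M\<^esub> a \<in> H" using assms(4) a by simp
  moreover have "(\<ominus> \<one>) \<odot>\<^bsub>M\<^esub> a = \<ominus>\<^bsub>M\<^esub> a" using a assms(1) by (simp add: smult_l_minus subset_iff)
  ultimately show "\<ominus>\<^bsub>M\<^esub> a \<in> H" by simp
qed (use assms in auto)

lemma (in module) submodule_abelian_subgroup: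
  assumes "submodule B R M" shows "abelian_subgroup B M"
  using assms abelian_group_axioms
  by (auto intro!: abelian_subgroupI3 additive_subgroup.intro simp: submodule_def)

lemma (in module) coset_eq_iff:
  assumes B: "submodule B R M" and x: "x \<in> carrier M" and y: "y \<in> carrier M"
  shows "B +>\<^bsub>M\<^esub> x = B +>\<^bsub>M\<^esub> y \<longleftrightarrow> x \<ominus>\<^bsub>M\<^esub> y \<in> B"
proof -
  interpret B: abelian_subgroup B M by (rule submodule_abelian_subgroup[OF B])
  have "B +>\<^bsub>M\<^esub> x = B +>\<^bsub>M\<^esub> y \<longleftrightarrow> x \<in> B +>\<^bsub>M\<^esub> y"
    using B.a_repr_independence'[of x y] B.a_rcos_self[OF x] y by metis
  then show ?thesis using B.a_rcos_module[OF y x] by (simp add: a_minus_def)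
qed

section \<open>Linear maps\<close>

lemma linear_maps_closed:
  "\<lbrakk>h \<in> linear_maps K M N; x \<in> carrier M\<rbrakk> \<Longrightarrow> h x \<in> carrier N"
  unfolding linear_maps_def by auto

lemma linear_maps_add:
  "\<lbrakk>h \<in> linear_maps K M N; x \<in> carrier M; y \<in> carrier M\<rbrakk> \<Longrightarrow> h (x \<oplus>\<^bsub>M\<^esub> y) = h x \<oplus>\<^bsub>N\<^esub> h y"
  unfolding linear_maps_def by auto

lemma linear_maps_smult:
  "\<lbrakk>h \<in> linear_maps K M N; c \<in> carrier K; x \<in> carrier M\<rbrakk> \<Longrightarrow> h (c \<odot>\<^bsub>M\<^esub> x) = c \<odot>\<^bsub>N\<^esub> h x"
  unfolding linear_maps_def by auto

lemma linear_maps_zero: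
  assumes "module K M" "module K N" "h \<in> linear_maps K M N"
  shows "h \<zero>\<^bsub>M\<^esub> = \<zero>\<^bsub>N\<^esub>"
proof -
  interpret M: module K M by fact
  interpret N: module K N by fact
  have "h \<zero>\<^bsub>M\<^esub> = h (\<zero>\<^bsub>K\<^esub> \<odot>\<^bsub>M\<^esub> \<zero>\<^bsub>M\<^esub>)" by simp
  also have "\<dots> = \<zero>\<^bsub>K\<^esub> \<odot>\<^bsub>N\<^esub> h \<zero>\<^bsub>M\<^esub>" using assms(3) by (intro linear_maps_smult) auto
  also have "\<dots> = \<zero>\<^bsub>N\<^esub>" using linear_maps_closed[OF assms(3)] by simp
  finally show ?thesis .
qed

lemma linear_maps_minus:
  assumes "module K M" "module K N" "h \<in> linear_maps K M N" "x \<in> carrier M" "y \<in> carrier M"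
  shows "h (x \<ominus>\<^bsub>M\<^esub> y) = h x \<ominus>\<^bsub>N\<^esub> h y"
proof -
  interpret M: module K M by fact
  interpret N: module K N by fact
  note h = assms(3)
  have hy: "h y \<in> carrier N" using linear_maps_closed h assms by metis
  have "h (x \<ominus>\<^bsub>M\<^esub> y) = h (x \<oplus>\<^bsub>M\<^esub> (\<ominus>\<^bsub>K\<^esub> \<one>\<^bsub>K\<^esub>) \<odot>\<^bsub>M\<^esub> y)"
    using assms by (simp add: a_minus_def M.smult_l_minus)
  also have "\<dots> = h x \<oplus>\<^bsub>N\<^esub> h ((\<ominus>\<^bsub>K\<^esub> \<one>\<^bsub>K\<^esub>) \<odot>\<^bsub>M\<^esub> y)"
    using assms by (intro linear_maps_add[OF h]) auto
  also have "\<dots> = h x \<oplus>\<^bsub>N\<^esub> (\<ominus>\<^bsub>K\<^esub> \<one>\<^bsub>K\<^esub>) \<odot>\<^bsub>N\<^esub> h y"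
    using assms by (subst linear_maps_smult[OF h]) auto
  also have "\<dots> = h x \<ominus>\<^bsub>N\<^esub> h y" using hy by (simp add: a_minus_def N.smult_l_minus)
  finally show ?thesis .
qed

lemma mem_a_kernel: "x \<in> a_kernel M N h \<longleftrightarrow> x \<in> carrier M \<and> h x = \<zero>\<^bsub>N\<^esub>"
  by (simp add: a_kernel_def')

lemma submodule_vimage:
  assumes "module K M" "module K N" "h \<in> linear_maps K M N" "submodule B K N"
  shows "submodule {x \<in> carrier M. h x \<in> B} K M"
proof -
  interpret M: module K M by fact
  interpret N: module K N by fact
  show ?thesis
    by (rule M.submodule_criterion)
      (use assms N.submoduleE[OF assms(4)] N.submodule_zero[OF assms(4)] in
        \<open>auto simp: linear_maps_add linear_maps_smult linear_maps_zero\<close>)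
qed

lemma submodule_image:
  assumes "module K M" "module K N" "h \<in> linear_maps K M N" "submodule A K M"
  shows "submodule (h ` A) K N"
proof -
  interpret M: module K M by fact
  interpret N: module K N by fact
  note A = M.submoduleE[OF assms(4)] M.submodule_zero[OF assms(4)]
  have A1: "x \<in> carrier M" if "x \<in> A" for x using A(1) that by auto
  show ?thesis
  proof (rule N.submodule_criterion)
    show "h ` A \<subseteq> carrier N" using A1 linear_maps_closed[OF assms(3)] by auto
    show "\<zero>\<^bsub>N\<^esub> \<in> h ` A" using A linear_maps_zero[OF assms(1-3)] by (metis imageI)
    show "x \<oplus>\<^bsub>N\<^esub> y \<in> h ` A" if "x \<in> h ` A" "y \<in> h ` A" for x y
      using that A(5) A1 linear_maps_add[OF assms(3)] by (auto simp: image_iff) metis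
    show "c \<odot>\<^bsub>N\<^esub> x \<in> h ` A" if "c \<in> carrier K" "x \<in> h ` A" for c x
      using that A(4) A1 linear_maps_smult[OF assms(3)] by (auto simp: image_iff) metis
  qed
qed

lemma (in module) submodule_Int:
  assumes "submodule A R M" "submodule B R M" shows "submodule (A \<inter> B) R M"
  by (rule submodule_criterion)
    (use submoduleE[OF assms(1)] submoduleE[OF assms(2)] submodule_zero assms in auto)

section \<open>Quotients\<close>

lemma (in module) coset_add:
  assumes B: "submodule B R M" and x: "x \<in> carrier M" and y: "y \<in> carrier M"
  shows "(B +>\<^bsub>M\<^esub> x) <+>\<^bsub>M\<^esub> (B +>\<^bsub>M\<^esub> y) = B +>\<^bsub>M\<^esub> (x \<oplus>\<^bsub>M\<^esub> y)"
proof -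
  interpret B: abelian_subgroup B M by (rule submodule_abelian_subgroup[OF B])
  show ?thesis by (rule B.a_rcos_sum[OF x y])
qed

lemma (in module) mem_coset_iff:
  assumes B: "submodule B R M" and x: "x \<in> carrier M"
  shows "y \<in> B +>\<^bsub>M\<^esub> x \<longleftrightarrow> y \<in> carrier M \<and> y \<ominus>\<^bsub>M\<^esub> x \<in> B"
proof -
  interpret B: abelian_subgroup B M by (rule submodule_abelian_subgroup[OF B])
  show ?thesis using B.a_rcos_module[OF x] B.a_elemrcos_carrier[OF x] by (auto simp: a_minus_def)
qed

lemma (in module) coset_cong_Union:
  assumes B: "submodule B R M" and X: "x \<in> carrier M"
    and g: "\<And>y. y \<in> B +>\<^bsub>M\<^esub> x \<Longrightarrow> g y = z"
  shows "(\<Union>y\<in>B +>\<^bsub>M\<^esub> x. g y) = z"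
proof -
  interpret B: abelian_subgroup B M by (rule submodule_abelian_subgroup[OF B])
  show ?thesis using g B.a_rcos_self[OF X] by blast
qed

lemma (in module) coset_smult:
  assumes B: "submodule B R M" and x: "x \<in> carrier M" and c: "c \<in> carrier R"
  shows "(\<Union>y\<in>B +>\<^bsub>M\<^esub> x. B +>\<^bsub>M\<^esub> (c \<odot>\<^bsub>M\<^esub> y)) = B +>\<^bsub>M\<^esub> (c \<odot>\<^bsub>M\<^esub> x)"
proof (rule coset_cong_Union[OF B x])
  fix y assume "y \<in> B +>\<^bsub>M\<^esub> x"
  then have y: "y \<in> carrier M" and d: "y \<ominus>\<^bsub>M\<^esub> x \<in> B" using mem_coset_iff[OF B x] by auto
  have "c \<odot>\<^bsub>M\<^esub> y \<ominus>\<^bsub>M\<^esub> c \<odot>\<^bsub>M\<^esub> x = c \<odot>\<^bsub>M\<^esub> (y \<ominus>\<^bsub>M\<^esub> x)"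
    using x y c by (simp add: a_minus_def smult_r_distr smult_r_minus)
  then have "c \<odot>\<^bsub>M\<^esub> y \<ominus>\<^bsub>M\<^esub> c \<odot>\<^bsub>M\<^esub> x \<in> B" using submoduleE(4)[OF B c d] by simp
  then show "B +>\<^bsub>M\<^esub> (c \<odot>\<^bsub>M\<^esub> y) = B +>\<^bsub>M\<^esub> (c \<odot>\<^bsub>M\<^esub> x)" using coset_eq_iff[OF B] x y c by simp
qed

lemma a_r_coset_carrier_update: "B +>\<^bsub>M\<lparr>carrier := A\<rparr>\<^esub> x = B +>\<^bsub>M\<^esub> x"
  by (simp add: a_r_coset_def r_coset_def)

lemma carrier_subquotient:
  "carrier (subquotient M A B) = (\<lambda>a. B +>\<^bsub>M\<^esub> a) ` A"
  by (auto simp: subquotient_def quotient_module_def A_RCOSETS_def' a_r_coset_carrier_update)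

lemma add_subquotient: "X \<oplus>\<^bsub>subquotient M A B\<^esub> Y = X <+>\<^bsub>M\<^esub> Y"
  by (simp add: subquotient_def quotient_module_def set_add_def set_mult_def)

lemma smult_subquotient:
  "c \<odot>\<^bsub>subquotient M A B\<^esub> X = (\<Union>x\<in>X. B +>\<^bsub>M\<^esub> (c \<odot>\<^bsub>M\<^esub> x))"
  by (simp add: subquotient_def quotient_module_def a_r_coset_carrier_update)

lemma carrier_quotient_module: "carrier (quotient_module M B) = (\<lambda>a. B +>\<^bsub>M\<^esub> a) ` carrier M"
  by (auto simp: quotient_module_def A_RCOSETS_def')

lemma quotient_module_linear:
  assumes "module K M" "submodule B K M"
  shows "(\<lambda>x. B +>\<^bsub>M\<^esub> x) \<in> linear_maps K M (quotient_module M B)"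
proof -
  interpret module K M by fact
  show ?thesis unfolding linear_maps_def
    using coset_add[OF assms(2)] coset_smult[OF assms(2)]
    by (auto simp: carrier_quotient_module) (auto simp: quotient_module_def)
qed

lemma module_surjective_image:
  assumes M: "module K M" and h: "h \<in> linear_maps K M N" and surj: "h ` carrier M = carrier N"
    and zero: "h \<zero>\<^bsub>M\<^esub> = \<zero>\<^bsub>N\<^esub>"
  shows "module K N"
proof -
  interpret module K M by fact
  have ex: "\<exists>a\<in>carrier M. x = h a" if "x \<in> carrier N" for x using that surj by auto
  note lm = linear_maps_add[OF h, symmetric] linear_maps_smult[OF h, symmetric]
    linear_maps_closed[OF h]
  have abel: "abelian_group N"
  proof (rule abelian_groupI)
    fix x y z assume "x \<in> carrier N" "y \<in> carrier N" "z \<in> carrier N"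
    then obtain a b c where "a \<in> carrier M" "b \<in> carrier M" "c \<in> carrier M" "x = h a" "y = h b"
        "z = h c"
      using ex by metis
    then show "x \<oplus>\<^bsub>N\<^esub> y \<in> carrier N" "x \<oplus>\<^bsub>N\<^esub> y = y \<oplus>\<^bsub>N\<^esub> x"
      "x \<oplus>\<^bsub>N\<^esub> y \<oplus>\<^bsub>N\<^esub> z = x \<oplus>\<^bsub>N\<^esub> (y \<oplus>\<^bsub>N\<^esub> z)" by (auto simp: lm M.a_ac)
  next
    show "\<zero>\<^bsub>N\<^esub> \<in> carrier N" using zero lm(3) by (metis M.zero_closed)
  next
    fix x assume "x \<in> carrier N"
    then obtain a where a: "a \<in> carrier M" "x = h a" using ex by auto
    then show "\<zero>\<^bsub>N\<^esub> \<oplus>\<^bsub>N\<^esub> x = x"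
      using linear_maps_add[OF h, of "\<zero>\<^bsub>M\<^esub>" a] zero by simp
    from a have "h (\<ominus>\<^bsub>M\<^esub> a) \<oplus>\<^bsub>N\<^esub> x = \<zero>\<^bsub>N\<^esub>" using zero by (simp add: lm M.l_neg)
    then show "\<exists>y\<in>carrier N. y \<oplus>\<^bsub>N\<^esub> x = \<zero>\<^bsub>N\<^esub>"
      by (rule bexI[where x = "h (\<ominus>\<^bsub>M\<^esub> a)"]) (simp add: a lm(3))
  qed
  show ?thesis
  proof (rule moduleI[OF is_cring abel])
    fix c d x y assume c: "c \<in> carrier K" "d \<in> carrier K" and "x \<in> carrier N" "y \<in> carrier N"
    then obtain a b where "a \<in> carrier M" "b \<in> carrier M" "x = h a" "y = h b"
      using ex by metis
    with c show "c \<odot>\<^bsub>N\<^esub> x \<in> carrier N"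
      "(c \<oplus>\<^bsub>K\<^esub> d) \<odot>\<^bsub>N\<^esub> x = c \<odot>\<^bsub>N\<^esub> x \<oplus>\<^bsub>N\<^esub> d \<odot>\<^bsub>N\<^esub> x"
      "c \<odot>\<^bsub>N\<^esub> (x \<oplus>\<^bsub>N\<^esub> y) = c \<odot>\<^bsub>N\<^esub> x \<oplus>\<^bsub>N\<^esub> c \<odot>\<^bsub>N\<^esub> y"
      "(c \<otimes>\<^bsub>K\<^esub> d) \<odot>\<^bsub>N\<^esub> x = c \<odot>\<^bsub>N\<^esub> (d \<odot>\<^bsub>N\<^esub> x)"
      by (simp_all add: lm smult_l_distr smult_r_distr smult_assoc1)
  next
    show "\<one>\<^bsub>K\<^esub> \<odot>\<^bsub>N\<^esub> x = x" if "x \<in> carrier N" for x using ex[OF that] by (auto simp: lm)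
  qed
qed

lemma module_quotient:
  assumes "module K M" "submodule B K M"
  shows "module K (quotient_module M B)"
proof (rule module_surjective_image[OF assms(1) quotient_module_linear[OF assms]])
  interpret module K M by fact
  interpret B: abelian_subgroup B M by (rule submodule_abelian_subgroup[OF assms(2)])
  show "(+>\<^bsub>M\<^esub>) B \<zero>\<^bsub>M\<^esub> = \<zero>\<^bsub>quotient_module M B\<^esub>"
    using B.a_rcos_const[OF submodule_zero[OF assms(2)]] by (simp add: quotient_module_def)
qed (simp add: carrier_quotient_module)

text \<open>
  Two subquotients are isomorphic as soon as some module maps onto both with the same kernel. This
  avoids choosing preimages when a connecting map is only given as a relation.
\<close>

lemma linearly_isomorphic_subquotients:
  assumes W: "module K W" and M: "module K M" and N: "module K N"
    and B: "submodule B K M" and D: "submodule D K N"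
    and p: "p \<in> linear_maps K W M" and q: "q \<in> linear_maps K W N"
    and A: "A \<subseteq> carrier M" and C: "C \<subseteq> carrier N"
    and pA: "\<And>x. x \<in> carrier W \<Longrightarrow> p x \<in> A" and qC: "\<And>x. x \<in> carrier W \<Longrightarrow> q x \<in> C"
    and p_surj: "\<And>a. a \<in> A \<Longrightarrow> \<exists>x\<in>carrier W. p x \<ominus>\<^bsub>M\<^esub> a \<in> B"
    and q_surj: "\<And>c. c \<in> C \<Longrightarrow> \<exists>x\<in>carrier W. q x \<ominus>\<^bsub>N\<^esub> c \<in> D"
    and kernels: "\<And>x. x \<in> carrier W \<Longrightarrow> p x \<in> B \<longleftrightarrow> q x \<in> D"
  shows "linearly_isomorphic K (subquotient M A B) (subquotient N C D)"
proof -
  interpret W: module K W by fact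
  interpret M: module K M by fact
  interpret N: module K N by fact
  define P Q where "P x = B +>\<^bsub>M\<^esub> p x" and "Q x = D +>\<^bsub>N\<^esub> q x" for x
  note cl = linear_maps_closed[OF p] linear_maps_closed[OF q]
  have PQ: "P x = P y \<longleftrightarrow> Q x = Q y" if "x \<in> carrier W" "y \<in> carrier W" for x y
    unfolding P_def Q_def using kernels[of "x \<ominus>\<^bsub>W\<^esub> y"] that
    by (simp add: M.coset_eq_iff[OF B] N.coset_eq_iff[OF D] cl
        linear_maps_minus[OF W M p] linear_maps_minus[OF W N q])
  have carP: "carrier (subquotient M A B) = P ` carrier W"
  proof -
    have "B +>\<^bsub>M\<^esub> a \<in> P ` carrier W" if a: "a \<in> A" for a
    proof -
      obtain x where "x \<in> carrier W" "p x \<ominus>\<^bsub>M\<^esub> a \<in> B" using p_surj a by auto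
      then have "P x = B +>\<^bsub>M\<^esub> a" unfolding P_def using subsetD[OF A a]
        by (simp add: M.coset_eq_iff[OF B] cl)
      then show ?thesis using \<open>x \<in> carrier W\<close> by (metis imageI)
    qed
    then show ?thesis using pA by (auto simp: carrier_subquotient P_def)
  qed
  have carQ: "carrier (subquotient N C D) = Q ` carrier W"
  proof -
    have "D +>\<^bsub>N\<^esub> a \<in> Q ` carrier W" if a: "a \<in> C" for a
    proof -
      obtain x where "x \<in> carrier W" "q x \<ominus>\<^bsub>N\<^esub> a \<in> D" using q_surj a by auto
      then have "Q x = D +>\<^bsub>N\<^esub> a" unfolding Q_def using subsetD[OF C a]
        by (simp add: N.coset_eq_iff[OF D] cl)
      then show ?thesis using \<open>x \<in> carrier W\<close> by (metis imageI)
    qed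
    then show ?thesis using qC by (auto simp: carrier_subquotient Q_def)
  qed
  define h where "h X = Q (SOME x. x \<in> carrier W \<and> P x = X)" for X
  have hP: "h (P x) = Q x" if x: "x \<in> carrier W" for x
    unfolding h_def by (rule someI2[where a = x]) (use x PQ in auto)
  have addP: "P x \<oplus>\<^bsub>subquotient M A B\<^esub> P y = P (x \<oplus>\<^bsub>W\<^esub> y)"
    and addQ: "Q x \<oplus>\<^bsub>subquotient N C D\<^esub> Q y = Q (x \<oplus>\<^bsub>W\<^esub> y)"
    if "x \<in> carrier W" "y \<in> carrier W" for x y
    using that by (simp_all add: P_def Q_def add_subquotient M.coset_add[OF B] N.coset_add[OF D] cl
        linear_maps_add[OF p] linear_maps_add[OF q])
  have smultP: "c \<odot>\<^bsub>subquotient M A B\<^esub> P x = P (c \<odot>\<^bsub>W\<^esub> x)"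
    and smultQ: "c \<odot>\<^bsub>subquotient N C D\<^esub> Q x = Q (c \<odot>\<^bsub>W\<^esub> x)"
    if "c \<in> carrier K" "x \<in> carrier W" for c x
    using that by (simp_all add: P_def Q_def smult_subquotient M.coset_smult[OF B]
        N.coset_smult[OF D] cl linear_maps_smult[OF p] linear_maps_smult[OF q])
  have "h \<in> linear_maps K (subquotient M A B) (subquotient N C D)"
    unfolding linear_maps_def carP carQ by (auto simp: hP addP addQ smultP smultQ)
  moreover have "bij_betw h (carrier (subquotient M A B)) (carrier (subquotient N C D))"
    unfolding carP carQ bij_betw_def inj_on_def using PQ by (auto simp: hP image_iff)
  ultimately show ?thesis unfolding linearly_isomorphic_def by blast
qed

section \<open>Homomorphisms and ideals\<close>

lemma lie_n_algebra_module: "lie_n_algebra n K A \<Longrightarrow> module K A"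
  by (simp add: lie_n_algebra_def)

lemma lie_hom_linear: "h \<in> lie_hom n K A B \<Longrightarrow> h \<in> linear_maps K A B"
  by (simp add: lie_hom_def)

lemma lie_hom_bracket:
  "\<lbrakk>h \<in> lie_hom n K A B; ls \<in> tuples n (carrier A)\<rbrakk> \<Longrightarrow> h (bracket A ls) = bracket B (map h ls)"
  by (simp add: lie_hom_def)

lemma lie_hom_closed: "\<lbrakk>h \<in> lie_hom n K A B; x \<in> carrier A\<rbrakk> \<Longrightarrow> h x \<in> carrier B"
  by (rule linear_maps_closed[OF lie_hom_linear])

lemma lie_hom_zero:
  "\<lbrakk>lie_n_algebra n K A; lie_n_algebra n K B; h \<in> lie_hom n K A B\<rbrakk> \<Longrightarrow> h \<zero>\<^bsub>A\<^esub> = \<zero>\<^bsub>B\<^esub>"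
  by (rule linear_maps_zero[OF lie_n_algebra_module lie_n_algebra_module lie_hom_linear])

lemma lie_hom_minus:
  "\<lbrakk>lie_n_algebra n K A; lie_n_algebra n K B; h \<in> lie_hom n K A B; x \<in> carrier A; y \<in> carrier A\<rbrakk>
    \<Longrightarrow> h (x \<ominus>\<^bsub>A\<^esub> y) = h x \<ominus>\<^bsub>B\<^esub> h y"
  by (rule linear_maps_minus[OF lie_n_algebra_module lie_n_algebra_module lie_hom_linear])

lemma tuples_map: "\<lbrakk>ls \<in> tuples n X; \<And>x. x \<in> X \<Longrightarrow> h x \<in> Y\<rbrakk> \<Longrightarrow> map h ls \<in> tuples n Y"
  by (auto simp: tuples_def)

lemma tuples_update: "\<lbrakk>ls \<in> tuples n X; x \<in> X\<rbrakk> \<Longrightarrow> ls[i := x] \<in> tuples n X"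
  using set_update_subset_insert[of ls i x] by (auto simp: tuples_def)

lemma tuples_nth: "\<lbrakk>ls \<in> tuples n X; i < n\<rbrakk> \<Longrightarrow> ls ! i \<in> X"
  by (auto simp: tuples_def)

lemma tuples_iff_nth: "ls \<in> tuples n X \<longleftrightarrow> length ls = n \<and> (\<forall>i<n. ls ! i \<in> X)"
  by (auto simp: tuples_def in_set_conv_nth subset_iff)

lemma lie_hom_compose:
  assumes "h \<in> lie_hom n K A B" "g \<in> lie_hom n K B C"
  shows "(\<lambda>x. g (h x)) \<in> lie_hom n K A C"
proof -
  note lm = lie_hom_linear[OF assms(1)] lie_hom_linear[OF assms(2)]
  have "(\<lambda>x. g (h x)) \<in> linear_maps K A C"
    using lm by (auto simp: linear_maps_def Pi_iff)
  moreover have "g (h (bracket A ls)) = bracket C (map (\<lambda>x. g (h x)) ls)"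
    if ls: "ls \<in> tuples n (carrier A)" for ls
    using lie_hom_bracket[OF assms(1) ls]
      lie_hom_bracket[OF assms(2) tuples_map[OF ls lie_hom_closed[OF assms(1)]]]
    by (simp add: comp_def)
  ultimately show ?thesis unfolding lie_hom_def by auto
qed

lemma lie_hom_id: "(\<lambda>x. x) \<in> lie_hom n K A A"
  by (auto simp: lie_hom_def linear_maps_def)

context lie_n_algebra
begin

lemma bracket_zero:
  assumes "ls \<in> tuples n (carrier L)" "i < n" "ls ! i = \<zero>\<^bsub>L\<^esub>"
  shows "bracket L ls = \<zero>\<^bsub>L\<^esub>"
proof -
  have "bracket L (ls[i := \<zero> \<odot>\<^bsub>L\<^esub> \<zero>\<^bsub>L\<^esub>]) = \<zero> \<odot>\<^bsub>L\<^esub> bracket L (ls[i := \<zero>\<^bsub>L\<^esub>])"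
    using assms by (intro bracket_smult) auto
  moreover have "ls[i := \<zero>\<^bsub>L\<^esub>] = ls" using assms(3) by (metis list_update_id)
  ultimately show ?thesis using assms bracket_closed[OF assms(1)] by simp
qed

lemma bracket_minus:
  assumes "ls \<in> tuples n (carrier L)" "i < n" "x \<in> carrier L" "y \<in> carrier L"
  shows "bracket L (ls[i := x \<ominus>\<^bsub>L\<^esub> y]) = bracket L (ls[i := x]) \<ominus>\<^bsub>L\<^esub> bracket L (ls[i := y])"
proof -
  have cl: "bracket L (ls[i := z]) \<in> carrier L" if "z \<in> carrier L" for z
    using assms(1) that by (intro bracket_closed tuples_update)
  have "bracket L (ls[i := x \<ominus>\<^bsub>L\<^esub> y]) = bracket L (ls[i := x \<oplus>\<^bsub>L\<^esub> (\<ominus> \<one>) \<odot>\<^bsub>L\<^esub> y])"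
    using assms by (simp add: a_minus_def smult_l_minus)
  also have "\<dots> = bracket L (ls[i := x]) \<oplus>\<^bsub>L\<^esub> (\<ominus> \<one>) \<odot>\<^bsub>L\<^esub> bracket L (ls[i := y])"
    using assms by (simp add: bracket_add bracket_smult)
  finally show ?thesis using cl assms by (simp add: a_minus_def smult_l_minus)
qed

lemma bracket_finsum:
  assumes ls: "ls \<in> tuples n (carrier L)" and i: "i < n" and T: "finite T"
    and x: "\<And>t. t \<in> T \<Longrightarrow> x t \<in> carrier L"
  shows "bracket L (ls[i := (\<Oplus>\<^bsub>L\<^esub>t\<in>T. x t)]) = (\<Oplus>\<^bsub>L\<^esub>t\<in>T. bracket L (ls[i := x t]))"
  using T x
proof (induction T)
  case empty
  show ?case using ls i tuples_update[OF ls M.zero_closed]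
    by (simp add: bracket_zero[of _ i] tuples_def)
next
  case (insert t T)
  have "bracket L (ls[i := x s]) \<in> carrier L" if "s \<in> insert t T" for s
    using ls insert.prems that by (intro bracket_closed tuples_update) auto
  then show ?case using insert ls i by (simp add: bracket_add Pi_def)
qed

lemma lie_ideal_carrier: "lie_ideal n K L (carrier L)"
  unfolding lie_ideal_def using carrier_is_submodule bracket_closed by auto

lemma lie_ideal_zero: "lie_ideal n K L {\<zero>\<^bsub>L\<^esub>}"
  unfolding lie_ideal_def using bracket_zero by (auto intro!: submodule_criterion)

lemma lie_ideal_Inter:
  assumes "\<And>N. N \<in> F \<Longrightarrow> lie_ideal n K L N" "F \<noteq> {}"
  shows "lie_ideal n K L (\<Inter>F)"
proof -
  have s: "submodule N K L" if "N \<in> F" for N using assms(1)[OF that] by (simp add: lie_ideal_def)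
  have "submodule (\<Inter>F) K L"
  proof (rule submodule_criterion)
    show "\<Inter>F \<subseteq> carrier L" using assms(2) submoduleE(1)[OF s] by blast
  qed (use submoduleE(4,5)[OF s] submodule_zero[OF s] in auto)
  then show ?thesis using assms(1) unfolding lie_ideal_def by blast
qed

lemma lie_ideal_generated:
  assumes "S \<subseteq> carrier L" shows "lie_ideal n K L (generated_ideal n K L S)"
  unfolding generated_ideal_def using lie_ideal_carrier assms by (intro lie_ideal_Inter) auto

lemma lie_ideal_Int:
  "\<lbrakk>lie_ideal n K L A; lie_ideal n K L B\<rbrakk> \<Longrightarrow> lie_ideal n K L (A \<inter> B)"
  using lie_ideal_Inter[of "{A, B}"] by auto

lemma lie_ideal_commutator:
  assumes "\<And>j. j < n \<Longrightarrow> N j \<subseteq> carrier L"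
  shows "lie_ideal n K L (commutator_ideal n K L N)"
  unfolding commutator_ideal_def
proof (rule lie_ideal_generated, clarify)
  fix ls assume "\<forall>i<length ls. ls ! i \<in> N i" "n = length ls"
  then show "bracket L ls \<in> carrier L"
    using assms by (intro bracket_closed) (auto simp: tuples_iff_nth)
qed

lemma lie_ideal_derived: "lie_ideal n K L (derived_ideal n K L)"
  unfolding derived_ideal_def by (rule lie_ideal_commutator) auto

lemma derived_submodule: "submodule (derived_ideal n K L) K L"
  using lie_ideal_derived by (simp add: lie_ideal_def)

text \<open>A subspace that contains all brackets is automatically an ideal.\<close>

lemma derived_subset:
  assumes "submodule N K L" "\<And>ls. ls \<in> tuples n (carrier L) \<Longrightarrow> bracket L ls \<in> N"
  shows "derived_ideal n K L \<subseteq> N"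
proof -
  have "lie_ideal n K L N" using assms unfolding lie_ideal_def by auto
  moreover have "{bracket L ls |ls. length ls = n \<and> (\<forall>i<n. ls ! i \<in> carrier L)} \<subseteq> N"
    using assms(2) by (auto simp: tuples_iff_nth)
  ultimately show ?thesis
    unfolding derived_ideal_def commutator_ideal_def generated_ideal_def by auto
qed

text \<open>
  The entry of a bracket at one place can be expanded along a finite sum, which makes the sum of
  ideals an ideal again, and then the smallest one that contains the summands.
\<close>

lemma sum_of_ideals:
  assumes T: "finite T" and N: "\<And>t. t \<in> T \<Longrightarrow> lie_ideal n K L (N t)"
  shows "lie_ideal n K L (sum_of_ideals L T N)"
    and "\<And>t. t \<in> T \<Longrightarrow> N t \<subseteq> sum_of_ideals L T N"
    and "\<And>M. \<lbrakk>submodule M K L; \<And>t. t \<in> T \<Longrightarrow> N t \<subseteq> M\<rbrakk> \<Longrightarrow> sum_of_ideals L T N \<subseteq> M"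
proof -
  have s: "submodule (N t) K L" if "t \<in> T" for t using N[OF that] by (simp add: lie_ideal_def)
  have sc: "N t \<subseteq> carrier L" if "t \<in> T" for t using submoduleE(1)[OF s[OF that]] .
  show "lie_ideal n K L (sum_of_ideals L T N)"
    unfolding lie_ideal_def
  proof (intro conjI ballI impI)
    show "submodule (sum_of_ideals L T N) K L"
    proof (rule submodule_criterion)
      show "sum_of_ideals L T N \<subseteq> carrier L"
        unfolding sum_of_ideals_def using sc by (auto intro!: M.finsum_closed)
      show "\<zero>\<^bsub>L\<^esub> \<in> sum_of_ideals L T N"
        unfolding sum_of_ideals_def using submodule_zero[OF s]
        by (intro CollectI exI[of _ "\<lambda>_. \<zero>\<^bsub>L\<^esub>"]) simp
      show "x \<oplus>\<^bsub>L\<^esub> y \<in> sum_of_ideals L T N"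
        if xy: "x \<in> sum_of_ideals L T N" "y \<in> sum_of_ideals L T N" for x y
      proof -
        obtain a b where a: "x = (\<Oplus>\<^bsub>L\<^esub>t\<in>T. a t)" "\<forall>t\<in>T. a t \<in> N t"
          and b: "y = (\<Oplus>\<^bsub>L\<^esub>t\<in>T. b t)" "\<forall>t\<in>T. b t \<in> N t"
          using xy unfolding sum_of_ideals_def by auto
        have "x \<oplus>\<^bsub>L\<^esub> y = (\<Oplus>\<^bsub>L\<^esub>t\<in>T. a t \<oplus>\<^bsub>L\<^esub> b t)"
          using a b sc by (subst M.finsum_addf) (auto simp: subset_iff)
        moreover have "\<forall>t\<in>T. a t \<oplus>\<^bsub>L\<^esub> b t \<in> N t" using a b submoduleE(5)[OF s] by auto
        ultimately show ?thesis unfolding sum_of_ideals_def by blast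
      qed
      show "c \<odot>\<^bsub>L\<^esub> x \<in> sum_of_ideals L T N"
        if c: "c \<in> carrier K" and x: "x \<in> sum_of_ideals L T N" for c x
      proof -
        obtain a where a: "x = (\<Oplus>\<^bsub>L\<^esub>t\<in>T. a t)" "\<forall>t\<in>T. a t \<in> N t"
          using x unfolding sum_of_ideals_def by auto
        have "c \<odot>\<^bsub>L\<^esub> x = (\<Oplus>\<^bsub>L\<^esub>t\<in>T. c \<odot>\<^bsub>L\<^esub> a t)"
          using a c sc T by (subst a, subst finsum_smult_ldistr) (auto simp: subset_iff)
        moreover have "\<forall>t\<in>T. c \<odot>\<^bsub>L\<^esub> a t \<in> N t" using a c submoduleE(4)[OF s] by auto
        ultimately show ?thesis unfolding sum_of_ideals_def by blast
      qed
    qed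
    fix ls assume ls: "ls \<in> tuples n (carrier L)" and "\<exists>i<n. ls ! i \<in> sum_of_ideals L T N"
    then obtain i a where i: "i < n" and a: "ls ! i = (\<Oplus>\<^bsub>L\<^esub>t\<in>T. a t)" "\<forall>t\<in>T. a t \<in> N t"
      unfolding sum_of_ideals_def by auto
    have ac: "a t \<in> carrier L" if "t \<in> T" for t using a sc that by auto
    have "bracket L ls = (\<Oplus>\<^bsub>L\<^esub>t\<in>T. bracket L (ls[i := a t]))"
      using bracket_finsum[of ls i T a] ls i T ac unfolding a(1)[symmetric] by simp
    moreover have "bracket L (ls[i := a t]) \<in> N t" if t: "t \<in> T" for t
    proof -
      have "ls[i := a t] ! i \<in> N t" using a t i ls by (simp add: tuples_def)
      then show ?thesis
        using N[OF t] i tuples_update[OF ls ac[OF t], of i] unfolding lie_ideal_def by blast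
    qed
    ultimately show "bracket L ls \<in> sum_of_ideals L T N" unfolding sum_of_ideals_def by blast
  qed
  show "N t \<subseteq> sum_of_ideals L T N" if t: "t \<in> T" for t
  proof
    fix y assume y: "y \<in> N t"
    have "y = (\<Oplus>\<^bsub>L\<^esub>s\<in>T. if t = s then y else \<zero>\<^bsub>L\<^esub>)"
      using M.finsum_singleton[OF t T, of "\<lambda>_. y"] y sc[OF t] by auto
    moreover have "\<forall>s\<in>T. (if t = s then y else \<zero>\<^bsub>L\<^esub>) \<in> N s" using y submodule_zero[OF s] by auto
    ultimately show "y \<in> sum_of_ideals L T N" unfolding sum_of_ideals_def by fast
  qed
  show "sum_of_ideals L T N \<subseteq> M" if M: "submodule M K L" "\<And>t. t \<in> T \<Longrightarrow> N t \<subseteq> M" for M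
  proof -
    have "(\<Oplus>\<^bsub>L\<^esub>t\<in>U. x t) \<in> M" if "finite U" "\<forall>t\<in>U. x t \<in> M" for x and U :: "'c set"
      using that
    proof (induction U)
      case empty then show ?case by (simp add: submodule_zero[OF M(1)])
    next
      case (insert t U)
      then show ?case using submoduleE(1,5)[OF M(1)] by (subst M.finsum_insert) auto
    qed
    then show ?thesis unfolding sum_of_ideals_def using T M(2) by blast
  qed
qed

end

lemma lie_ideal_vimage:
  assumes "lie_n_algebra n K A" "lie_n_algebra n K B" "h \<in> lie_hom n K A B" "lie_ideal n K B N"
  shows "lie_ideal n K A {x \<in> carrier A. h x \<in> N}"
proof -
  interpret A: lie_n_algebra n K A by fact
  have "bracket A ls \<in> carrier A \<and> h (bracket A ls) \<in> N"
    if ls: "ls \<in> tuples n (carrier A)" and i: "i < n" "h (ls ! i) \<in> N" for ls i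
  proof -
    have m: "map h ls \<in> tuples n (carrier B)"
      by (rule tuples_map[OF ls lie_hom_closed[OF assms(3)]])
    have "map h ls ! i \<in> N" using i ls by (simp add: tuples_def)
    then show ?thesis
      using m i assms(4) lie_hom_bracket[OF assms(3) ls] A.bracket_closed[OF ls]
      unfolding lie_ideal_def by metis
  qed
  then show ?thesis
    using submodule_vimage[OF lie_n_algebra_module lie_n_algebra_module lie_hom_linear] assms
    unfolding lie_ideal_def by fast
qed

lemma lie_ideal_image:
  assumes A: "lie_n_algebra n K A" and B: "lie_n_algebra n K B" and h: "h \<in> lie_hom n K A B"
    and N: "lie_ideal n K A N" and surj: "h ` carrier A = carrier B"
  shows "lie_ideal n K B (h ` N)"
  unfolding lie_ideal_def
proof (intro conjI ballI impI)
  interpret A: lie_n_algebra n K A by fact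
  have sN: "submodule N K A" using N by (simp add: lie_ideal_def)
  show "submodule (h ` N) K B"
    by (rule submodule_image[OF lie_n_algebra_module[OF A] lie_n_algebra_module[OF B]
          lie_hom_linear[OF h] sN])
  fix ls assume ls: "ls \<in> tuples n (carrier B)" and "\<exists>i<n. ls ! i \<in> h ` N"
  then obtain i y where i: "i < n" and y: "y \<in> N" "ls ! i = h y" by auto
  define g where "g j = (if j = i then y else inv_into (carrier A) h (ls ! j))" for j
  define ks where "ks = map g [0..<n]"
  have g: "g j \<in> carrier A \<and> h (g j) = ls ! j" if j: "j < n" for j
    unfolding g_def using y A.submoduleE(1)[OF sN] tuples_nth[OF ls j] surj
    by (auto simp: inv_into_into f_inv_into_f)
  have ks: "ks \<in> tuples n (carrier A)" using g by (simp add: tuples_iff_nth ks_def)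
  have "map h ks = ls" using ls g by (auto simp: ks_def tuples_def intro!: nth_equalityI)
  then have "h (bracket A ks) = bracket B ls" using lie_hom_bracket[OF h ks] by simp
  moreover have "ks ! i \<in> N" using i y by (simp add: ks_def g_def)
  then have "bracket A ks \<in> N" using N ks i unfolding lie_ideal_def by blast
  ultimately show "bracket B ls \<in> h ` N" by (metis imageI)
qed

lemma lie_ideal_kernel:
  assumes "lie_n_algebra n K A" "lie_n_algebra n K B" "h \<in> lie_hom n K A B"
  shows "lie_ideal n K A (a_kernel A B h)"
proof -
  interpret B: lie_n_algebra n K B by fact
  have "a_kernel A B h = {x \<in> carrier A. h x \<in> {\<zero>\<^bsub>B\<^esub>}}" by (auto simp: a_kernel_def')
  then show ?thesis using lie_ideal_vimage[OF assms B.lie_ideal_zero] by simp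
qed

lemma derived_ideal_bracket:
  "ls \<in> tuples n (carrier A) \<Longrightarrow> bracket A ls \<in> derived_ideal n K A"
  unfolding derived_ideal_def commutator_ideal_def generated_ideal_def tuples_iff_nth by blast

lemma derived_ideal_map:
  assumes A: "lie_n_algebra n K A" and B: "lie_n_algebra n K B" and h: "h \<in> lie_hom n K A B"
    and x: "x \<in> derived_ideal n K A"
  shows "h x \<in> derived_ideal n K B"
proof -
  interpret A: lie_n_algebra n K A by fact
  interpret B: lie_n_algebra n K B by fact
  have "derived_ideal n K A \<subseteq> {x \<in> carrier A. h x \<in> derived_ideal n K B}"
  proof (rule A.derived_subset)
    show "submodule {x \<in> carrier A. h x \<in> derived_ideal n K B} K A"
      using lie_ideal_vimage[OF A B h B.lie_ideal_derived] by (simp add: lie_ideal_def)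
    fix ls assume ls: "ls \<in> tuples n (carrier A)"
    then show "bracket A ls \<in> {x \<in> carrier A. h x \<in> derived_ideal n K B}"
      using lie_hom_bracket[OF h ls] A.bracket_closed[OF ls]
        derived_ideal_bracket[OF tuples_map[OF ls lie_hom_closed[OF h]]] by simp
  qed
  then show ?thesis using x by auto
qed

section \<open>Free Lie n-algebras\<close>

lemma (in abelian_monoid) foldr_add_conv_finsum:
  assumes "distinct xs" "\<And>i. i \<in> set xs \<Longrightarrow> g i \<in> carrier G"
  shows "foldr (\<oplus>) (map g xs) \<zero> = (\<Oplus>i\<in>set xs. g i)"
  using assms by (induction xs) (auto simp: finsum_insert)

text \<open>
  The bound \<open>1 \<le> n\<close> ensures that the nested brackets of the derivation identity are \<open>n\<close>-tuples.
\<close>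

locale ground = field K for n :: nat and K :: "('k, 'r) ring_scheme" (structure) +
  assumes n_pos: "1 \<le> n"
begin

lemma sign_closed: "[sign \<sigma>] \<cdot> \<one> \<in> carrier K"
  by (simp add: add.int_pow_closed)

lemma free_terms_tuples:
  "Brk ts \<in> free_terms n K X" if "ts \<in> tuples n (free_terms n K X)"
  using that by (auto simp: tuples_def intro: free_terms.intros)

lemma free_terms_foldr:
  "set ts \<subseteq> free_terms n K X \<Longrightarrow> foldr Add ts Zero \<in> free_terms n K X"
  by (induction ts) (auto intro: free_terms.intros)

lemma tuples_Cons: "\<lbrakk>x \<in> A; xs \<in> tuples (n - 1) A\<rbrakk> \<Longrightarrow> x # xs \<in> tuples n A"
  using n_pos by (auto simp: tuples_def)

lemma tuples_permute:
  assumes "ts \<in> tuples n A" "\<sigma> permutes {..<n}" shows "permute_list \<sigma> ts \<in> tuples n A"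
  using assms by (auto simp: tuples_def)

lemma free_cong_terms:
  "free_cong n K X s t \<Longrightarrow> s \<in> free_terms n K X \<and> t \<in> free_terms n K X"
proof (induction rule: free_cong.induct)
  case (cong_Brk ts i t')
  then show ?case by (auto intro!: free_terms_tuples tuples_update)
next
  case (Brk_derivation ts ts')
  then have "Brk (ts[i := Brk ((ts ! i) # ts')]) \<in> free_terms n K X" if "i < n" for i
    using that by (intro free_terms_tuples tuples_update tuples_Cons) (auto simp: tuples_nth)
  then have "foldr Add (map (\<lambda>i. Brk (ts[i := Brk ((ts ! i) # ts')])) [0..<n]) Zero \<in>
      free_terms n K X"
    by (intro free_terms_foldr) auto
  moreover have "Brk (Brk ts # ts') \<in> free_terms n K X"
    using Brk_derivation by (intro free_terms_tuples tuples_Cons) auto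
  ultimately show ?case by simp
next
  case (Brk_sign ts \<sigma>)
  then show ?case
    by (auto intro!: free_terms_tuples free_terms.intros(4) sign_closed tuples_permute)
qed (auto intro!: free_terms.intros(2-4) free_terms_tuples tuples_update)

text \<open>
  The congruence rule for brackets replaces one entry; all entries are replaced from left to right.
\<close>

lemma free_cong_Brk_all:
  assumes ts: "ts \<in> tuples n (free_terms n K X)" and ts': "ts' \<in> tuples n (free_terms n K X)"
    and eq: "\<And>i. i < n \<Longrightarrow> free_cong n K X (ts ! i) (ts' ! i)"
  shows "free_cong n K X (Brk ts) (Brk ts')"
proof -
  have len: "length ts = n" "length ts' = n" using ts ts' by (auto simp: tuples_def)
  have "free_cong n K X (Brk ts) (Brk (take k ts' @ drop k ts))" if "k \<le> n" for k
    using that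
  proof (induction k)
    case 0
    show ?case using ts by (auto intro: cong_refl free_terms_tuples)
  next
    case (Suc k)
    let ?us = "take k ts' @ drop k ts"
    have us: "?us \<in> tuples n (free_terms n K X)"
      using ts ts' Suc.prems set_take_subset[of k ts'] set_drop_subset[of k ts]
      by (auto simp: tuples_def)
    have "?us ! k = ts ! k" using len Suc.prems by (simp add: nth_append)
    moreover have "?us[k := ts' ! k] = take (Suc k) ts' @ drop (Suc k) ts"
      using len Suc.prems by (intro nth_equalityI) (auto simp: nth_list_update nth_append
          less_Suc_eq)
    ultimately have "free_cong n K X (Brk ?us) (Brk (take (Suc k) ts' @ drop (Suc k) ts))"
      using cong_Brk[OF us, of k "ts' ! k"] eq[of k] Suc.prems by simp
    then show ?case using Suc by (meson Suc_leD cong_trans)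
  qed
  from this[of n] show ?thesis using len by simp
qed

lemma free_rep_cong: "t \<in> free_terms n K X \<Longrightarrow> free_cong n K X t (free_rep n K X t)"
  unfolding free_rep_def by (rule someI[of _ t]) (rule cong_refl)

lemma free_rep_eq_iff:
  assumes "s \<in> free_terms n K X" "t \<in> free_terms n K X"
  shows "free_rep n K X s = free_rep n K X t \<longleftrightarrow> free_cong n K X s t"
proof
  show "free_cong n K X s t" if "free_rep n K X s = free_rep n K X t"
    using free_rep_cong assms that by (metis cong_sym cong_trans)
  assume "free_cong n K X s t"
  then have "free_cong n K X s = free_cong n K X t" by (blast intro: cong_sym cong_trans)
  then show "free_rep n K X s = free_rep n K X t" unfolding free_rep_def by simp
qed

lemma free_rep_eqI: "free_cong n K X s t \<Longrightarrow> free_rep n K X s = free_rep n K X t"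
  using free_rep_eq_iff free_cong_terms by blast

lemma free_rep_terms: "t \<in> free_terms n K X \<Longrightarrow> free_rep n K X t \<in> free_terms n K X"
  using free_rep_cong free_cong_terms by blast

lemma free_rep_idem:
  "t \<in> free_terms n K X \<Longrightarrow> free_rep n K X (free_rep n K X t) = free_rep n K X t"
  using free_rep_cong by (metis free_rep_eqI)

lemma free_rep_Add:
  assumes "s \<in> free_terms n K X" "t \<in> free_terms n K X"
  shows "free_rep n K X (Add (free_rep n K X s) t) = free_rep n K X (Add s t)"
    and "free_rep n K X (Add s (free_rep n K X t)) = free_rep n K X (Add s t)"
  using assms by (auto intro!: free_rep_eqI cong_Add intro: cong_refl cong_sym[OF free_rep_cong])

lemma free_rep_Smult:
  assumes "c \<in> carrier K" "t \<in> free_terms n K X"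
  shows "free_rep n K X (Smult c (free_rep n K X t)) = free_rep n K X (Smult c t)"
  using assms by (auto intro!: free_rep_eqI cong_Smult intro: cong_sym[OF free_rep_cong])

lemma free_rep_Brk_update:
  assumes "ts \<in> tuples n (free_terms n K X)" "t \<in> free_terms n K X"
  shows "free_rep n K X (Brk (ts[i := free_rep n K X t])) = free_rep n K X (Brk (ts[i := t]))"
proof (intro free_rep_eqI free_cong_Brk_all tuples_update)
  fix j assume "j < n"
  then show "free_cong n K X (ts[i := free_rep n K X t] ! j) (ts[i := t] ! j)"
    using tuples_nth[OF assms(1)] conjunct1[OF assms(1)[unfolded tuples_iff_nth]] assms(2)
    by (cases "i = j") (simp_all add: cong_refl cong_sym[OF free_rep_cong])
qed (use assms free_rep_terms in auto)

lemma carrier_free: "carrier (free_nlie n K X) = free_rep n K X ` free_terms n K X"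
  by (simp add: free_nlie_def)

lemma carrier_free_terms:
  assumes "t \<in> carrier (free_nlie n K X)"
  shows "t \<in> free_terms n K X" and "free_rep n K X t = t"
  using assms free_rep_terms free_rep_idem by (auto simp: carrier_free)

lemma free_rep_carrier: "t \<in> free_terms n K X \<Longrightarrow> free_rep n K X t \<in> carrier (free_nlie n K X)"
  by (simp add: carrier_free)

lemma free_ops:
  "\<zero>\<^bsub>free_nlie n K X\<^esub> = free_rep n K X Zero"
  "s \<oplus>\<^bsub>free_nlie n K X\<^esub> t = free_rep n K X (Add s t)"
  "c \<odot>\<^bsub>free_nlie n K X\<^esub> t = free_rep n K X (Smult c t)"
  "bracket (free_nlie n K X) ts = free_rep n K X (Brk ts)"
  by (simp_all add: free_nlie_def)

lemma free_module: "module K (free_nlie n K X)"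
proof -
  let ?F = "free_nlie n K X" and ?T = "free_terms n K X" and ?r = "free_rep n K X"
  note T = free_terms.intros(2-4) free_rep_terms
  have abel: "abelian_group ?F"
  proof (rule abelian_groupI)
    fix x y z assume "x \<in> carrier ?F" "y \<in> carrier ?F" "z \<in> carrier ?F"
    then have xyz: "x \<in> ?T" "y \<in> ?T" "z \<in> ?T" by (auto simp: carrier_free_terms)
    then show "x \<oplus>\<^bsub>?F\<^esub> y \<in> carrier ?F" by (auto simp: free_ops intro!: free_rep_carrier T)
    show "x \<oplus>\<^bsub>?F\<^esub> y = y \<oplus>\<^bsub>?F\<^esub> x"
      using xyz by (auto simp: free_ops intro!: free_rep_eqI Add_comm T)
    show "x \<oplus>\<^bsub>?F\<^esub> y \<oplus>\<^bsub>?F\<^esub> z = x \<oplus>\<^bsub>?F\<^esub> (y \<oplus>\<^bsub>?F\<^esub> z)"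
      using xyz by (auto simp: free_ops free_rep_Add T intro!: free_rep_eqI Add_assoc)
  next
    show "\<zero>\<^bsub>?F\<^esub> \<in> carrier ?F" by (simp add: free_ops free_rep_carrier T)
  next
    fix x assume x: "x \<in> carrier ?F"
    show "\<zero>\<^bsub>?F\<^esub> \<oplus>\<^bsub>?F\<^esub> x = x"
      using free_rep_eqI[OF Add_Zero, of x X] carrier_free_terms[OF x]
      by (simp add: free_ops free_rep_Add T)
    show "\<exists>y\<in>carrier ?F. y \<oplus>\<^bsub>?F\<^esub> x = \<zero>\<^bsub>?F\<^esub>"
      by (rule bexI[where x = "?r (Smult (\<ominus> \<one>) x)"])
        (use free_rep_eqI[OF Add_minus, of x X] carrier_free_terms[OF x] in
          \<open>auto simp: free_ops free_rep_Add T intro!: free_rep_carrier\<close>)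
  qed
  show ?thesis
  proof (rule moduleI[OF is_cring abel])
    fix c d x y
    assume c: "c \<in> carrier K" "d \<in> carrier K" and "x \<in> carrier ?F" "y \<in> carrier ?F"
    then have xy: "x \<in> ?T" "y \<in> ?T" by (auto simp: carrier_free_terms)
    show "c \<odot>\<^bsub>?F\<^esub> x \<in> carrier ?F"
      using c xy by (auto simp: free_ops intro!: free_rep_carrier T)
    show "(c \<oplus> d) \<odot>\<^bsub>?F\<^esub> x = c \<odot>\<^bsub>?F\<^esub> x \<oplus>\<^bsub>?F\<^esub> d \<odot>\<^bsub>?F\<^esub> x"
      using c xy by (auto simp: free_ops free_rep_Add T intro!: free_rep_eqI Smult_add_left)
    show "c \<odot>\<^bsub>?F\<^esub> (x \<oplus>\<^bsub>?F\<^esub> y) = c \<odot>\<^bsub>?F\<^esub> x \<oplus>\<^bsub>?F\<^esub> c \<odot>\<^bsub>?F\<^esub> y"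
      using c xy
      by (auto simp: free_ops free_rep_Add free_rep_Smult T intro!: free_rep_eqI Smult_add_right)
    show "(c \<otimes> d) \<odot>\<^bsub>?F\<^esub> x = c \<odot>\<^bsub>?F\<^esub> (d \<odot>\<^bsub>?F\<^esub> x)"
      using c xy by (auto simp: free_ops free_rep_Smult T intro!: free_rep_eqI Smult_assoc)
  next
    fix x assume "x \<in> carrier ?F"
    then show "\<one> \<odot>\<^bsub>?F\<^esub> x = x"
      using free_rep_eqI[OF Smult_one, of x X] carrier_free_terms[of x X] by (simp add: free_ops)
  qed
qed

lemma free_rep_foldr:
  assumes "set ts \<subseteq> free_terms n K X"
  shows "free_rep n K X (foldr Add ts Zero) =
    foldr (\<oplus>\<^bsub>free_nlie n K X\<^esub>) (map (free_rep n K X) ts) \<zero>\<^bsub>free_nlie n K X\<^esub>"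
  using assms
proof (induction ts)
  case (Cons t ts)
  have "free_rep n K X (foldr Add (t # ts) Zero) =
    free_rep n K X (Add (free_rep n K X t) (free_rep n K X (foldr Add ts Zero)))"
    using Cons.prems by (simp add: free_rep_Add free_rep_terms free_terms_foldr)
  also have "\<dots> = free_rep n K X t \<oplus>\<^bsub>free_nlie n K X\<^esub> free_rep n K X (foldr Add ts Zero)"
    by (simp add: free_ops)
  finally show ?case using Cons by simp
qed (simp add: free_ops)

lemma lie_n_algebra_free: "lie_n_algebra n K (free_nlie n K X)"
proof -
  let ?F = "free_nlie n K X" and ?T = "free_terms n K X" and ?r = "free_rep n K X"
  interpret F: module K ?F by (rule free_module)
  note T = free_terms.intros(2-4) free_rep_terms
  have tup: "ls \<in> tuples k ?T" if "ls \<in> tuples k (carrier ?F)" for ls k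
    using that carrier_free_terms(1) by (auto simp: tuples_iff_nth)
  show ?thesis
  proof (intro_locales, unfold_locales)
    fix ls assume "ls \<in> tuples n (carrier ?F)"
    then show "bracket ?F ls \<in> carrier ?F"
      by (auto simp: free_ops intro!: free_rep_carrier free_terms_tuples tup)
  next
    fix ls i x y
    assume ls: "ls \<in> tuples n (carrier ?F)" and i: "i < n"
      and "x \<in> carrier ?F" "y \<in> carrier ?F"
    then have xy: "x \<in> ?T" "y \<in> ?T" by (auto simp: carrier_free_terms)
    show "bracket ?F (ls[i := x \<oplus>\<^bsub>?F\<^esub> y]) = bracket ?F (ls[i := x]) \<oplus>\<^bsub>?F\<^esub> bracket ?F (ls[i := y])"
      using xy i tup[OF ls]
      by (simp add: free_ops free_rep_Brk_update free_rep_Add T free_terms_tuples tuples_update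
          free_rep_eqI[OF Brk_add])
  next
    fix ls i c x
    assume ls: "ls \<in> tuples n (carrier ?F)" and i: "i < n" and c: "c \<in> carrier K"
      and "x \<in> carrier ?F"
    then have x: "x \<in> ?T" by (auto simp: carrier_free_terms)
    show "bracket ?F (ls[i := c \<odot>\<^bsub>?F\<^esub> x]) = c \<odot>\<^bsub>?F\<^esub> bracket ?F (ls[i := x])"
      using x i c tup[OF ls]
      by (simp add: free_ops free_rep_Brk_update free_rep_Smult T free_terms_tuples tuples_update
          free_rep_eqI[OF Brk_smult])
  next
    fix ls ls'
    assume "ls \<in> tuples n (carrier ?F)" "ls' \<in> tuples (n - 1) (carrier ?F)"
    then have ls: "ls \<in> tuples n ?T" and ls': "ls' \<in> tuples (n - 1) ?T" by (auto intro: tup)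
    let ?g = "\<lambda>i. Brk (ls[i := Brk ((ls ! i) # ls')])"
    have inner: "Brk ((ls ! i) # ls') \<in> ?T" if "i < n" for i
      by (rule free_terms_tuples[OF tuples_Cons[OF tuples_nth[OF ls that] ls']])
    have g: "?g i \<in> ?T" if "i < n" for i
      by (rule free_terms_tuples[OF tuples_update[OF ls inner[OF that]]])
    have "bracket ?F (bracket ?F ls # ls') = ?r (Brk ((Brk ls # ls')[0 := ?r (Brk ls)]))"
      by (simp add: free_ops)
    also have "\<dots> = ?r (Brk (Brk ls # ls'))"
      using ls ls' by (subst free_rep_Brk_update) (auto intro!: tuples_Cons free_terms_tuples)
    also have "\<dots> = ?r (foldr Add (map ?g [0..<n]) Zero)"
      by (rule free_rep_eqI[OF Brk_derivation[OF ls ls']])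
    also have "\<dots> = foldr (\<oplus>\<^bsub>?F\<^esub>) (map (\<lambda>i. ?r (?g i)) [0..<n]) \<zero>\<^bsub>?F\<^esub>"
      using g by (subst free_rep_foldr) (auto simp: comp_def)
    also have "\<dots> = (\<Oplus>\<^bsub>?F\<^esub>i\<in>set [0..<n]. ?r (?g i))"
      using g by (intro F.M.foldr_add_conv_finsum) (auto intro: free_rep_carrier)
    also have "\<dots> = (\<Oplus>\<^bsub>?F\<^esub>i\<in>{..<n}. bracket ?F (ls[i := bracket ?F ((ls ! i) # ls')]))"
      using g ls inner
      by (intro F.M.finsum_cong) (auto simp: free_ops free_rep_Brk_update simp_implies_def
          lessThan_atLeast0 intro!: free_rep_carrier)
    finally show "bracket ?F (bracket ?F ls # ls') =
      (\<Oplus>\<^bsub>?F\<^esub>i\<in>{..<n}. bracket ?F (ls[i := bracket ?F ((ls ! i) # ls')]))" .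
  next
    fix ls \<sigma> assume "ls \<in> tuples n (carrier ?F)" and s: "\<sigma> permutes {..<n}"
    then have ls: "ls \<in> tuples n ?T" by (auto intro: tup)
    show "bracket ?F ls = ([sign \<sigma>] \<cdot> \<one>) \<odot>\<^bsub>?F\<^esub> bracket ?F (permute_list \<sigma> ls)"
      using free_rep_eqI[OF Brk_sign[OF ls s]] tuples_permute[OF ls s]
      by (simp add: free_ops free_rep_Smult sign_closed free_terms_tuples)
  qed
qed

lemma free_unit_closed: "x \<in> X \<Longrightarrow> free_unit n K X x \<in> carrier (free_nlie n K X)"
  by (auto simp: free_unit_def intro!: free_rep_carrier free_terms.intros)

context
  fixes A :: "('k, 'b) nlie" and X :: "('k, 'a) univ set" and h :: "('k, 'a) univ \<Rightarrow> 'b"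
  assumes A: "lie_n_algebra n K A" and h: "\<And>x. x \<in> X \<Longrightarrow> h x \<in> carrier A"
begin

interpretation A: lie_n_algebra n K A by (rule A)

lemma free_lift_terms: "t \<in> free_terms n K X \<Longrightarrow> free_lift A h t \<in> carrier A"
  by (induction rule: free_terms.induct) (auto simp: h tuples_def intro!: A.bracket_closed)

lemma free_lift_tuples:
  "ts \<in> tuples k (free_terms n K X) \<Longrightarrow> map (free_lift A h) ts \<in> tuples k (carrier A)"
  by (rule tuples_map[OF _ free_lift_terms])

lemma free_lift_foldr:
  "free_lift A h (foldr Add ts Zero) = foldr (\<oplus>\<^bsub>A\<^esub>) (map (free_lift A h) ts) \<zero>\<^bsub>A\<^esub>"
  by (induction ts) auto

text \<open>
  Soundness of the congruence: each of its generating relations is an axiom of Lie \<open>n\<close>-algebras.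
\<close>

lemma free_lift_cong:
  "free_cong n K X s t \<Longrightarrow> free_lift A h s = free_lift A h t"
proof (induction rule: free_cong.induct)
  case (cong_Brk ts i t')
  then show ?case by (metis free_lift.simps(6) list_update_id map_update)
next
  case (Brk_derivation ts ts')
  let ?g = "\<lambda>i. bracket A ((map (free_lift A h) ts)[i :=
      bracket A (map (free_lift A h) ts ! i # map (free_lift A h) ts')])"
  have inner: "bracket A (map (free_lift A h) ts ! i # map (free_lift A h) ts') \<in> carrier A"
    if "i < n" for i
    using Brk_derivation that
    by (intro A.bracket_closed tuples_Cons tuples_nth[OF free_lift_tuples] free_lift_tuples)
  have g: "?g i \<in> carrier A" if "i < n" for i
    using Brk_derivation that free_lift_tuples
    by (intro A.bracket_closed tuples_update inner) auto
  have "free_lift A h (foldr Add (map (\<lambda>i. Brk (ts[i := Brk ((ts ! i) # ts')])) [0..<n]) Zero) =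
      foldr (\<oplus>\<^bsub>A\<^esub>) (map ?g [0..<n]) \<zero>\<^bsub>A\<^esub>"
    unfolding free_lift_foldr using Brk_derivation(1)
    by (intro arg_cong2[of _ _ _ _ "\<lambda>xs. foldr _ xs"]) (auto simp: map_update tuples_def)
  also have "\<dots> = (\<Oplus>\<^bsub>A\<^esub>i\<in>set [0..<n]. ?g i)"
    using g by (intro A.M.foldr_add_conv_finsum) auto
  also have "\<dots> = bracket A (bracket A (map (free_lift A h) ts) # map (free_lift A h) ts')"
    using A.bracket_derivation[OF free_lift_tuples free_lift_tuples] Brk_derivation
    by (simp add: lessThan_atLeast0)
  finally show ?case by simp
next
  case (Brk_sign ts \<sigma>)
  then show ?case using A.bracket_sign[OF free_lift_tuples, of ts \<sigma>]
    by (simp add: tuples_def permute_list_map)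
next
  case (Brk_add ts i s t)
  then show ?case by (simp add: map_update A.bracket_add free_lift_tuples free_lift_terms)
next
  case (Brk_smult ts i c t)
  then show ?case by (simp add: map_update A.bracket_smult free_lift_tuples free_lift_terms)
next
  case (Add_minus t)
  then show ?case using free_lift_terms[of t] by (simp add: A.smult_l_minus A.M.l_neg)
qed (auto simp: free_lift_terms A.M.a_ac A.smult_l_distr A.smult_r_distr
    A.smult_assoc1)

lemma free_lift_rep:
  "t \<in> free_terms n K X \<Longrightarrow> free_lift A h (free_rep n K X t) = free_lift A h t"
  using free_lift_cong free_rep_cong by metis

lemma free_lift_hom: "free_lift A h \<in> lie_hom n K (free_nlie n K X) A"
  unfolding lie_hom_def linear_maps_def
  by (auto simp: free_ops free_lift_rep free_terms.intros free_terms_tuples carrier_free_terms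
      free_lift_terms tuples_def subset_iff)

lemma free_lift_unit: "x \<in> X \<Longrightarrow> free_lift A h (free_unit n K X x) = h x"
  by (simp add: free_unit_def free_lift_rep free_terms.intros)

end

lemma free_hom_unique:
  assumes g: "g \<in> lie_hom n K (free_nlie n K X) A" and h: "h \<in> lie_hom n K (free_nlie n K X) A"
    and A: "lie_n_algebra n K A"
    and eq: "\<And>x. x \<in> X \<Longrightarrow> g (free_unit n K X x) = h (free_unit n K X x)"
    and t: "t \<in> carrier (free_nlie n K X)"
  shows "g t = h t"
proof -
  let ?F = "free_nlie n K X" and ?r = "free_rep n K X"
  note lin = lie_hom_linear[OF g] lie_hom_linear[OF h]
  have "g (?r t) = h (?r t)" if "t \<in> free_terms n K X" for t
    using that
  proof (induction rule: free_terms.induct)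
    case (1 x)
    then show ?case using eq by (simp add: free_unit_def)
  next
    case 2
    show ?case using lie_hom_zero[OF lie_n_algebra_free A g] lie_hom_zero[OF lie_n_algebra_free A h]
      by (simp add: free_ops)
  next
    case (3 s t)
    have "?r (Add s t) = ?r s \<oplus>\<^bsub>?F\<^esub> ?r t" using 3 by (simp add: free_ops free_rep_Add free_rep_terms)
    then show ?case using 3 by (simp add: linear_maps_add[OF lin(1)] linear_maps_add[OF lin(2)]
          free_rep_carrier)
  next
    case (4 c t)
    have "?r (Smult c t) = c \<odot>\<^bsub>?F\<^esub> ?r t" using 4 by (simp add: free_ops free_rep_Smult)
    then show ?case using 4 by (simp add: linear_maps_smult[OF lin(1)] linear_maps_smult[OF lin(2)]
          free_rep_carrier)
  next
    case (5 ts)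
    have ts: "ts \<in> tuples n (free_terms n K X)" using 5 by (auto simp: tuples_def)
    have m: "map ?r ts \<in> tuples n (carrier ?F)" by (rule tuples_map[OF ts free_rep_carrier])
    have "?r (Brk (map ?r ts)) = ?r (Brk ts)"
      using ts tuples_nth[OF ts] conjunct1[OF ts[unfolded tuples_iff_nth]]
      by (intro free_rep_eqI free_cong_Brk_all tuples_map[OF ts free_rep_terms])
        (simp_all add: cong_sym[OF free_rep_cong])
    then have "?r (Brk ts) = bracket ?F (map ?r ts)" by (simp add: free_ops)
    then show ?case
      using lie_hom_bracket[OF g m] lie_hom_bracket[OF h m] 5
        by (auto intro: arg_cong[of _ _ "bracket A"])
  qed
  then show ?thesis using carrier_free_terms[OF t] by metis
qed

end

section \<open>Retracts of free algebras\<close>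

text \<open>
  Projectivity is used in this form because it provides lifts into Lie \<open>n\<close>-algebras on any type.
\<close>

definition retract_of_free ::
  "nat \<Rightarrow> ('k, 'r) ring_scheme \<Rightarrow> ('k, 'a) univ set \<Rightarrow> ('k, 'b) nlie \<Rightarrow> bool" where
  "retract_of_free n K X P \<longleftrightarrow>
     (\<exists>s \<in> lie_hom n K P (free_nlie n K X). \<exists>p \<in> lie_hom n K (free_nlie n K X) P.
        \<forall>x \<in> carrier P. p (s x) = x)"

lemma the_Elem_hom: "the_Elem \<in> lie_hom n K (elem_copy L) L"
  by (auto simp: lie_hom_def linear_maps_def elem_copy_def)

lemma Elem_hom: "lie_n_algebra n K L \<Longrightarrow> Elem \<in> lie_hom n K L (elem_copy L)"
  by (auto simp: lie_hom_def linear_maps_def elem_copy_def comp_def)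

lemma lie_n_algebra_elem_copy:
  assumes "lie_n_algebra n K L" shows "lie_n_algebra n K (elem_copy L)"
proof -
  interpret L: lie_n_algebra n K L by fact
  let ?C = "elem_copy L"
  have car: "carrier ?C = Elem ` carrier L" by (simp add: elem_copy_def)
  have ops: "x \<oplus>\<^bsub>?C\<^esub> y = Elem (the_Elem x \<oplus>\<^bsub>L\<^esub> the_Elem y)"
    "c \<odot>\<^bsub>?C\<^esub> x = Elem (c \<odot>\<^bsub>L\<^esub> the_Elem x)" "\<zero>\<^bsub>?C\<^esub> = Elem \<zero>\<^bsub>L\<^esub>"
    "bracket ?C xs = Elem (bracket L (map the_Elem xs))" for x y c xs
    by (simp_all add: elem_copy_def)
  have tup: "map the_Elem xs \<in> tuples k (carrier L)" if "xs \<in> tuples k (carrier ?C)" for xs k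
    by (rule tuples_map[OF that]) (auto simp: car)
  have mod: "module K ?C"
    by (rule module_surjective_image[OF lie_n_algebra_module[OF assms]
          lie_hom_linear[OF Elem_hom[OF assms]]]) (simp_all add: car ops)
  interpret C: module K ?C by (rule mod)
  have Elem_sum: "Elem (\<Oplus>\<^bsub>L\<^esub>i\<in>I. g i) = (\<Oplus>\<^bsub>?C\<^esub>i\<in>I. Elem (g i))"
    if "finite I" "\<And>i. i \<in> I \<Longrightarrow> g i \<in> carrier L" for I :: "nat set" and g
    using that
  proof (induction I)
    case (insert i I)
    then have "the_Elem (\<Oplus>\<^bsub>?C\<^esub>i\<in>I. Elem (g i)) = (\<Oplus>\<^bsub>L\<^esub>i\<in>I. g i)"
      by (metis insertCI univ.sel)
    then show ?case using insert
      by (simp add: L.M.finsum_insert C.M.finsum_insert Pi_def car ops)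
  qed (simp add: ops)
  have "lie_n_algebra_axioms n K ?C"
  proof
    show "bracket ?C ls \<in> carrier ?C" if "ls \<in> tuples n (carrier ?C)" for ls
      using L.bracket_closed[OF tup[OF that]] by (simp add: car ops)
    show "bracket ?C (ls[i := x \<oplus>\<^bsub>?C\<^esub> y]) = bracket ?C (ls[i := x]) \<oplus>\<^bsub>?C\<^esub> bracket ?C (ls[i := y])"
      if "ls \<in> tuples n (carrier ?C)" "i < n" "x \<in> carrier ?C" "y \<in> carrier ?C" for ls i x y
      using L.bracket_add[OF tup[OF that(1)] that(2)] that(3,4) by (auto simp: ops car map_update)
    show "bracket ?C (ls[i := c \<odot>\<^bsub>?C\<^esub> x]) = c \<odot>\<^bsub>?C\<^esub> bracket ?C (ls[i := x])"
      if "ls \<in> tuples n (carrier ?C)" "i < n" "c \<in> carrier K" "x \<in> carrier ?C" for ls i c x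
      using L.bracket_smult[OF tup[OF that(1)] that(2,3)] that(4) by (auto simp: ops car map_update)
    show "bracket ?C ls = ([sign \<sigma>] \<cdot>\<^bsub>K\<^esub> \<one>\<^bsub>K\<^esub>) \<odot>\<^bsub>?C\<^esub> bracket ?C (permute_list \<sigma> ls)"
      if ls: "ls \<in> tuples n (carrier ?C)" and s: "\<sigma> permutes {..<n}" for ls \<sigma>
      using L.bracket_sign[OF tup[OF ls] s] ls s by (simp add: ops permute_list_map tuples_def)
    show "bracket ?C (bracket ?C ls # ls') =
        (\<Oplus>\<^bsub>?C\<^esub>i\<in>{..<n}. bracket ?C (ls[i := bracket ?C ((ls ! i) # ls')]))"
      if ls: "ls \<in> tuples n (carrier ?C)" and ls': "ls' \<in> tuples (n - 1) (carrier ?C)" for ls ls'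
    proof -
      let ?m = "map the_Elem"
      have cl: "bracket L ((?m ls)[i := bracket L ((?m ls ! i) # ?m ls')]) \<in> carrier L"
        if "i < n" for i
        using that tup[OF ls] tup[OF ls'] tuples_nth[OF tup[OF ls] that]
        by (intro L.bracket_closed tuples_update) (auto simp: tuples_def)
      have "bracket ?C (bracket ?C ls # ls') = Elem (bracket L (bracket L (?m ls) # ?m ls'))"
        by (simp add: ops)
      also have "\<dots> =
          (\<Oplus>\<^bsub>?C\<^esub>i\<in>{..<n}. Elem (bracket L ((?m ls)[i := bracket L ((?m ls ! i) # ?m ls')])))"
        unfolding L.bracket_derivation[OF tup[OF ls] tup[OF ls']] using cl by (intro Elem_sum) auto
      also have "\<dots> = (\<Oplus>\<^bsub>?C\<^esub>i\<in>{..<n}. bracket ?C (ls[i := bracket ?C ((ls ! i) # ls')]))"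
        using ls cl by (intro C.M.finsum_cong)
          (auto simp: ops map_update simp_implies_def tuples_def car)
      finally show ?thesis .
    qed
  qed
  then show ?thesis using mod L.field_axioms by (simp add: lie_n_algebra_def)
qed

context ground
begin

lemma projective_retract_of_free:
  fixes P :: "('k, 'a) nlie"
  assumes P: "lie_n_algebra n K P" and proj: "lie_projective n K P"
  shows "retract_of_free n K (carrier (elem_copy P) :: ('k, 'a) univ set) P"
proof -
  let ?C = "elem_copy P :: ('k, ('k, 'a) univ) nlie" and ?p = "free_lift (elem_copy P) (\<lambda>x. x)"
  let ?F = "free_nlie n K (carrier ?C)"
  have C: "lie_n_algebra n K ?C" by (rule lie_n_algebra_elem_copy[OF P])
  have p: "?p \<in> lie_hom n K ?F ?C" by (rule free_lift_hom[OF C])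
  have "?p ` carrier ?F = carrier ?C"
  proof
    show "carrier ?C \<subseteq> ?p ` carrier ?F"
    proof
      fix x assume x: "x \<in> carrier ?C"
      then show "x \<in> ?p ` carrier ?F"
        using free_lift_unit[OF C _ x, of "\<lambda>x. x"] free_unit_closed[OF x] by force
    qed
  qed (use lie_hom_closed[OF p] in auto)
  then obtain s where s: "s \<in> lie_hom n K P ?F" "\<forall>x\<in>carrier P. ?p (s x) = Elem x"
    using proj[unfolded lie_projective_def, rule_format, OF p Elem_hom[OF P] lie_n_algebra_free C]
    by auto
  show ?thesis unfolding retract_of_free_def
    by (rule bexI[OF _ s(1)], rule bexI[OF _ lie_hom_compose[OF p the_Elem_hom]]) (use s(2) in auto)
qed

text \<open>
  The lift is first chosen on generators, where it is merely a choice of elements. Compatibility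
  with the maps \<open>q t\<close> then holds on generators, hence everywhere on the free algebra, and is
  inherited by the retract.
\<close>

lemma retract_of_free_lift:
  assumes P: "retract_of_free n K X P" and B: "lie_n_algebra n K B"
    and Q: "\<And>t. t \<in> T \<Longrightarrow> lie_n_algebra n K (Q t)"
    and k: "\<And>t. t \<in> T \<Longrightarrow> k t \<in> lie_hom n K P (Q t)"
    and q: "\<And>t. t \<in> T \<Longrightarrow> q t \<in> lie_hom n K B (Q t)"
    and lift: "\<And>x. x \<in> carrier P \<Longrightarrow> \<exists>y\<in>carrier B. \<forall>t\<in>T. q t y = k t x"
  shows "\<exists>r\<in>lie_hom n K P B. \<forall>t\<in>T. \<forall>x\<in>carrier P. q t (r x) = k t x"
proof -
  let ?F = "free_nlie n K X"
  obtain s p where s: "s \<in> lie_hom n K P ?F" and p: "p \<in> lie_hom n K ?F P"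
    and ps: "\<And>x. x \<in> carrier P \<Longrightarrow> p (s x) = x"
    using P unfolding retract_of_free_def by blast
  have "\<exists>y. y \<in> carrier B \<and> (\<forall>t\<in>T. q t y = k t (p (free_unit n K X x)))" if "x \<in> X" for x
    using lift[OF lie_hom_closed[OF p free_unit_closed[OF that]]] by blast
  then obtain y where y: "\<And>x. x \<in> X \<Longrightarrow> y x \<in> carrier B"
    and qy: "\<And>x t. \<lbrakk>x \<in> X; t \<in> T\<rbrakk> \<Longrightarrow> q t (y x) = k t (p (free_unit n K X x))" by metis
  let ?g = "free_lift B y"
  have g: "?g \<in> lie_hom n K ?F B" by (rule free_lift_hom[OF B y])
  have eq: "q t (?g z) = k t (p z)" if t: "t \<in> T" and z: "z \<in> carrier ?F" for t z
    using free_hom_unique[OF lie_hom_compose[OF g q[OF t]] lie_hom_compose[OF p k[OF t]] Q[OF t]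
        _ z]
      free_lift_unit[OF B, of X y] y qy t by simp
  show ?thesis
    by (rule bexI[OF _ lie_hom_compose[OF s g]]) (simp add: eq lie_hom_closed[OF s] ps)
qed

end

section \<open>Alternating sums over subsets\<close>

text \<open>
  For distinct \<open>js\<close> this is the sum of \<open>(-1)\<^bsup>|I|\<^esup> u I\<close> over the subsets \<open>I\<close> of \<open>set js\<close>. The recursion
  pairs \<open>I\<close> with \<open>insert j I\<close>, which is how cancellations come about.
\<close>

primrec alt_sum :: "('k, 'a, 'x) module_scheme \<Rightarrow> nat list \<Rightarrow> (nat set \<Rightarrow> 'a) \<Rightarrow> 'a" where
  "alt_sum M [] u = u {}"
| "alt_sum M (j # js) u = alt_sum M js u \<ominus>\<^bsub>M\<^esub> alt_sum M js (\<lambda>I. u (insert j I))"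

lemma (in abelian_group) add_minus_add:
  assumes "a \<in> carrier G" "b \<in> carrier G" "c \<in> carrier G" "d \<in> carrier G"
  shows "(a \<oplus> b) \<ominus> (c \<oplus> d) = (a \<ominus> c) \<oplus> (b \<ominus> d)"
  using assms by (simp add: a_minus_def minus_add a_ac)

lemma (in abelian_group) minus_minus_minus:
  assumes "a \<in> carrier G" "b \<in> carrier G" "c \<in> carrier G" "d \<in> carrier G"
  shows "(a \<ominus> b) \<ominus> (c \<ominus> d) = (a \<ominus> c) \<ominus> (b \<ominus> d)"
  using assms by (simp add: a_minus_def minus_add a_ac)

lemma (in abelian_group) minus_add_minus:
  assumes "a \<in> carrier G" "b \<in> carrier G" "c \<in> carrier G"
  shows "(a \<ominus> b) \<oplus> (b \<ominus> c) = a \<ominus> c"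
proof -
  have "(a \<ominus> b) \<oplus> (b \<ominus> c) = a \<oplus> ((\<ominus> b \<oplus> b) \<oplus> \<ominus> c)"
    using assms by (simp add: a_minus_def a_assoc)
  then show ?thesis using assms by (simp add: l_neg a_minus_def)
qed

lemma (in abelian_group) minus_self: "a \<in> carrier G \<Longrightarrow> a \<ominus> a = \<zero>"
  by (simp add: a_minus_def r_neg)

lemma (in abelian_group) minus_zero: "a \<in> carrier G \<Longrightarrow> a \<ominus> \<zero> = a"
  by (simp add: a_minus_def)

context module
begin

lemma alt_sum_submodule:
  assumes "submodule B R M" "set js \<subseteq> S" "\<And>I. I \<subseteq> S \<Longrightarrow> u I \<in> B"
  shows "alt_sum M js u \<in> B"
  using assms(2,3)
proof (induction js arbitrary: u)
  case (Cons j js)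
  then show ?case using submodule_minus[OF assms(1)] by simp
qed simp

lemma alt_sum_closed:
  "\<lbrakk>set js \<subseteq> S; \<And>I. I \<subseteq> S \<Longrightarrow> u I \<in> carrier M\<rbrakk> \<Longrightarrow> alt_sum M js u \<in> carrier M"
  by (rule alt_sum_submodule[OF carrier_is_submodule])

lemma alt_sum_cong:
  assumes "set js \<subseteq> S" "\<And>I. I \<subseteq> S \<Longrightarrow> u I = v I"
  shows "alt_sum M js u = alt_sum M js v"
  using assms
proof (induction js arbitrary: u v)
  case (Cons j js)
  have "alt_sum M js u = alt_sum M js v"
    "alt_sum M js (\<lambda>I. u (insert j I)) = alt_sum M js (\<lambda>I. v (insert j I))"
    using Cons.prems by (auto intro!: Cons.IH)
  then show ?case by simp
qed simp

lemma alt_sum_minus: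
  assumes "set js \<subseteq> S" "\<And>I. I \<subseteq> S \<Longrightarrow> u I \<in> carrier M" "\<And>I. I \<subseteq> S \<Longrightarrow> v I \<in> carrier M"
  shows "alt_sum M js (\<lambda>I. u I \<ominus>\<^bsub>M\<^esub> v I) = alt_sum M js u \<ominus>\<^bsub>M\<^esub> alt_sum M js v"
  using assms
proof (induction js arbitrary: u v)
  case (Cons j js)
  then show ?case by (simp add: Cons.IH M.minus_minus_minus alt_sum_closed[of _ S])
qed simp

lemma alt_sum_vanish:
  assumes "set js \<subseteq> S" "\<And>I. I \<subseteq> S \<Longrightarrow> u I = \<zero>\<^bsub>M\<^esub>"
  shows "alt_sum M js u = \<zero>\<^bsub>M\<^esub>"
  using alt_sum_submodule[of "{\<zero>\<^bsub>M\<^esub>}" js S u] assms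
  by (force intro!: submodule_criterion)

lemma alt_sum_only_empty:
  assumes "set js \<subseteq> S" "\<And>I. I \<subseteq> S \<Longrightarrow> I \<noteq> {} \<Longrightarrow> u I = \<zero>\<^bsub>M\<^esub>" "u {} \<in> carrier M"
  shows "alt_sum M js u = u {}"
  using assms
proof (induction js)
  case (Cons j js)
  then have "alt_sum M js (\<lambda>I. u (insert j I)) = \<zero>\<^bsub>M\<^esub>"
    by (intro alt_sum_vanish[of _ S]) auto
  then show ?case using Cons by (simp add: M.minus_zero)
qed simp

lemma alt_sum_cancel:
  assumes "set js \<subseteq> S" "j \<in> set js" "\<And>I. I \<subseteq> S \<Longrightarrow> u I \<in> carrier M"
    and "\<And>I. I \<subseteq> S \<Longrightarrow> u (insert j I) = u I"
  shows "alt_sum M js u = \<zero>\<^bsub>M\<^esub>"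
  using assms
proof (induction js arbitrary: u)
  case (Cons i js)
  have i: "i \<in> S" "set js \<subseteq> S" using Cons.prems by auto
  show ?case
  proof (cases "i = j")
    case True
    have "alt_sum M js (\<lambda>I. u (insert i I)) = alt_sum M js u"
      using Cons.prems True by (intro alt_sum_cong[of _ S]) auto
    then show ?thesis using Cons.prems by (simp add: M.minus_self alt_sum_closed[of _ S])
  next
    case False
    then have "alt_sum M js u = \<zero>\<^bsub>M\<^esub>" using Cons.prems by (intro Cons.IH) auto
    moreover have "alt_sum M js (\<lambda>I. u (insert i I)) = \<zero>\<^bsub>M\<^esub>"
    proof (rule Cons.IH)
      show "u (insert i (insert j I)) = u (insert i I)" if "I \<subseteq> S" for I
        using Cons.prems(4)[of "insert i I"] i that by (simp add: insert_commute)
    qed (use Cons.prems False i in auto)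
    ultimately show ?thesis by (simp add: M.minus_zero)
  qed
qed simp

end

lemma alt_sum_hom:
  assumes M: "module K M" and N: "module K N" and h: "h \<in> linear_maps K M N"
    and "set js \<subseteq> S" "\<And>I. I \<subseteq> S \<Longrightarrow> u I \<in> carrier M"
  shows "h (alt_sum M js u) = alt_sum N js (\<lambda>I. h (u I))"
  using assms(4,5)
proof (induction js arbitrary: u)
  case (Cons j js)
  interpret M: module K M by (rule M)
  show ?case using Cons.prems
    by (simp add: Cons.IH linear_maps_minus[OF M N h] M.alt_sum_closed[of _ S])
qed simp

lemma alt_sum_linear:
  assumes M: "module K M" and N: "module K N"
    and "set js \<subseteq> S" "\<And>I. I \<subseteq> S \<Longrightarrow> u I \<in> linear_maps K M N"
  shows "(\<lambda>x. alt_sum N js (\<lambda>I. u I x)) \<in> linear_maps K M N"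
  using assms(3,4)
proof (induction js arbitrary: u)
  case (Cons j js)
  interpret M: module K M by (rule M)
  interpret N: module K N by (rule N)
  have a: "(\<lambda>x. alt_sum N js (\<lambda>I. u I x)) \<in> linear_maps K M N" (is "?a \<in> _")
    using Cons.prems by (intro Cons.IH) auto
  have b: "(\<lambda>x. alt_sum N js (\<lambda>I. u (insert j I) x)) \<in> linear_maps K M N" (is "?b \<in> _")
    using Cons.prems by (intro Cons.IH) auto
  have ac: "?a x \<in> carrier N" and bc: "?b x \<in> carrier N" if "x \<in> carrier M" for x
    using linear_maps_closed[OF a that] linear_maps_closed[OF b that] by auto
  have "(\<lambda>x. ?a x \<ominus>\<^bsub>N\<^esub> ?b x) \<in> linear_maps K M N"
    unfolding linear_maps_def
    by (auto simp: ac bc linear_maps_add[OF a] linear_maps_add[OF b] linear_maps_smult[OF a]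
        linear_maps_smult[OF b] N.M.add_minus_add)
      (simp add: a_minus_def N.smult_r_distr N.smult_r_minus ac bc)
  then show ?case by simp
qed (simp add: linear_maps_def)

section \<open>The denominator of the Hopf quotient\<close>

definition hopf_denominator ::
  "nat \<Rightarrow> ('k, 'r) ring_scheme \<Rightarrow> nat \<Rightarrow> (nat set \<Rightarrow> ('k, 'a) nlie) \<Rightarrow>
   (nat set \<Rightarrow> nat set \<Rightarrow> 'a \<Rightarrow> 'a) \<Rightarrow> 'a set" where
  "hopf_denominator n K m f \<phi> =
     sum_of_ideals (f {}) (covering_tuples n m)
       (\<lambda>T. commutator_ideal n K (f {}) (\<lambda>j. kernel_meet f \<phi> (T j)))"

lemma finite_covering_tuples: "finite (covering_tuples n m)"
  by (rule finite_subset[of _ "{..<n} \<rightarrow>\<^sub>E Pow {1..m}"])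
    (auto simp: covering_tuples_def intro!: finite_PiE)

lemma mem_kernel_meet:
  "x \<in> kernel_meet f \<phi> I \<longleftrightarrow> x \<in> carrier (f {}) \<and> (\<forall>i\<in>I. \<phi> {} {i} x = \<zero>\<^bsub>f {i}\<^esub>)"
  by (auto simp: kernel_meet_def a_kernel_def')

context fold_arrow
begin

lemma base_algebra: "lie_n_algebra n K (f {})"
  by (rule arrow_obj) simp

lemma arrow_zero: "\<lbrakk>I \<subseteq> J; J \<subseteq> {1..m}\<rbrakk> \<Longrightarrow> \<phi> I J \<zero>\<^bsub>f I\<^esub> = \<zero>\<^bsub>f J\<^esub>"
  by (rule lie_hom_zero[OF arrow_obj arrow_obj arrow_map]) auto

lemma arrow_minus:
  "\<lbrakk>I \<subseteq> J; J \<subseteq> {1..m}; x \<in> carrier (f I); y \<in> carrier (f I)\<rbrakk> \<Longrightarrow>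
    \<phi> I J (x \<ominus>\<^bsub>f I\<^esub> y) = \<phi> I J x \<ominus>\<^bsub>f J\<^esub> \<phi> I J y"
  by (rule lie_hom_minus[OF arrow_obj arrow_obj arrow_map]) auto

lemma arrow_closed: "\<lbrakk>I \<subseteq> J; J \<subseteq> {1..m}; x \<in> carrier (f I)\<rbrakk> \<Longrightarrow> \<phi> I J x \<in> carrier (f J)"
  by (rule lie_hom_closed[OF arrow_map])

lemma lie_ideal_kernel_meet:
  assumes "I \<subseteq> {1..m}" shows "lie_ideal n K (f {}) (kernel_meet f \<phi> I)"
proof -
  interpret lie_n_algebra n K "f {}" by (rule base_algebra)
  have "lie_ideal n K (f {}) (a_kernel (f {}) (f {i}) (\<phi> {} {i}))" if "i \<in> I" for i
    using that assms by (intro lie_ideal_kernel arrow_obj arrow_map) auto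
  then have "lie_ideal n K (f {})
      (\<Inter>(insert (carrier (f {})) ((\<lambda>i. a_kernel (f {}) (f {i}) (\<phi> {} {i})) ` I)))"
    using lie_ideal_carrier by (intro lie_ideal_Inter) auto
  then show ?thesis by (simp add: kernel_meet_def)
qed

lemma submodule_kernel_meet: "I \<subseteq> {1..m} \<Longrightarrow> submodule (kernel_meet f \<phi> I) K (f {})"
  using lie_ideal_kernel_meet by (simp add: lie_ideal_def)

lemma kernel_meet_vanish:
  assumes "x \<in> kernel_meet f \<phi> {1..m}" "I \<subseteq> {1..m}" "I \<noteq> {}"
  shows "\<phi> {} I x = \<zero>\<^bsub>f I\<^esub>"
proof -
  obtain i where i: "i \<in> I" using assms by auto
  have "\<phi> {} I x = \<phi> {i} I (\<phi> {} {i} x)"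
    using assms i by (intro arrow_comp[symmetric]) (auto simp: mem_kernel_meet)
  then show ?thesis using assms i arrow_zero[of "{i}" I] by (auto simp: mem_kernel_meet)
qed

lemma covering_tuples_commutator:
  "T \<in> covering_tuples n m \<Longrightarrow>
    lie_ideal n K (f {}) (commutator_ideal n K (f {}) (\<lambda>j. kernel_meet f \<phi> (T j)))"
  by (rule lie_n_algebra.lie_ideal_commutator[OF base_algebra]) (auto simp: kernel_meet_def)

lemma lie_ideal_hopf_denominator: "lie_ideal n K (f {}) (hopf_denominator n K m f \<phi>)"
  unfolding hopf_denominator_def
  by (rule lie_n_algebra.sum_of_ideals(1)[OF base_algebra finite_covering_tuples
        covering_tuples_commutator])

lemma submodule_hopf_denominator: "submodule (hopf_denominator n K m f \<phi>) K (f {})"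
  using lie_ideal_hopf_denominator by (simp add: lie_ideal_def)

lemma bracket_hopf_denominator:
  assumes "length ls = n" "\<And>j. j < n \<Longrightarrow> ls ! j \<in> kernel_meet f \<phi> (T j)"
    and "(\<Union>j<n. T j) = {1..m}"
  shows "bracket (f {}) ls \<in> hopf_denominator n K m f \<phi>"
proof -
  let ?T = "restrict T {..<n}"
  have T: "?T \<in> covering_tuples n m" using assms(3) by (auto simp: covering_tuples_def)
  have "bracket (f {}) ls \<in> commutator_ideal n K (f {}) (\<lambda>j. kernel_meet f \<phi> (?T j))"
    unfolding commutator_ideal_def generated_ideal_def using assms(1,2) by auto
  moreover have "(\<lambda>T. commutator_ideal n K (f {}) (\<lambda>j. kernel_meet f \<phi> (T j))) ?T
      \<subseteq> hopf_denominator n K m f \<phi>"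
    unfolding hopf_denominator_def
    by (rule lie_n_algebra.sum_of_ideals(2)[OF base_algebra finite_covering_tuples _ T])
      (rule covering_tuples_commutator)
  ultimately show ?thesis by blast
qed

lemma hopf_denominator_least:
  assumes N: "lie_ideal n K (f {}) N"
    and br: "\<And>ls T. \<lbrakk>length ls = n; \<And>j. j < n \<Longrightarrow> ls ! j \<in> kernel_meet f \<phi> (T j);
       \<And>j. j < n \<Longrightarrow> T j \<subseteq> {1..m}; (\<Union>j<n. T j) = {1..m}\<rbrakk> \<Longrightarrow> bracket (f {}) ls \<in> N"
  shows "hopf_denominator n K m f \<phi> \<subseteq> N"
  unfolding hopf_denominator_def
proof (rule lie_n_algebra.sum_of_ideals(3)[OF base_algebra finite_covering_tuples
      covering_tuples_commutator])
  show "submodule N K (f {})" using N by (simp add: lie_ideal_def)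
  fix T assume "T \<in> covering_tuples n m"
  then have "{bracket (f {}) ls |ls. length ls = n \<and> (\<forall>i<n. ls ! i \<in> kernel_meet f \<phi> (T i))} \<subseteq> N"
    using br by (auto simp: covering_tuples_def)
  then show "commutator_ideal n K (f {}) (\<lambda>j. kernel_meet f \<phi> (T j)) \<subseteq> N"
    unfolding commutator_ideal_def generated_ideal_def using N by auto
qed

text \<open>
  Expanding a bracket of alternating families in one direction at a time, every summand acquires
  an entry in the kernel of that direction; once all directions are used up, the summands are the
  generators of the denominator.
\<close>

lemma alt_sum_bracket:
  assumes "set js \<subseteq> {1..m}" "(\<Union>k<n. T k) \<union> set js = {1..m}"
    and "\<And>k I. \<lbrakk>k < n; I \<subseteq> {1..m}\<rbrakk> \<Longrightarrow> w k I \<in> kernel_meet f \<phi> (T k)"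
    and "\<And>k I j. \<lbrakk>k < n; I \<subseteq> {1..m}; j \<in> {1..m}\<rbrakk> \<Longrightarrow>
      w k I \<ominus>\<^bsub>f {}\<^esub> w k (insert j I) \<in> kernel_meet f \<phi> {j}"
  shows "alt_sum (f {}) js (\<lambda>I. bracket (f {}) (map (\<lambda>k. w k I) [0..<n]))
    \<in> hopf_denominator n K m f \<phi>"
  using assms
proof (induction js arbitrary: T w)
  case Nil
  then show ?case by (auto intro!: bracket_hopf_denominator[of _ T])
next
  case (Cons j js)
  interpret Q: lie_n_algebra n K "f {}" by (rule base_algebra)
  let ?S = "{1..m}" and ?D = "hopf_denominator n K m f \<phi>"
  have j: "j \<in> ?S" and js: "set js \<subseteq> ?S" using Cons.prems by auto
  have T: "T k \<subseteq> ?S" if "k < n" for k using Cons.prems(2) that by auto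
  have wc: "w k I \<in> carrier (f {})" if "k < n" "I \<subseteq> ?S" for k I
    using Cons.prems(3)[OF that] by (simp add: mem_kernel_meet)
  \<comment> \<open>In \<open>hyb r\<close> the first \<open>r\<close> entries have been moved along the direction \<open>j\<close>.\<close>
  define v where "v r k I = (if k < r then w k (insert j I) else w k I)" for r k I
  define hyb where "hyb r I = bracket (f {}) (map (\<lambda>k. v r k I) [0..<n])" for r I
  have vt: "map (\<lambda>k. v r k I) [0..<n] \<in> tuples n (carrier (f {}))" if "I \<subseteq> ?S" for r I
    using wc that j by (auto simp: tuples_iff_nth v_def)
  have hc: "hyb r I \<in> carrier (f {})" if "I \<subseteq> ?S" for r I
    unfolding hyb_def using vt[OF that] by (rule Q.bracket_closed)
  have ac: "alt_sum (f {}) js (hyb r) \<in> carrier (f {})" for r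
    using Q.alt_sum_closed[OF js, of "hyb r"] hc by blast
  have step: "alt_sum (f {}) js (hyb r) \<ominus>\<^bsub>f {}\<^esub> alt_sum (f {}) js (hyb (Suc r)) \<in> ?D"
      if r: "r < n" for r
  proof -
    define x where "x k I = (if k = r then w r I \<ominus>\<^bsub>f {}\<^esub> w r (insert j I) else v r k I)" for k I
    let ?T = "T(r := insert j (T r))"
    have upd: "(map (\<lambda>k. v r k I) [0..<n])[r := z] = map (\<lambda>k. if k = r then z else v r k I) [0..<n]"
      for I z using r by (auto intro!: nth_equalityI simp: nth_list_update)
    have eq: "hyb r I \<ominus>\<^bsub>f {}\<^esub> hyb (Suc r) I = bracket (f {}) (map (\<lambda>k. x k I) [0..<n])"
        if I: "I \<subseteq> ?S" for I
    proof -
      have "bracket (f {}) (map (\<lambda>k. x k I) [0..<n]) =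
          bracket (f {}) ((map (\<lambda>k. v r k I) [0..<n])[r := w r I \<ominus>\<^bsub>f {}\<^esub> w r (insert j I)])"
        unfolding upd by (simp add: x_def)
      also have "\<dots> = bracket (f {}) ((map (\<lambda>k. v r k I) [0..<n])[r := w r I])
          \<ominus>\<^bsub>f {}\<^esub> bracket (f {}) ((map (\<lambda>k. v r k I) [0..<n])[r := w r (insert j I)])"
        using r wc I j by (intro Q.bracket_minus vt) auto
      also have "(map (\<lambda>k. v r k I) [0..<n])[r := w r I] = map (\<lambda>k. v r k I) [0..<n]"
        unfolding upd by (simp add: v_def)
      also have "(map (\<lambda>k. v r k I) [0..<n])[r := w r (insert j I)] =
          map (\<lambda>k. v (Suc r) k I) [0..<n]"
        unfolding upd by (auto simp: v_def less_Suc_eq)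
      finally show ?thesis by (simp add: hyb_def)
    qed
    have "alt_sum (f {}) js (hyb r) \<ominus>\<^bsub>f {}\<^esub> alt_sum (f {}) js (hyb (Suc r)) =
        alt_sum (f {}) js (\<lambda>I. hyb r I \<ominus>\<^bsub>f {}\<^esub> hyb (Suc r) I)"
      by (rule Q.alt_sum_minus[OF js hc hc, symmetric])
    also have "\<dots> = alt_sum (f {}) js (\<lambda>I. bracket (f {}) (map (\<lambda>k. x k I) [0..<n]))"
      by (rule Q.alt_sum_cong[OF js eq])
    also have "\<dots> \<in> ?D"
    proof (rule Cons.IH[where T = ?T])
      show "set js \<subseteq> ?S" by (rule js)
      show "(\<Union>k<n. ?T k) \<union> set js = ?S" using Cons.prems(2) r by (auto split: if_splits)
      show "x k I \<in> kernel_meet f \<phi> (?T k)" if "k < n" "I \<subseteq> ?S" for k I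
      proof (cases "k = r")
        case True
        have "x k I \<in> kernel_meet f \<phi> (T r)"
          using True that j Cons.prems(3) T[OF r]
          by (auto simp: x_def intro!: Q.submodule_minus submodule_kernel_meet)
        moreover have "x k I \<in> kernel_meet f \<phi> {j}"
          using True that j Cons.prems(4) by (auto simp: x_def)
        ultimately show ?thesis using True by (auto simp: mem_kernel_meet)
      next
        case False
        then show ?thesis using that j Cons.prems(3) by (auto simp: x_def v_def)
      qed
      show "x k I \<ominus>\<^bsub>f {}\<^esub> x k (insert i I) \<in> kernel_meet f \<phi> {i}"
        if k: "k < n" and I: "I \<subseteq> ?S" and i: "i \<in> ?S" for k I i
      proof -
        have 1: "w k I \<ominus>\<^bsub>f {}\<^esub> w k (insert i I) \<in> kernel_meet f \<phi> {i}"
          and 2: "w k (insert j I) \<ominus>\<^bsub>f {}\<^esub> w k (insert j (insert i I)) \<in> kernel_meet f \<phi> {i}"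
          using Cons.prems(4)[OF k I i] Cons.prems(4)[of k "insert j I" i] k I i j
          by (simp_all add: insert_commute)
        have "(w k I \<ominus>\<^bsub>f {}\<^esub> w k (insert j I)) \<ominus>\<^bsub>f {}\<^esub> (w k (insert i I)
            \<ominus>\<^bsub>f {}\<^esub> w k (insert j (insert i I)))
            \<in> kernel_meet f \<phi> {i}"
          using Q.submodule_minus[OF submodule_kernel_meet 1 2] i wc[OF k] I j
          by (subst Q.M.minus_minus_minus) auto
        then show ?thesis using 1 2 by (auto simp: x_def v_def)
      qed
    qed
    finally show ?thesis .
  qed
  have "alt_sum (f {}) js (hyb 0) \<ominus>\<^bsub>f {}\<^esub> alt_sum (f {}) js (hyb r) \<in> ?D" if "r \<le> n" for r
    using that
  proof (induction r)
    case 0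
    show ?case using Q.submodule_zero[OF submodule_hopf_denominator] ac
      by (simp add: Q.M.minus_self)
  next
    case (Suc r)
    then show ?case
      using Q.submoduleE(5)[OF submodule_hopf_denominator Suc.IH step[of r]] ac
      by (simp add: Q.M.minus_add_minus)
  qed
  from this[of n] have "alt_sum (f {}) js (hyb 0) \<ominus>\<^bsub>f {}\<^esub> alt_sum (f {}) js (hyb n) \<in> ?D" by simp
  moreover have "hyb 0 = (\<lambda>I. bracket (f {}) (map (\<lambda>k. w k I) [0..<n]))"
    "hyb n = (\<lambda>I. bracket (f {}) (map (\<lambda>k. w k (insert j I)) [0..<n]))"
    by (auto simp: hyb_def v_def intro!: ext arg_cong[of _ _ "bracket (f {})"])
  ultimately show ?case by simp
qed

text \<open>
  For a cube of homomorphisms \<open>u I\<close> that agree modulo the kernel of \<open>j\<close> in every direction \<open>j\<close>, the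
  alternating sum sends brackets into the denominator. It suffices to see this for brackets because
  the elements with this property form a subspace.
\<close>

lemma alt_sum_derived:
  assumes P: "lie_n_algebra n K P" and js: "set js = {1..m}"
    and u: "\<And>I. I \<subseteq> {1..m} \<Longrightarrow> u I \<in> lie_hom n K P (f {})"
    and uj: "\<And>I j x. \<lbrakk>I \<subseteq> {1..m}; j \<in> {1..m}; x \<in> carrier P\<rbrakk> \<Longrightarrow>
      \<phi> {} {j} (u I x) = \<phi> {} {j} (u (insert j I) x)"
    and x: "x \<in> derived_ideal n K P"
  shows "alt_sum (f {}) js (\<lambda>I. u I x) \<in> hopf_denominator n K m f \<phi>"
proof -
  interpret P: lie_n_algebra n K P by (rule P)
  interpret Q: lie_n_algebra n K "f {}" by (rule base_algebra)
  let ?D = "hopf_denominator n K m f \<phi>" and ?a = "\<lambda>x. alt_sum (f {}) js (\<lambda>I. u I x)"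
  have lin: "?a \<in> linear_maps K P (f {})"
    using js u by (intro alt_sum_linear[where S = "{1..m}"] P.module_axioms Q.module_axioms
        lie_hom_linear) auto
  have "derived_ideal n K P \<subseteq> {x \<in> carrier P. ?a x \<in> ?D}"
  proof (rule P.derived_subset)
    show "submodule {x \<in> carrier P. ?a x \<in> ?D} K P"
      by (rule submodule_vimage[OF P.module_axioms Q.module_axioms lin submodule_hopf_denominator])
    fix ls assume ls: "ls \<in> tuples n (carrier P)"
    have lsk: "ls ! k \<in> carrier P" if "k < n" for k by (rule tuples_nth[OF ls that])
    have "u I (bracket P ls) = bracket (f {}) (map (\<lambda>k. u I (ls ! k)) [0..<n])" if "I \<subseteq> {1..m}"
        for I
    proof -
      have "map (u I) ls = map (\<lambda>k. u I (ls ! k)) [0..<n]"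
        using ls by (auto simp: tuples_def intro!: nth_equalityI)
      then show ?thesis using lie_hom_bracket[OF u[OF that] ls] by simp
    qed
    then have "?a (bracket P ls) =
        alt_sum (f {}) js (\<lambda>I. bracket (f {}) (map (\<lambda>k. u I (ls ! k)) [0..<n]))"
      using js by (intro Q.alt_sum_cong[of _ "{1..m}"]) auto
    also have "\<dots> \<in> ?D"
    proof (rule alt_sum_bracket[where T = "\<lambda>_. {}"])
      fix k I j assume k: "k < n" and I: "I \<subseteq> {1..m}" and j: "j \<in> {1..m}"
      have c: "u I (ls ! k) \<in> carrier (f {})" "u (insert j I) (ls ! k) \<in> carrier (f {})"
        using lie_hom_closed[OF u lsk[OF k]] I j by auto
      interpret R: lie_n_algebra n K "f {j}" using j by (intro arrow_obj) auto
      have "\<phi> {} {j} (u (insert j I) (ls ! k)) \<in> carrier (f {j})"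
        using c j by (intro arrow_closed) auto
      then show "u I (ls ! k) \<ominus>\<^bsub>f {}\<^esub> u (insert j I) (ls ! k) \<in> kernel_meet f \<phi> {j}"
        using c j uj[OF I j lsk[OF k]] by (auto simp: mem_kernel_meet arrow_minus R.M.minus_self)
    qed (use js lie_hom_closed[OF u lsk] in \<open>auto simp: mem_kernel_meet\<close>)
    finally show "bracket P ls \<in> {x \<in> carrier P. ?a x \<in> ?D}" using P.bracket_closed[OF ls] by simp
  qed
  then show ?thesis using x by auto
qed

end

section \<open>Maps of cubes\<close>

definition cube_map ::
  "nat \<Rightarrow> ('k, 'r) ring_scheme \<Rightarrow> nat \<Rightarrow> (nat set \<Rightarrow> ('k, 'a) nlie) \<Rightarrow>
   (nat set \<Rightarrow> nat set \<Rightarrow> 'a \<Rightarrow> 'a) \<Rightarrow> (nat set \<Rightarrow> ('k, 'b) nlie) \<Rightarrow>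
   (nat set \<Rightarrow> nat set \<Rightarrow> 'b \<Rightarrow> 'b) \<Rightarrow> (nat set \<Rightarrow> 'a \<Rightarrow> 'b) \<Rightarrow> bool" where
  "cube_map n K m f \<phi> f' \<phi>' g \<longleftrightarrow>
     (\<forall>I. I \<subseteq> {1..m} \<longrightarrow> g I \<in> lie_hom n K (f I) (f' I)) \<and>
     (\<forall>I J. I \<subseteq> J \<and> J \<subseteq> {1..m} \<longrightarrow> (\<forall>x\<in>carrier (f I). \<phi>' I J (g I x) = g J (\<phi> I J x)))"

lemma cube_mapD:
  assumes "cube_map n K m f \<phi> f' \<phi>' g"
  shows "I \<subseteq> {1..m} \<Longrightarrow> g I \<in> lie_hom n K (f I) (f' I)"
    and "\<lbrakk>I \<subseteq> J; J \<subseteq> {1..m}; x \<in> carrier (f I)\<rbrakk> \<Longrightarrow> \<phi>' I J (g I x) = g J (\<phi> I J x)"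
  using assms by (simp_all add: cube_map_def)

text \<open>
  A pair \<open>(I, J)\<close> stands for a map \<open>f J \<rightarrow> f' I\<close>. It has to be compatible with the edge \<open>I \<rightarrow> I'\<close>
  of the target, which leads to the pair \<open>(I', J \<union> I')\<close>.
\<close>

definition upclosed_pairs :: "nat \<Rightarrow> (nat set \<times> nat set) set \<Rightarrow> bool" where
  "upclosed_pairs m B \<longleftrightarrow> (\<forall>(I, J)\<in>B. I \<subseteq> J \<and> J \<subseteq> {1..m} \<and>
     (\<forall>I'. I \<subseteq> I' \<and> I' \<subseteq> {1..m} \<longrightarrow> (I', J \<union> I') \<in> B))"

lemma upclosed_pairsD:
  assumes "upclosed_pairs m B" "(I, J) \<in> B"
  shows "I \<subseteq> J" "J \<subseteq> {1..m}" "I \<subseteq> {1..m}"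
    and "\<And>I'. \<lbrakk>I \<subseteq> I'; I' \<subseteq> {1..m}\<rbrakk> \<Longrightarrow> (I', J \<union> I') \<in> B"
proof -
  have *: "I \<subseteq> J \<and> J \<subseteq> {1..m} \<and> (\<forall>I'. I \<subseteq> I' \<and> I' \<subseteq> {1..m} \<longrightarrow> (I', J \<union> I') \<in> B)"
    using assms unfolding upclosed_pairs_def by auto
  show "I \<subseteq> J" "J \<subseteq> {1..m}" "I \<subseteq> {1..m}" using * by blast+
  show "(I', J \<union> I') \<in> B" if "I \<subseteq> I'" "I' \<subseteq> {1..m}" for I' using * that by blast
qed

locale cubes = ground n K + src: fold_arrow n K m f \<phi> + tgt: fold_extension n K m f' \<phi>'
  for n :: nat and K :: "('k, 'r) ring_scheme" (structure) and m :: nat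
    and f :: "nat set \<Rightarrow> ('k, 'a) nlie" and \<phi>
    and f' :: "nat set \<Rightarrow> ('k, 'b) nlie" and \<phi>'
begin

text \<open>
  On the diagonal a system is a map of cubes. Composing \<open>c {} I\<close> with \<open>\<phi> {} I\<close> yields homomorphisms
  out of the initial vertex that factor through the vertex \<open>I\<close>, and inserting \<open>j\<close> into \<open>I\<close> changes
  them only by elements of the kernel in the direction \<open>j\<close>.
\<close>

definition system :: "(nat set \<times> nat set) set \<Rightarrow> (nat set \<Rightarrow> nat set \<Rightarrow> 'a \<Rightarrow> 'b) \<Rightarrow> bool" where
  "system B c \<longleftrightarrow> (\<forall>(I, J)\<in>B. c I J \<in> lie_hom n K (f J) (f' I) \<and>
     (\<forall>I'. I \<subseteq> I' \<and> I' \<subseteq> {1..m} \<longrightarrow>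
        (\<forall>x\<in>carrier (f J). \<phi>' I I' (c I J x) = c I' (J \<union> I') (\<phi> J (J \<union> I') x))))"

lemma systemD:
  assumes "system B c" "(I, J) \<in> B"
  shows "c I J \<in> lie_hom n K (f J) (f' I)"
    and "\<And>I' x. \<lbrakk>I \<subseteq> I'; I' \<subseteq> {1..m}; x \<in> carrier (f J)\<rbrakk> \<Longrightarrow>
      \<phi>' I I' (c I J x) = c I' (J \<union> I') (\<phi> J (J \<union> I') x)"
  using assms unfolding system_def by auto

lemma extension_lift:
  assumes I: "I \<subset> {1..m}"
    and y: "\<And>J. \<lbrakk>I \<subset> J; J \<subseteq> {1..m}\<rbrakk> \<Longrightarrow> y J \<in> carrier (f' J)"
    and comp: "\<And>J H. \<lbrakk>I \<subset> J; J \<subseteq> H; H \<subseteq> {1..m}\<rbrakk> \<Longrightarrow> \<phi>' J H (y J) = y H"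
  shows "\<exists>z\<in>carrier (f' I). \<forall>J. I \<subset> J \<and> J \<subseteq> {1..m} \<longrightarrow> \<phi>' I J z = y J"
proof -
  let ?T = "{J. I \<subset> J \<and> J \<subseteq> {1..m}}"
  have "restrict y ?T \<in> upper_limit m f' \<phi>' I"
    unfolding upper_limit_def
  proof (intro CollectI conjI allI impI)
    show "restrict y ?T \<in> (\<Pi>\<^sub>E J\<in>?T. carrier (f' J))" using y by (simp add: restrict_PiE_iff)
    fix J H assume JH: "I \<subset> J \<and> J \<subseteq> H \<and> H \<subseteq> {1..m}"
    then have "I \<subset> H" "J \<subseteq> {1..m}" by blast+
    then show "\<phi>' J H (restrict y ?T J) = restrict y ?T H" using JH comp by simp
  qed
  then obtain z where "z \<in> carrier (f' I)" "(\<lambda>J\<in>?T. \<phi>' I J z) = restrict y ?T"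
    unfolding tgt.extension[OF I, symmetric] by auto
  then show ?thesis by (intro bexI[of _ z]) (auto simp: restrict_def fun_eq_iff split: if_splits)
qed

text \<open>
  The missing pairs are added one by one, those with large first component first: then the values
  on all larger pairs are already known and form a compatible family, which lifts because the cube
  in the target is an extension and the algebra in the source is a retract of a free one.
\<close>

lemma extend_system_one:
  assumes B: "upclosed_pairs m B" and c: "system B c" and top: "I \<noteq> {1..m}"
    and new: "(I, J) \<notin> B" "I \<subseteq> J" "J \<subseteq> {1..m}"
    and above: "\<And>I'. \<lbrakk>I \<subset> I'; I' \<subseteq> {1..m}\<rbrakk> \<Longrightarrow> (I', J \<union> I') \<in> B"
    and retr: "retract_of_free n K X (f J)"
  shows "\<exists>r. system (insert (I, J) B) (\<lambda>I0 J0. if I0 = I \<and> J0 = J then r else c I0 J0)"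
proof -
  let ?T = "{I'. I \<subset> I' \<and> I' \<subseteq> {1..m}}"
  let ?k = "\<lambda>I' x. c I' (J \<union> I') (\<phi> J (J \<union> I') x)"
  have I: "I \<subset> {1..m}" using top new by auto
  have k: "?k I' \<in> lie_hom n K (f J) (f' I')" if "I' \<in> ?T" for I'
    using that new systemD(1)[OF c above]
    by (intro lie_hom_compose[OF src.arrow_map]) auto
  have "\<exists>r\<in>lie_hom n K (f J) (f' I). \<forall>I'\<in>?T. \<forall>x\<in>carrier (f J). \<phi>' I I' (r x) = ?k I' x"
  proof (rule retract_of_free_lift[where Q = f', OF retr])
    show "lie_n_algebra n K (f' I)" using I by (intro tgt.arrow_obj) auto
    fix x assume x: "x \<in> carrier (f J)"
    have "\<exists>z\<in>carrier (f' I). \<forall>I'. I \<subset> I' \<and> I' \<subseteq> {1..m} \<longrightarrow> \<phi>' I I' z = ?k I' x"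
    proof (rule extension_lift[OF I])
      show "?k I' x \<in> carrier (f' I')" if "I \<subset> I'" "I' \<subseteq> {1..m}" for I'
        using lie_hom_closed[OF k x] that by auto
      show "\<phi>' I' H (?k I' x) = ?k H x" if "I \<subset> I'" "I' \<subseteq> H" "H \<subseteq> {1..m}" for I' H
      proof -
        have un: "J \<union> I' \<union> H = J \<union> H" using that by auto
        have "\<phi>' I' H (?k I' x) = c H (J \<union> I' \<union> H) (\<phi> (J \<union> I') (J \<union> I' \<union> H) (\<phi> J (J \<union> I') x))"
          using that new x
          by (intro systemD(2)[OF c above] src.arrow_closed) auto
        also have "\<phi> (J \<union> I') (J \<union> I' \<union> H) (\<phi> J (J \<union> I') x) = \<phi> J (J \<union> I' \<union> H) x"
          using that new x by (intro src.arrow_comp) auto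
        finally show ?thesis by (simp only: un)
      qed
    qed
    then show "\<exists>z\<in>carrier (f' I). \<forall>I'\<in>?T. \<phi>' I I' z = ?k I' x" by auto
  qed (use k I in \<open>auto intro!: tgt.arrow_obj tgt.arrow_map\<close>)
  then obtain r where r: "r \<in> lie_hom n K (f J) (f' I)"
    and rk: "\<And>I' x. \<lbrakk>I \<subset> I'; I' \<subseteq> {1..m}; x \<in> carrier (f J)\<rbrakk> \<Longrightarrow> \<phi>' I I' (r x) = ?k I' x" by auto
  let ?c = "\<lambda>I0 J0. if I0 = I \<and> J0 = J then r else c I0 J0"
  have old: "?c I0 J0 = c I0 J0" if "(I0, J0) \<in> B" for I0 J0 using that new by auto
  have "system (insert (I, J) B) ?c"
    unfolding system_def
  proof (clarify, intro conjI allI impI ballI)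
    fix I0 J0 assume IJ: "(I0, J0) \<in> insert (I, J) B"
    then show "?c I0 J0 \<in> lie_hom n K (f J0) (f' I0)" using r systemD(1)[OF c] by auto
    fix I' x assume I': "I0 \<subseteq> I' \<and> I' \<subseteq> {1..m}" and x: "x \<in> carrier (f J0)"
    show "\<phi>' I0 I' (?c I0 J0 x) = ?c I' (J0 \<union> I') (\<phi> J0 (J0 \<union> I') x)"
    proof (cases "I0 = I \<and> J0 = J")
      case True
      show ?thesis
      proof (cases "I' = I")
        case True
        then show ?thesis using \<open>I0 = I \<and> J0 = J\<close> new x I lie_hom_closed[OF r]
          by (simp add: sup.absorb1 src.arrow_id tgt.arrow_id)
      next
        case False
        then have I': "I \<subset> I'" "I' \<subseteq> {1..m}" using I' \<open>I0 = I \<and> J0 = J\<close> by auto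
        then show ?thesis using rk[OF I'] x \<open>I0 = I \<and> J0 = J\<close> old[OF above[OF I']] by auto
      qed
    next
      case False
      then have IJ0: "(I0, J0) \<in> B" using IJ by auto
      have "(I', J0 \<union> I') \<in> B" using I' by (intro upclosed_pairsD(4)[OF B IJ0]) auto
      then show ?thesis
        unfolding old[OF IJ0] old[OF \<open>(I', J0 \<union> I') \<in> B\<close>]
        using I' x by (intro systemD(2)[OF c IJ0]) auto
    qed
  qed
  then show ?thesis by blast
qed

lemma extend_system:
  assumes U: "upclosed_pairs m U" and B: "upclosed_pairs m B" "B \<subseteq> U"
    and top: "({1..m}, {1..m}) \<in> B" and c: "system B c"
    and retr: "\<And>I J. (I, J) \<in> U - B \<Longrightarrow> retract_of_free n K (X J) (f J)"
  shows "\<exists>c'. system U c' \<and> (\<forall>(I, J)\<in>B. c' I J = c I J)"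
proof -
  have finU: "finite U"
  proof (rule finite_subset)
    show "U \<subseteq> Pow {1..m} \<times> Pow {1..m}"
    proof (rule subrelI)
      fix I J assume "(I, J) \<in> U"
      then show "(I, J) \<in> Pow {1..m} \<times> Pow {1..m}" using upclosed_pairsD(2,3)[OF U] by simp
    qed
  qed simp
  show ?thesis
    using B top c retr
  proof (induction "card (U - B)" arbitrary: B c rule: less_induct)
    case less
    show ?case
    proof (cases "U = B")
      case True
      then show ?thesis using less by blast
    next
      case False
      let ?M = "Max ((card \<circ> fst) ` (U - B))"
      have fin: "finite ((card \<circ> fst) ` (U - B))" using finU by simp
      have "?M \<in> (card \<circ> fst) ` (U - B)" using False less.prems(2) fin by (intro Max_in) auto
      then obtain I J where IJ: "(I, J) \<in> U - B" and M: "card I = ?M" by force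
      note IJ' = upclosed_pairsD[OF U, of I J]
      have max: "card I' \<le> card I" if "(I', J') \<in> U - B" for I' J'
        unfolding M using fin that by (intro Max_ge) force+
      have above: "(I', J \<union> I') \<in> B" if "I \<subset> I'" "I' \<subseteq> {1..m}" for I'
      proof (rule ccontr)
        assume "(I', J \<union> I') \<notin> B"
        then have "card I' \<le> card I" using IJ' IJ that by (intro max[of _ "J \<union> I'"]) auto
        moreover have "card I < card I'" using that
          by (intro psubset_card_mono) (auto intro: finite_subset)
        ultimately show False by simp
      qed
      have "I \<noteq> {1..m}"
      proof
        assume "I = {1..m}"
        moreover from this have "J = {1..m}" using IJ IJ' by blast
        ultimately show False using IJ less.prems(3) by simp
      qed
      have new: "(I, J) \<notin> B" "I \<subseteq> J" "J \<subseteq> {1..m}" using IJ IJ' by auto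
      have "\<exists>r. system (insert (I, J) B) (\<lambda>I0 J0. if I0 = I \<and> J0 = J then r else c I0 J0)"
        by (rule extend_system_one[OF less.prems(1,4) \<open>I \<noteq> {1..m}\<close> new above less.prems(5)[OF IJ]])
      then obtain r where r: "system (insert (I, J) B) (\<lambda>I0 J0. if I0 = I \<and> J0 =
          J then r else c I0 J0)" ..
      have "\<exists>c'. system U c' \<and>
          (\<forall>(I0, J0)\<in>insert (I, J) B. c' I0 J0 = (if I0 = I \<and> J0 = J then r else c I0 J0))"
      proof (rule less.hyps[OF _ _ _ _ r])
        show "card (U - insert (I, J) B) < card (U - B)"
          using IJ finU by (intro psubset_card_mono) auto
        show "upclosed_pairs m (insert (I, J) B)"
          unfolding upclosed_pairs_def
        proof (clarify, intro conjI allI impI)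
          fix I0 J0 assume IJ0: "(I0, J0) \<in> insert (I, J) B"
          then show "I0 \<subseteq> J0" "J0 \<subseteq> {1..m}"
            using upclosed_pairsD(1,2)[OF less.prems(1), of I0 J0] new(2,3) by blast+
          fix I' assume I': "I0 \<subseteq> I' \<and> I' \<subseteq> {1..m}"
          show "(I', J0 \<union> I') \<in> insert (I, J) B"
          proof (cases "(I0, J0) = (I, J)")
            case True
            then show ?thesis using above I' IJ IJ'(1) by (cases "I' = I") (auto simp: sup.absorb1)
          next
            case False
            then show ?thesis using IJ0 I' upclosed_pairsD(4)[OF less.prems(1)] by auto
          qed
        qed
      qed (use IJ less.prems in auto)
      then obtain c' where "system U c'"
        "\<forall>(I0, J0)\<in>insert (I, J) B. c' I0 J0 = (if I0 = I \<and> J0 = J then r else c I0 J0)"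
        by (elim exE conjE)
      then show ?thesis using new(1) by (intro exI[of _ c']) auto
    qed
  qed
qed

lemma cube_map_extend:
  assumes top: "{1..m} \<in> V" and up: "\<And>I J. \<lbrakk>I \<in> V; I \<subseteq> J; J \<subseteq> {1..m}\<rbrakk> \<Longrightarrow> J \<in> V"
    and g: "\<And>I. \<lbrakk>I \<in> V; I \<subseteq> {1..m}\<rbrakk> \<Longrightarrow> g I \<in> lie_hom n K (f I) (f' I)"
    and nat: "\<And>I J x. \<lbrakk>I \<in> V; I \<subseteq> J; J \<subseteq> {1..m}; x \<in> carrier (f I)\<rbrakk> \<Longrightarrow> \<phi>' I J (g I x) =
        g J (\<phi> I J x)"
    and retr: "\<And>I. \<lbrakk>I \<subseteq> {1..m}; I \<notin> V\<rbrakk> \<Longrightarrow> retract_of_free n K (X I) (f I)"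
  shows "\<exists>g'. cube_map n K m f \<phi> f' \<phi>' g' \<and> (\<forall>I. I \<in> V \<and> I \<subseteq> {1..m} \<longrightarrow> g' I = g I)"
proof -
  let ?U = "{(I, I) |I. I \<subseteq> {1..m}}" and ?B = "{(I, I) |I. I \<in> V \<and> I \<subseteq> {1..m}}"
  have "\<exists>c. system ?U c \<and> (\<forall>(I, J)\<in>?B. c I J = (\<lambda>I J. g I) I J)"
  proof (rule extend_system)
    show "upclosed_pairs m ?U" by (auto simp: upclosed_pairs_def)
    show "upclosed_pairs m ?B" using up by (auto simp: upclosed_pairs_def sup.absorb2)
    show "system ?B (\<lambda>I J. g I)"
      using g nat by (auto simp: system_def sup.absorb2)
    show "retract_of_free n K (X J) (f J)" if "(I, J) \<in> ?U - ?B" for I J using that retr by auto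
  qed (use top in auto)
  then obtain c where c: "system ?U c" and cg: "\<And>I. \<lbrakk>I \<in> V; I \<subseteq> {1..m}\<rbrakk> \<Longrightarrow> c I I = g I" by auto
  have "cube_map n K m f \<phi> f' \<phi>' (\<lambda>I. c I I)"
    unfolding cube_map_def using systemD[OF c] by (auto simp: sup.absorb2)
  then show ?thesis using cg by blast
qed

definition projection :: "(nat set \<Rightarrow> nat set \<Rightarrow> 'a \<Rightarrow> 'b) \<Rightarrow> nat list \<Rightarrow> 'a \<Rightarrow> 'b" where
  "projection c js x = alt_sum (f' {}) js (\<lambda>I. c {} I (\<phi> {} I x))"

context
  fixes c and js :: "nat list"
  assumes c: "system {(I, J). I \<subseteq> J \<and> J \<subseteq> {1..m}} c" and js: "set js = {1..m}"
begin

lemma system_term_hom: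
  "I \<subseteq> {1..m} \<Longrightarrow> (\<lambda>x. c {} I (\<phi> {} I x)) \<in> lie_hom n K (f {}) (f' {})"
  using systemD(1)[OF c, of "{}" I] by (intro lie_hom_compose[OF src.arrow_map]) auto

lemma system_term_step:
  assumes "I \<subseteq> {1..m}" "j \<in> {1..m}" "x \<in> carrier (f {})"
  shows "\<phi>' {} {j} (c {} I (\<phi> {} I x)) = c {j} (insert j I) (\<phi> {} (insert j I) x)"
proof -
  have "\<phi>' {} {j} (c {} I (\<phi> {} I x)) = c {j} (I \<union> {j}) (\<phi> I (I \<union> {j}) (\<phi> {} I x))"
    using assms by (intro systemD(2)[OF c] src.arrow_closed) auto
  also have "\<phi> I (I \<union> {j}) (\<phi> {} I x) = \<phi> {} (I \<union> {j}) x"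
    using assms by (intro src.arrow_comp) auto
  finally show ?thesis by simp
qed

lemma projection_linear: "projection c js \<in> linear_maps K (f {}) (f' {})"
  unfolding projection_def[abs_def]
  using js system_term_hom
  by (intro alt_sum_linear[where S = "{1..m}"] lie_n_algebra_module[OF src.base_algebra]
      lie_n_algebra_module[OF tgt.base_algebra] lie_hom_linear) auto

text \<open>
  In each direction \<open>j\<close>, the terms at \<open>I\<close> and \<open>insert j I\<close> have the same image and cancel.
\<close>

lemma projection_kernel:
  assumes x: "x \<in> carrier (f {})"
  shows "projection c js x \<in> kernel_meet f' \<phi>' {1..m}"
proof -
  have tc: "c {} I (\<phi> {} I x) \<in> carrier (f' {})" if "I \<subseteq> {1..m}" for I
    using lie_hom_closed[OF system_term_hom[OF that] x] .
  have "\<phi>' {} {j} (projection c js x) = \<zero>\<^bsub>f' {j}\<^esub>" if j: "j \<in> {1..m}" for j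
  proof -
    interpret R: lie_n_algebra n K "f' {j}" using j by (intro tgt.arrow_obj) auto
    have hom: "\<phi>' {} {j} \<in> lie_hom n K (f' {}) (f' {j})" using j by (intro tgt.arrow_map) auto
    have "\<phi>' {} {j} (projection c js x) = alt_sum (f' {j}) js (\<lambda>I. \<phi>' {} {j} (c {} I (\<phi> {} I x)))"
      unfolding projection_def
      by (rule alt_sum_hom[OF lie_n_algebra_module[OF tgt.base_algebra] R.module_axioms
            lie_hom_linear[OF hom], of _ "{1..m}"]) (use js tc in auto)
    also have "\<dots> = \<zero>\<^bsub>f' {j}\<^esub>"
      by (rule R.alt_sum_cancel[of _ "{1..m}" j])
        (use js j x system_term_step lie_hom_closed[OF hom tc] in auto)
    finally show ?thesis .
  qed
  then show ?thesis using linear_maps_closed[OF projection_linear x] by (simp add: mem_kernel_meet)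
qed

lemma projection_derived:
  assumes "x \<in> derived_ideal n K (f {})"
  shows "projection c js x \<in> hopf_denominator n K m f' \<phi>'"
  unfolding projection_def
proof (rule tgt.alt_sum_derived[OF src.base_algebra js system_term_hom _ assms])
  fix I j x assume "I \<subseteq> {1..m}" "j \<in> {1..m}" "x \<in> carrier (f {})"
  then show "\<phi>' {} {j} (c {} I (\<phi> {} I x)) = \<phi>' {} {j} (c {} (insert j I) (\<phi> {} (insert j I) x))"
    using system_term_step[of I j x] system_term_step[of "insert j I" j x] by simp
qed

end

text \<open>
  The source is replaced by the cube that is constant in the direction \<open>i\<close>; all its objects are
  retracts of free algebras, even at the terminal vertex. Since \<open>g\<close> and \<open>h\<close> agree at the vertices
  that contain \<open>i\<close>, they extend to systems that agree on all pairs \<open>(I, J)\<close> with \<open>i \<in> J\<close>. On the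
  intersection of the kernels only the terms at \<open>{}\<close> and \<open>{i}\<close> of the two projections survive, and
  the terms at \<open>{i}\<close> are equal.
\<close>

lemma cube_maps_agree_in_direction:
  assumes g: "cube_map n K m f \<phi> f' \<phi>' g" and h: "cube_map n K m f \<phi> f' \<phi>' h"
    and i: "i \<in> {1..m}"
    and agree: "\<And>I x. \<lbrakk>i \<in> I; I \<subseteq> {1..m}; x \<in> carrier (f I)\<rbrakk> \<Longrightarrow> g I x = h I x"
    and retr: "\<And>J. J \<subset> {1..m} \<Longrightarrow> retract_of_free n K (X J) (f J)"
    and xD: "x \<in> derived_ideal n K (f {})" and xK: "x \<in> kernel_meet f \<phi> {1..m}"
  shows "g {} x \<ominus>\<^bsub>f' {}\<^esub> h {} x \<in> hopf_denominator n K m f' \<phi>'"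
proof -
  let ?f = "\<lambda>J. f (J - {i})" and ?\<phi> = "\<lambda>I J. \<phi> (I - {i}) (J - {i})"
  let ?U = "{(I, J). I \<subseteq> J \<and> J \<subseteq> {1..m}}"
  let ?D = "{(I, I) |I. I \<subseteq> {1..m}}"
  let ?B = "{(I, J). I \<subseteq> J \<and> J \<subseteq> {1..m} \<and> (I = J \<or> i \<in> J)}"
  have "fold_arrow n K m ?f ?\<phi>"
  proof (rule fold_arrow.intro)
    show "lie_n_algebra n K (?f I)" if "I \<subseteq> {1..m}" for I using that by (intro src.arrow_obj) auto
    show "?\<phi> I J \<in> lie_hom n K (?f I) (?f J)" if "I \<subseteq> J" "J \<subseteq> {1..m}" for I J
      using that by (intro src.arrow_map) auto
    show "?\<phi> I I x = x" if "I \<subseteq> {1..m}" "x \<in> carrier (?f I)" for I x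
      using that by (intro src.arrow_id) auto
    show "?\<phi> J H (?\<phi> I J x) = ?\<phi> I H x"
      if "I \<subseteq> J" "J \<subseteq> H" "H \<subseteq> {1..m}" "x \<in> carrier (?f I)" for I J H x
      using that by (intro src.arrow_comp) auto
  qed
  then interpret P: cubes n K m ?f ?\<phi> f' \<phi>'
    by (intro cubes.intro ground_axioms tgt.fold_extension_axioms)
  have retr': "retract_of_free n K (X (J - {i})) (?f J)" if "J \<subseteq> {1..m}" for J
    using that i by (intro retr) auto
  have U: "upclosed_pairs m ?U" and D: "upclosed_pairs m ?D" and B: "upclosed_pairs m ?B"
    unfolding upclosed_pairs_def by auto
  \<comment> \<open>the restriction of a map of cubes to the source that is constant in the direction \<open>i\<close>\<close>
  define pre :: "(nat set \<Rightarrow> 'a \<Rightarrow> 'b) \<Rightarrow> nat set \<Rightarrow> 'a \<Rightarrow> 'b"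
      where "pre k I x = k I (\<phi> (I - {i}) I x)" for k I x
  have pre_hom: "pre k I \<in> lie_hom n K (?f I) (f' I)"
    if k: "cube_map n K m f \<phi> f' \<phi>' k" and I: "I \<subseteq> {1..m}" for k I
    unfolding pre_def[abs_def] using k I
    by (intro lie_hom_compose[OF src.arrow_map]) (auto simp: cube_map_def)
  have pre_nat: "\<phi>' I I' (pre k I x) = pre k I' (?\<phi> I I' x)"
    if k: "cube_map n K m f \<phi> f' \<phi>' k" and I: "I \<subseteq> I'" "I' \<subseteq> {1..m}" and x: "x \<in> carrier (?f I)"
        for k I I' x
  proof -
    have "\<phi> I I' (\<phi> (I - {i}) I x) = \<phi> (I' - {i}) I' (?\<phi> I I' x)"
      using I x by (subst src.arrow_comp, auto)+
    moreover have "\<phi> (I - {i}) I x \<in> carrier (f I)" using I x by (intro src.arrow_closed) auto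
    ultimately show ?thesis using k I unfolding pre_def cube_map_def by simp
  qed
  have sysD: "P.system ?D (\<lambda>I J. pre g I)"
    unfolding P.system_def using pre_hom[OF g] pre_nat[OF g] by (auto simp: sup.absorb2)
  obtain c where c: "P.system ?U c" and cg: "\<And>I. I \<subseteq> {1..m} \<Longrightarrow> c I I = pre g I"
  proof -
    have "\<exists>c. P.system ?U c \<and> (\<forall>(I, J)\<in>?D. c I J = (\<lambda>I J. pre g I) I J)"
    proof (rule P.extend_system[OF U D _ _ sysD])
      show "retract_of_free n K (X (J - {i})) (?f J)" if "(I, J) \<in> ?U - ?D" for I J
        using that by (intro retr') auto
    qed auto
    then show thesis using that by auto
  qed
  let ?c0 = "\<lambda>I J. if i \<in> J then c I J else pre h I"
  have pre_eq: "pre g I y = pre h I y" if "i \<in> I" "I \<subseteq> {1..m}" "y \<in> carrier (?f I)" for I y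
    unfolding pre_def using that by (intro agree src.arrow_closed) auto
  have sysB: "P.system ?B ?c0"
    unfolding P.system_def
  proof (clarify, intro conjI allI impI ballI)
    fix I J assume IJ: "I \<subseteq> J" "J \<subseteq> {1..m}" "I = J \<or> i \<in> J"
    then have IJU: "(I, J) \<in> ?U" by simp
    show "?c0 I J \<in> lie_hom n K (?f J) (f' I)"
      using IJ P.systemD(1)[OF c IJU] pre_hom[OF h, of J] by auto
    fix I' y assume I': "I \<subseteq> I' \<and> I' \<subseteq> {1..m}" and y: "y \<in> carrier (?f J)"
    show "\<phi>' I I' (?c0 I J y) = ?c0 I' (J \<union> I') (?\<phi> J (J \<union> I') y)"
    proof (cases "i \<in> J")
      case True
      then show ?thesis using P.systemD(2)[OF c IJU _ _ y] I' by simp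
    next
      case False
      then have J: "J = I" using IJ by auto
      have y': "?\<phi> I I' y \<in> carrier (?f I')" using I' y J by (intro P.src.arrow_closed) auto
      have "\<phi>' I I' (pre h I y) = pre h I' (?\<phi> I I' y)"
        using pre_nat[OF h _ _ y[unfolded J]] I' by blast
      also have "\<dots> = ?c0 I' I' (?\<phi> I I' y)" using cg pre_eq[OF _ _ y'] I' by auto
      finally show ?thesis using False I' unfolding J by (simp add: sup.absorb2)
    qed
  qed
  obtain d where d: "P.system ?U d" and dh: "d {} {} = pre h {}" and dc: "d {} {i} = c {} {i}"
  proof -
    have "\<exists>d. P.system ?U d \<and> (\<forall>(I, J)\<in>?B. d I J = ?c0 I J)"
    proof (rule P.extend_system[OF U B _ _ sysB])
      show "retract_of_free n K (X (J - {i})) (?f J)" if "(I, J) \<in> ?U - ?B" for I J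
        using that by (intro retr') auto
    qed auto
    then show thesis using that i by auto
  qed
  let ?rest = "sorted_list_of_set ({1..m} - {i})"
  have js: "set (i # ?rest) = {1..m}" using i by auto
  have xc: "x \<in> carrier (f {})" using xK by (simp add: mem_kernel_meet)
  interpret Q: lie_n_algebra n K "f' {}" by (rule tgt.base_algebra)
  have proj: "P.projection e (i # ?rest) x = k {} x \<ominus>\<^bsub>f' {}\<^esub> e {} {i} x"
    if e: "P.system ?U e" and k: "e {} {} = pre k {}" for e k
  proof -
    let ?t = "\<lambda>I. e {} I (?\<phi> {} I x)"
    have hom: "e {} I \<in> lie_hom n K (?f I) (f' {})" if "I \<subseteq> {1..m}" for I
      using P.systemD(1)[OF e, of "{}" I] that by simp
    have zero: "e {} I (?\<phi> {} I x) = \<zero>\<^bsub>f' {}\<^esub>" if I: "I \<subseteq> {1..m}" "I - {i} \<noteq> {}" for I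
    proof -
      have "\<phi> {} (I - {i}) x = \<zero>\<^bsub>?f I\<^esub>"
        by (rule src.kernel_meet_vanish[OF xK _ I(2)]) (use I in auto)
      then show ?thesis using lie_hom_zero[OF _ tgt.base_algebra hom[OF I(1)]]
          P.src.arrow_obj[OF I(1)] by simp
    qed
    have id: "\<phi> {} {} x = x" using xc by (intro src.arrow_id) auto
    have c0: "e {} {} x \<in> carrier (f' {})" "e {} {i} x \<in> carrier (f' {})"
      using lie_hom_closed[OF hom, of "{}" x] lie_hom_closed[OF hom, of "{i}" x] i xc by auto
    have "alt_sum (f' {}) ?rest ?t = ?t {}"
      using c0 zero id by (intro Q.alt_sum_only_empty[of _ "{1..m} - {i}"]) auto
    moreover have "alt_sum (f' {}) ?rest (\<lambda>I. ?t (insert i I)) = ?t (insert i {})"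
    proof (rule Q.alt_sum_only_empty[of _ "{1..m} - {i}"])
      fix I assume "I \<subseteq> {1..m} - {i}" "I \<noteq> {}"
      then show "?t (insert i I) = \<zero>\<^bsub>f' {}\<^esub>" using i by (intro zero) blast+
    qed (use c0 id in auto)
    ultimately show ?thesis unfolding P.projection_def using k id by (simp add: pre_def)
  qed
  have xD': "x \<in> derived_ideal n K (?f {})" using xD by simp
  let ?H = "hopf_denominator n K m f' \<phi>'"
  have "g {} x \<ominus>\<^bsub>f' {}\<^esub> c {} {i} x \<in> ?H" "h {} x \<ominus>\<^bsub>f' {}\<^esub> c {} {i} x \<in> ?H"
    using P.projection_derived[OF c js xD'] P.projection_derived[OF d js xD']
      proj[OF c cg[of "{}"]] proj[OF d dh] dc by simp_all
  note diff = Q.submodule_minus[OF tgt.submodule_hopf_denominator this]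
  have "c {} {i} \<in> lie_hom n K (?f {i}) (f' {})" using P.systemD(1)[OF c, of "{}" "{i}"] i by auto
  then have cl: "g {} x \<in> carrier (f' {})" "h {} x \<in> carrier (f' {})" "c {} {i} x \<in> carrier (f' {})"
    using lie_hom_closed[OF _ xc] cube_mapD(1)[OF g, of "{}"] cube_mapD(1)[OF h, of "{}"] by auto
  show ?thesis using diff cl by (simp add: Q.M.minus_minus_minus Q.M.minus_self Q.M.minus_zero)
qed

text \<open>
  Two maps of cubes that agree only at the top are connected by changing one vertex at a time:
  replacing \<open>g J\<close> by \<open>h J\<close> forces changes at subsets of \<open>J\<close> only, hence none in a direction
  outside \<open>J\<close>.
\<close>

lemma cube_maps_homotopic:
  assumes g: "cube_map n K m f \<phi> f' \<phi>' g" and h: "cube_map n K m f \<phi> f' \<phi>' h"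
    and top: "\<And>x. x \<in> carrier (f {1..m}) \<Longrightarrow> g {1..m} x = h {1..m} x"
    and retr: "\<And>J. J \<subset> {1..m} \<Longrightarrow> retract_of_free n K (X J) (f J)"
    and xD: "x \<in> derived_ideal n K (f {})" and xK: "x \<in> kernel_meet f \<phi> {1..m}"
  shows "g {} x \<ominus>\<^bsub>f' {}\<^esub> h {} x \<in> hopf_denominator n K m f' \<phi>'"
proof -
  interpret Q: lie_n_algebra n K "f' {}" by (rule tgt.base_algebra)
  have xc: "x \<in> carrier (f {})" using xK by (simp add: mem_kernel_meet)
  have cl: "k {} x \<in> carrier (f' {})" if "cube_map n K m f \<phi> f' \<phi>' k" for k
    using lie_hom_closed[OF cube_mapD(1)[OF that] xc] by simp
  have "\<forall>I\<in>V. \<forall>x\<in>carrier (f I). g I x = h I x \<Longrightarrow> ?thesis"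
    if "V \<subseteq> Pow {1..m}" "{1..m} \<in> V" "\<And>I J. \<lbrakk>I \<in> V; I \<subseteq> J; J \<subseteq> {1..m}\<rbrakk> \<Longrightarrow> J \<in> V" for V
    using that g
  proof (induction "card (Pow {1..m} - V)" arbitrary: V g rule: less_induct)
    case less
    note V = less.prems(2-4) and g = less.prems(5) and agree = less.prems(1)
    show ?case
    proof (cases "Pow {1..m} - V = {}")
      case True
      then have "g {} x = h {} x" using agree xc by blast
      then show ?thesis using cl[OF h] Q.submodule_zero[OF tgt.submodule_hopf_denominator]
        by (simp add: Q.M.minus_self)
    next
      case False
      let ?M = "Max (card ` (Pow {1..m} - V))"
      have "?M \<in> card ` (Pow {1..m} - V)" using False by (intro Max_in) auto
      then obtain J where J: "J \<subseteq> {1..m}" "J \<notin> V" and M: "card J = ?M" by force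
      have above: "J' \<in> V" if "J \<subset> J'" "J' \<subseteq> {1..m}" for J'
      proof (rule ccontr)
        assume "J' \<notin> V"
        then have "card J' \<le> card J" unfolding M using that by (intro Max_ge) auto
        moreover have "card J < card J'" using that
          by (intro psubset_card_mono) (auto intro: finite_subset)
        ultimately show False by simp
      qed
      have "J \<noteq> {1..m}" using J V(2) by auto
      then obtain i where i: "i \<in> {1..m}" "i \<notin> J" using J(1) by blast
      \<comment> \<open>Outside the subsets of \<open>J\<close> the new map coincides with \<open>g\<close>, at \<open>J\<close> with \<open>h\<close>.\<close>
      let ?W = "{I. I \<subseteq> {1..m} \<and> (\<not> I \<subseteq> J \<or> I = J)}"
      let ?k = "\<lambda>I. if I = J then h I else g I"
      have "\<exists>k. cube_map n K m f \<phi> f' \<phi>' k \<and> (\<forall>I. I \<in> ?W \<and> I \<subseteq> {1..m} \<longrightarrow> k I = ?k I)"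
      proof (rule cube_map_extend)
        show "{1..m} \<in> ?W" using i by auto
        show "H \<in> ?W" if "I \<in> ?W" "I \<subseteq> H" "H \<subseteq> {1..m}" for I H using that by auto
        show "?k I \<in> lie_hom n K (f I) (f' I)" if "I \<in> ?W" for I
          using that g h by (auto simp: cube_map_def)
        show "\<phi>' I H (?k I y) = ?k H (\<phi> I H y)"
          if I: "I \<in> ?W" "I \<subseteq> H" "H \<subseteq> {1..m}" and y: "y \<in> carrier (f I)" for I H y
        proof (cases "I = J \<and> H \<noteq> J")
          case True
          then have "H \<in> V" using above[of H] I by blast
          then have "g H (\<phi> I H y) = h H (\<phi> I H y)"
            using agree src.arrow_closed[OF I(2,3) y] by blast
          moreover have "\<phi>' I H (h I y) = h H (\<phi> I H y)"
            by (rule cube_mapD(2)[OF h I(2,3) y])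
          ultimately show ?thesis using True by simp
        next
          case False
          then have "(I = J \<and> H = J) \<or> (I \<noteq> J \<and> H \<noteq> J)" using I by blast
          moreover have "\<phi>' I H (g I y) = g H (\<phi> I H y)" "\<phi>' I H (h I y) = h H (\<phi> I H y)"
            using cube_mapD(2)[OF g I(2,3) y] cube_mapD(2)[OF h I(2,3) y] by simp_all
          ultimately show ?thesis by (elim disjE) simp_all
        qed
        show "retract_of_free n K (X I) (f I)" if "I \<subseteq> {1..m}" "I \<notin> ?W" for I
          using that J by (intro retr) auto
      qed
      then obtain k where k: "cube_map n K m f \<phi> f' \<phi>' k"
        and kk: "\<forall>I. I \<in> ?W \<and> I \<subseteq> {1..m} \<longrightarrow> k I = ?k I" by (elim exE conjE)
      have kW: "k I = g I" if "I \<subseteq> {1..m}" "\<not> I \<subseteq> J" for I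
      proof -
        have "I \<noteq> J" using that by blast
        then show ?thesis using kk that by simp
      qed
      have kJ: "k J = h J" using kk J(1) by simp
      have 1: "g {} x \<ominus>\<^bsub>f' {}\<^esub> k {} x \<in> hopf_denominator n K m f' \<phi>'"
      proof (rule cube_maps_agree_in_direction[OF g k i(1) _ retr xD xK])
        show "g I y = k I y" if "i \<in> I" "I \<subseteq> {1..m}" for I y
        proof -
          have "\<not> I \<subseteq> J" using that i by blast
          then show ?thesis using kW that by simp
        qed
      qed
      have 2: "k {} x \<ominus>\<^bsub>f' {}\<^esub> h {} x \<in> hopf_denominator n K m f' \<phi>'"
      proof (rule less.hyps[OF _ _ _ _ _ k, where V = "insert J V"])
        show "card (Pow {1..m} - insert J V) < card (Pow {1..m} - V)"
          using J by (intro psubset_card_mono) auto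
        show "\<forall>I\<in>insert J V. \<forall>y\<in>carrier (f I). k I y = h I y"
        proof (intro ballI)
          fix I y assume I: "I \<in> insert J V" and y: "y \<in> carrier (f I)"
          show "k I y = h I y"
          proof (cases "I = J")
            case True
            then show ?thesis using kJ by simp
          next
            case False
            then have "I \<in> V" using I by simp
            moreover have "\<not> I \<subseteq> J" using V(3)[OF \<open>I \<in> V\<close> _ J(1)] J(2) by blast
            moreover have "I \<subseteq> {1..m}" using \<open>I \<in> V\<close> V(1) by blast
            ultimately show ?thesis using kW agree y by simp
          qed
        qed
        show "H \<in> insert J V" if "I \<in> insert J V" "I \<subseteq> H" "H \<subseteq> {1..m}" for I H
        proof (cases "I = J")
          case True
          then show ?thesis using above that by blast
        next
          case False
          then show ?thesis using V(3)[of I H] that by blast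
        qed
      qed (use J V in auto)
      have "(g {} x \<ominus>\<^bsub>f' {}\<^esub> k {} x) \<oplus>\<^bsub>f' {}\<^esub> (k {} x \<ominus>\<^bsub>f' {}\<^esub> h {} x) \<in> hopf_denominator n K m f' \<phi>'"
        by (rule Q.submoduleE(5)[OF tgt.submodule_hopf_denominator 1 2])
      then show ?thesis using cl[OF g] cl[OF h] cl[OF k] by (simp add: Q.M.minus_add_minus)
    qed
  qed
  from this[of "{{1..m}}"] show ?thesis using top by auto
qed

end

section \<open>The cubes of the comonad resolution\<close>

context ground
begin

lemma lie_n_algebra_G_obj: "lie_n_algebra n K (G_obj n K A)"
  by (simp add: G_obj_def lie_n_algebra_free)

lemma G_map_hom:
  assumes "\<And>x. x \<in> carrier A \<Longrightarrow> h x \<in> carrier B"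
  shows "G_map n K B h \<in> lie_hom n K (G_obj n K A) (G_obj n K B)"
  unfolding G_map_def G_obj_def
  by (rule free_lift_hom[OF lie_n_algebra_free]) (use assms free_unit_closed in auto)

lemma G_map_unit:
  assumes "\<And>x. x \<in> carrier A \<Longrightarrow> h x \<in> carrier B" "x \<in> carrier A"
  shows "G_map n K B h (free_unit n K (carrier A) x) = free_unit n K (carrier B) (h x)"
  unfolding G_map_def G_obj_def
  by (subst free_lift_unit[OF lie_n_algebra_free, where X = "carrier A"])
    (use assms free_unit_closed in auto)

lemma G_counit_hom: "lie_n_algebra n K A \<Longrightarrow> G_counit A \<in> lie_hom n K (G_obj n K A) A"
  unfolding G_counit_def G_obj_def by (rule free_lift_hom) auto

lemma G_counit_unit:
  "\<lbrakk>lie_n_algebra n K A; x \<in> carrier A\<rbrakk> \<Longrightarrow> G_counit A (free_unit n K (carrier A) x) = x"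
  unfolding G_counit_def by (rule free_lift_unit) auto

lemma G_hom_unique:
  assumes "g \<in> lie_hom n K (G_obj n K A) B" "h \<in> lie_hom n K (G_obj n K A) B" "lie_n_algebra n K B"
    and "\<And>x. x \<in> carrier A \<Longrightarrow> g (free_unit n K (carrier A) x) = h (free_unit n K (carrier A) x)"
    and "t \<in> carrier (G_obj n K A)"
  shows "g t = h t"
  by (rule free_hom_unique[OF assms(1,2)[unfolded G_obj_def] assms(3,4)
      assms(5)[unfolded G_obj_def]])

lemma G_map_cong:
  assumes "\<And>x. x \<in> carrier A \<Longrightarrow> h x \<in> carrier B" "\<And>x. x \<in> carrier A \<Longrightarrow> g x = h x"
    and "t \<in> carrier (G_obj n K A)"
  shows "G_map n K B g t = G_map n K B h t"
proof -
  have gc: "g x \<in> carrier B" if "x \<in> carrier A" for x using assms(1,2)[OF that] by simp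
  have unit: "G_map n K B g (free_unit n K (carrier A) x) =
      G_map n K B h (free_unit n K (carrier A) x)"
    if "x \<in> carrier A" for x
    using G_map_unit[OF gc that] G_map_unit[OF assms(1) that] assms(2)[OF that] by simp
  show ?thesis
    by (rule G_hom_unique[OF G_map_hom[OF gc] G_map_hom[OF assms(1)] lie_n_algebra_G_obj unit
        assms(3)])
qed

lemma G_map_comp:
  assumes "\<And>x. x \<in> carrier A \<Longrightarrow> h x \<in> carrier B" "\<And>x. x \<in> carrier B \<Longrightarrow> g x \<in> carrier C"
    and "t \<in> carrier (G_obj n K A)"
  shows "G_map n K C g (G_map n K B h t) = G_map n K C (\<lambda>x. g (h x)) t"
proof (rule G_hom_unique[OF lie_hom_compose[OF G_map_hom[OF assms(1)] G_map_hom[OF assms(2)]]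
      G_map_hom lie_n_algebra_G_obj _ assms(3)])
  show gh: "g (h x) \<in> carrier C" if "x \<in> carrier A" for x by (rule assms(2)[OF assms(1)[OF that]])
  fix x assume x: "x \<in> carrier A"
  show "G_map n K C g (G_map n K B h (free_unit n K (carrier A) x)) =
      G_map n K C (\<lambda>x. g (h x)) (free_unit n K (carrier A) x)"
    using G_map_unit[OF assms(1) x] G_map_unit[OF assms(2) assms(1)[OF x]] G_map_unit[OF gh x]
      by simp
qed

lemma G_map_id:
  "t \<in> carrier (G_obj n K A) \<Longrightarrow> G_map n K A (\<lambda>x. x) t = t"
  by (rule G_hom_unique[OF G_map_hom lie_hom_id lie_n_algebra_G_obj]) (auto simp: G_map_unit)

lemma G_counit_natural:
  assumes A: "lie_n_algebra n K A" and B: "lie_n_algebra n K B" and h: "h \<in> lie_hom n K A B"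
    and t: "t \<in> carrier (G_obj n K A)"
  shows "G_counit B (G_map n K B h t) = h (G_counit A t)"
proof (rule G_hom_unique[OF lie_hom_compose[OF G_map_hom G_counit_hom[OF B]]
      lie_hom_compose[OF G_counit_hom[OF A] h] B _ t])
  show hc: "h x \<in> carrier B" if "x \<in> carrier A" for x by (rule lie_hom_closed[OF h that])
  fix x assume "x \<in> carrier A"
  then show "G_counit B (G_map n K B h (free_unit n K (carrier A) x)) =
      h (G_counit A (free_unit n K (carrier A) x))"
    using hc by (simp add: G_map_unit G_counit_unit A B)
qed

end

text \<open>
  The directions of the cube are the entries of a list, the first entry belonging to the outermost
  application of the comonad. At the vertex \<open>I\<close> the applications in the directions of \<open>I\<close> are
  absent, and the edge in a direction is the counit at the corresponding place.
\<close>

primrec comonad_cube ::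
  "nat \<Rightarrow> ('k, 'r) ring_scheme \<Rightarrow> ('k, ('k, 'a) univ) nlie \<Rightarrow> nat list \<Rightarrow> nat set \<Rightarrow>
   ('k, ('k, 'a) univ) nlie" where
  "comonad_cube n K B [] I = B"
| "comonad_cube n K B (x # xs) I =
    (if x \<in> I then comonad_cube n K B xs I else G_obj n K (comonad_cube n K B xs I))"

primrec comonad_edge ::
  "nat \<Rightarrow> ('k, 'r) ring_scheme \<Rightarrow> ('k, ('k, 'a) univ) nlie \<Rightarrow> nat list \<Rightarrow> nat set \<Rightarrow> nat set \<Rightarrow>
   ('k, 'a) univ \<Rightarrow> ('k, 'a) univ" where
  "comonad_edge n K B [] I J = (\<lambda>t. t)"
| "comonad_edge n K B (x # xs) I J =
     (if x \<in> I then comonad_edge n K B xs I J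
      else if x \<in> J then (\<lambda>t. comonad_edge n K B xs I J (G_counit (comonad_cube n K B xs I) t))
      else G_map n K (comonad_cube n K B xs J) (comonad_edge n K B xs I J))"

text \<open>
  Inserting generators at the place of \<open>j\<close> gives a section of the edge from \<open>I\<close> to \<open>insert j I\<close>.
  It is linear unless this place is the outermost one that is present at \<open>I\<close>.
\<close>

primrec comonad_section ::
  "nat \<Rightarrow> ('k, 'r) ring_scheme \<Rightarrow> ('k, ('k, 'a) univ) nlie \<Rightarrow> nat list \<Rightarrow> nat set \<Rightarrow> nat \<Rightarrow>
   ('k, 'a) univ \<Rightarrow> ('k, 'a) univ" where
  "comonad_section n K B [] I j = (\<lambda>t. t)"
| "comonad_section n K B (x # xs) I j =
     (if x \<in> I then comonad_section n K B xs I j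
      else if x = j then free_unit n K (carrier (comonad_cube n K B xs I))
      else G_map n K (comonad_cube n K B xs I) (comonad_section n K B xs I j))"

lemma comonad_cube_cong: "I \<inter> set xs = J \<inter> set xs \<Longrightarrow> comonad_cube n K B xs I =
    comonad_cube n K B xs J"
proof (induction xs)
  case (Cons x xs)
  then have "I \<inter> set xs = J \<inter> set xs" "x \<in> I \<longleftrightarrow> x \<in> J" by (auto split: if_splits)
  then show ?case using Cons.IH by simp
qed simp

lemma comonad_edge_cong:
  "\<lbrakk>I \<inter> set xs = I' \<inter> set xs; J \<inter> set xs = J' \<inter> set xs\<rbrakk> \<Longrightarrow>
    comonad_edge n K B xs I J = comonad_edge n K B xs I' J'"
proof (induction xs)
  case (Cons x xs)
  then have "I \<inter> set xs = I' \<inter> set xs" "x \<in> I \<longleftrightarrow> x \<in> I'" "J \<inter> set xs = J' \<inter> set xs" "x \<in> J \<longleftrightarrow> x \<in> J'"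
    by (auto split: if_splits)
  moreover from this have "comonad_cube n K B xs I = comonad_cube n K B xs I'"
      "comonad_cube n K B xs J = comonad_cube n K B xs J'"
    by (auto intro: comonad_cube_cong)
  ultimately show ?case using Cons.IH by simp
qed simp

lemma comonad_cube_funpow: "I \<inter> set xs = {} \<Longrightarrow> comonad_cube n K B xs I = (G_obj n K ^^ length xs) B"
  by (induction xs) auto

lemma comonad_cube_append: "comonad_cube n K B (xs @ ys) I =
    comonad_cube n K (comonad_cube n K B ys I) xs I"
  by (induction xs) auto

lemma comonad_edge_snoc: "y \<in> I \<Longrightarrow> comonad_edge n K B (xs @ [y]) I J = comonad_edge n K B xs I J"
  if "I \<subseteq> J" using that by (induction xs) (auto simp: comonad_cube_append)

locale resolution = ground n K for n :: nat and K :: "('k, 'r) ring_scheme" (structure) +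
  fixes B :: "('k, ('k, 'a) univ) nlie"
  assumes base: "lie_n_algebra n K B"
begin

abbreviation cube where "cube \<equiv> comonad_cube n K B"
abbreviation edge where "edge \<equiv> comonad_edge n K B"
abbreviation edge_section where "edge_section \<equiv> comonad_section n K B"

lemma lie_n_algebra_cube: "lie_n_algebra n K (cube xs I)"
  by (induction xs) (auto simp: base lie_n_algebra_G_obj)

lemma cube_free: "\<not> set xs \<subseteq> I \<Longrightarrow> \<exists>X. cube xs I = free_nlie n K X"
  by (induction xs) (auto simp: G_obj_def)

lemma edge_hom: "I \<subseteq> J \<Longrightarrow> edge xs I J \<in> lie_hom n K (cube xs I) (cube xs J)"
proof (induction xs)
  case Nil
  show ?case by (simp add: lie_hom_id)
next
  case (Cons x xs)
  then show ?case
    using lie_hom_compose[OF G_counit_hom[OF lie_n_algebra_cube] Cons.IH]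
      lie_hom_closed[OF Cons.IH] by (auto intro: G_map_hom)
qed

lemma edge_closed:
  "\<lbrakk>I \<subseteq> J; t \<in> carrier (cube xs I)\<rbrakk> \<Longrightarrow> edge xs I J t \<in> carrier (cube xs J)"
  by (rule lie_hom_closed[OF edge_hom])

lemma edge_id: "t \<in> carrier (cube xs I) \<Longrightarrow> edge xs I I t = t"
proof (induction xs arbitrary: t)
  case (Cons x xs)
  show ?case
  proof (cases "x \<in> I")
    case False
    then have t: "t \<in> carrier (G_obj n K (cube xs I))" using Cons.prems by simp
    then have "G_map n K (cube xs I) (edge xs I I) t = t"
      using G_map_cong[of "cube xs I" "\<lambda>x. x" "cube xs I" "edge xs I I" t]
        G_map_id[OF t] Cons.IH by simp
    then show ?thesis using False by simp
  qed (use Cons in simp)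
qed simp

lemma edge_comp:
  "\<lbrakk>I \<subseteq> J; J \<subseteq> H; t \<in> carrier (cube xs I)\<rbrakk> \<Longrightarrow>
    edge xs J H (edge xs I J t) = edge xs I H t"
proof (induction xs arbitrary: t)
  case (Cons x xs)
  let ?c = "cube xs" and ?m = "edge xs"
  have cl: "?m I J s \<in> carrier (?c J)" if "s \<in> carrier (?c I)" for s
    using edge_closed Cons.prems that by blast
  have cl': "?m J H s \<in> carrier (?c H)" if "s \<in> carrier (?c J)" for s
    using edge_closed Cons.prems that by blast
  consider "x \<in> I" | "x \<notin> I" "x \<in> J" | "x \<notin> J" "x \<in> H" "x \<notin> I" | "x \<notin> H" "x \<notin> J" "x \<notin> I"
    using Cons.prems by blast
  then show ?case
  proof cases
    case 1
    then have "x \<in> J" using Cons.prems by auto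
    then show ?thesis using 1 Cons by simp
  next
    case 2
    then have "x \<in> H" using Cons.prems by auto
    have "G_counit (?c I) t \<in> carrier (?c I)"
      using Cons.prems 2 lie_hom_closed[OF G_counit_hom[OF lie_n_algebra_cube]] by simp
    then show ?thesis using 2 \<open>x \<in> H\<close> Cons by simp
  next
    case 3
    then have t: "t \<in> carrier (G_obj n K (?c I))" using Cons.prems by simp
    have "G_counit (?c J) (G_map n K (?c J) (?m I J) t) = ?m I J (G_counit (?c I) t)"
      using t Cons.prems by (intro G_counit_natural lie_n_algebra_cube edge_hom) auto
    moreover have "G_counit (?c I) t \<in> carrier (?c I)"
      using t lie_hom_closed[OF G_counit_hom[OF lie_n_algebra_cube]] by simp
    ultimately show ?thesis using 3 Cons by simp
  next
    case 4
    then have t: "t \<in> carrier (G_obj n K (?c I))" using Cons.prems by simp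
    have "G_map n K (?c H) (?m J H) (G_map n K (?c J) (?m I J) t) =
        G_map n K (?c H) (\<lambda>s. ?m J H (?m I J s)) t"
      using t cl cl' by (intro G_map_comp) auto
    also have "\<dots> = G_map n K (?c H) (?m I H) t"
      using t Cons edge_closed by (intro G_map_cong) auto
    finally show ?thesis using 4 by simp
  qed
qed simp

lemma edge_section_closed:
  "\<lbrakk>j \<in> set xs; j \<notin> I; distinct xs; t \<in> carrier (cube xs (insert j I))\<rbrakk> \<Longrightarrow>
    edge_section xs I j t \<in> carrier (cube xs I)"
proof (induction xs arbitrary: t)
  case (Cons x xs)
  show ?case
  proof (cases "x = j")
    case True
    then have "cube xs (insert j I) = cube xs I" using Cons.prems by (intro comonad_cube_cong) auto
    then show ?thesis using True Cons.prems free_unit_closed by (simp add: G_obj_def)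
  next
    case False
    then have j: "j \<in> set xs" using Cons.prems by auto
    have cl: "edge_section xs I j s \<in> carrier (cube xs I)"
      if "s \<in> carrier (cube xs (insert j I))" for s
      using Cons.IH[OF j] Cons.prems that by simp
    show ?thesis
    proof (cases "x \<in> I")
      case True
      then show ?thesis using cl Cons.prems by simp
    next
      case notin: False
      then show ?thesis using False Cons.prems(4) lie_hom_closed[OF G_map_hom[OF cl]] by simp
    qed
  qed
qed simp

lemma edge_of_section:
  "\<lbrakk>j \<in> set xs; j \<notin> I; distinct xs; t \<in> carrier (cube xs (insert j I))\<rbrakk> \<Longrightarrow>
    edge xs I (insert j I) (edge_section xs I j t) = t"
proof (induction xs arbitrary: t)
  case (Cons x xs)
  let ?c = "cube xs"
  show ?case
  proof (cases "x = j")
    case True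
    then have "?c (insert j I) = ?c I" "edge xs I (insert j I) = edge xs I I"
      using Cons.prems by (auto intro!: comonad_cube_cong comonad_edge_cong)
    then show ?thesis using True Cons.prems by (simp add: G_counit_unit lie_n_algebra_cube edge_id)
  next
    case False
    then have j: "j \<in> set xs" using Cons.prems by auto
    have cl: "edge_section xs I j s \<in> carrier (?c I)" if "s \<in> carrier (?c (insert j I))" for s
      using edge_section_closed[OF j] Cons.prems that by simp
    have IH: "edge xs I (insert j I) (edge_section xs I j s) = s"
      if "s \<in> carrier (?c (insert j I))" for s
      using Cons.IH[OF j] Cons.prems that by simp
    show ?thesis
    proof (cases "x \<in> I")
      case True
      then show ?thesis using IH Cons.prems by simp
    next
      case notin: False
      then have t: "t \<in> carrier (G_obj n K (?c (insert j I)))" using Cons.prems False by simp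
      have "G_map n K (?c (insert j I)) (edge xs I (insert j I))
          (G_map n K (?c I) (edge_section xs I j) t)
          = G_map n K (?c (insert j I)) (\<lambda>s. edge xs I (insert j I) (edge_section xs I j s)) t"
        using t cl edge_closed[of I "insert j I"] by (intro G_map_comp) auto
      also have "\<dots> = G_map n K (?c (insert j I)) (\<lambda>s. s) t"
        using t IH by (intro G_map_cong) auto
      finally show ?thesis using notin False G_map_id[OF t] by simp
    qed
  qed
qed simp

lemma later_edge_of_section:
  "\<lbrakk>j \<in> set xs; j \<notin> I; k \<notin> I; j < k; sorted_wrt (<) xs; t \<in> carrier (cube xs (insert j I))\<rbrakk> \<Longrightarrow>
    edge xs I (insert k I) (edge_section xs I j t) =
    edge_section xs (insert k I) j (edge xs (insert j I) (insert k (insert j I)) t)"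
proof (induction xs arbitrary: t)
  case (Cons x xs)
  let ?c = "cube xs" and ?m = "edge xs" and ?s = "edge_section xs"
  have dist: "distinct xs" using Cons.prems by (auto simp: strict_sorted_iff)
  show ?case
  proof (cases "x = j")
    case True
    then have nj: "j \<notin> set xs" using Cons.prems(5) by auto
    have e: "?c (insert j I) = ?c I" "?c (insert k (insert j I)) = ?c (insert k I)"
      "?m (insert j I) (insert k (insert j I)) = ?m I (insert k I)"
      using nj by (auto intro!: comonad_cube_cong comonad_edge_cong)
    have t: "t \<in> carrier (?c I)" using Cons.prems True e by simp
    have "G_map n K (?c (insert k I)) (?m I (insert k I)) (free_unit n K (carrier (?c I)) t)
        = free_unit n K (carrier (?c (insert k I))) (?m I (insert k I) t)"
      using t edge_closed[of I "insert k I"] by (intro G_map_unit) auto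
    then show ?thesis using True Cons.prems e by simp
  next
    case False
    then have j: "j \<in> set xs" using Cons.prems by auto
    have xk: "x \<noteq> k" using Cons.prems j by auto
    have cl: "?s I j s \<in> carrier (?c I)" if "s \<in> carrier (?c (insert j I))" for s
      using edge_section_closed[OF j Cons.prems(2) dist that] .
    have cl': "?s (insert k I) j s \<in> carrier (?c (insert k I))"
      if "s \<in> carrier (?c (insert j (insert k I)))" for s
      using edge_section_closed[OF j _ dist that] Cons.prems by simp
    have cm: "?m (insert j I) (insert k (insert j I)) s \<in> carrier (?c (insert k (insert j I)))"
      if "s \<in> carrier (?c (insert j I))" for s
        using edge_closed[OF _ that, of "insert k (insert j I)"] by blast
    have cm': "?m I (insert k I) s \<in> carrier (?c (insert k I))" if "s \<in> carrier (?c I)" for s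
      using edge_closed[OF _ that, of "insert k I"] by blast
    have IH: "?m I (insert k I) (?s I j s) =
        ?s (insert k I) j (?m (insert j I) (insert k (insert j I)) s)"
      if "s \<in> carrier (?c (insert j I))" for s
      using Cons.IH[OF j] Cons.prems that by simp
    show ?thesis
    proof (cases "x \<in> I")
      case True
      then show ?thesis using IH Cons.prems by simp
    next
      case notin: False
      then have t: "t \<in> carrier (G_obj n K (?c (insert j I)))" using Cons.prems False by simp
      have "G_map n K (?c (insert k I)) (?m I (insert k I)) (G_map n K (?c I) (?s I j) t)
          = G_map n K (?c (insert k I)) (\<lambda>s. ?m I (insert k I) (?s I j s)) t"
        using t cl cm' by (intro G_map_comp) auto
      also have "\<dots> = G_map n K (?c (insert k I))
          (\<lambda>s. ?s (insert k I) j (?m (insert j I) (insert k (insert j I)) s)) t"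
        using t IH cl' cm by (intro G_map_cong) (auto simp: insert_commute)
      also have "\<dots> = G_map n K (?c (insert k I)) (?s (insert k I) j)
          (G_map n K (?c (insert k (insert j I))) (?m (insert j I) (insert k (insert j I))) t)"
        using t cl' cm by (intro G_map_comp[symmetric]) (auto simp: insert_commute)
      finally show ?thesis using notin False xk by simp
    qed
  qed
qed simp

text \<open>
  The faces of the comonad resolution can be prescribed arbitrarily, subject to the evident
  compatibility. They are corrected one direction at a time, the largest first: the correction in
  a direction does not disturb the later ones. The section in the direction need not preserve zero,
  which is why its value at zero is subtracted.
\<close>

lemma fill_faces:
  assumes xs: "sorted_wrt (<) xs" and T: "finite T" "T \<subseteq> set xs" "T \<inter> I = {}"
    and y: "\<And>j. j \<in> T \<Longrightarrow> y j \<in> carrier (cube xs (insert j I))"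
    and comp: "\<And>j k. \<lbrakk>j \<in> T; k \<in> T; j < k\<rbrakk> \<Longrightarrow>
      edge xs (insert j I) (insert k (insert j I)) (y j) =
      edge xs (insert k I) (insert k (insert j I)) (y k)"
  shows "\<exists>z\<in>carrier (cube xs I). \<forall>j\<in>T. edge xs I (insert j I) z = y j"
  using T y comp
proof (induction T rule: finite_linorder_min_induct)
  case empty
  interpret A: lie_n_algebra n K "cube xs I" by (rule lie_n_algebra_cube)
  show ?case by auto
next
  case (insert b T)
  let ?c = "cube xs" and ?m = "edge xs" and ?s = "edge_section xs I b"
  interpret A: lie_n_algebra n K "?c I" by (rule lie_n_algebra_cube)
  interpret Bb: lie_n_algebra n K "?c (insert b I)" by (rule lie_n_algebra_cube)
  have "\<exists>z\<in>carrier (?c I). \<forall>j\<in>T. ?m I (insert j I) z = y j"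
  proof (rule insert.IH)
    show "?m (insert j I) (insert k (insert j I)) (y j) =
        ?m (insert k I) (insert k (insert j I)) (y k)"
      if "j \<in> T" "k \<in> T" "j < k" for j k
      using that by (intro insert.prems(4)) auto
  qed (use insert.prems in auto)
  then obtain z where z: "z \<in> carrier (?c I)" "\<And>j. j \<in> T \<Longrightarrow> ?m I (insert j I) z = y j" by auto
  have b: "b \<in> set xs" "b \<notin> I" using insert.prems by auto
  have dist: "distinct xs" using xs by (auto simp: strict_sorted_iff)
  note hom = edge_hom[of I "insert b I" xs, OF subset_insertI]
  let ?w = "y b \<ominus>\<^bsub>?c (insert b I)\<^esub> ?m I (insert b I) z"
  have mz: "?m I (insert b I) z \<in> carrier (?c (insert b I))" using lie_hom_closed[OF hom z(1)] .
  have yb: "y b \<in> carrier (?c (insert b I))" using insert.prems by auto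
  have w: "?w \<in> carrier (?c (insert b I))" using mz yb by simp
  have sc: "?s v \<in> carrier (?c I)" if "v \<in> carrier (?c (insert b I))" for v
    using edge_section_closed[OF b dist that] .
  let ?z = "z \<oplus>\<^bsub>?c I\<^esub> (?s ?w \<ominus>\<^bsub>?c I\<^esub> ?s \<zero>\<^bsub>?c (insert b I)\<^esub>)"
  have zc: "?z \<in> carrier (?c I)" using z sc w by simp
  have lin: "?m I H ?z = ?m I H z \<oplus>\<^bsub>?c H\<^esub> (?m I H (?s ?w) \<ominus>\<^bsub>?c H\<^esub> ?m I H (?s \<zero>\<^bsub>?c (insert b I)\<^esub>))"
    if "I \<subseteq> H" for H
    using z sc w linear_maps_add[OF lie_hom_linear[OF edge_hom[OF that]]]
      lie_hom_minus[OF lie_n_algebra_cube lie_n_algebra_cube edge_hom[OF that]] by simp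
  have zb: "?m I (insert b I) ?z = y b"
  proof -
    have "?m I (insert b I) ?z =
        ?m I (insert b I) z \<oplus>\<^bsub>?c (insert b I)\<^esub> (?w \<ominus>\<^bsub>?c (insert b I)\<^esub> \<zero>\<^bsub>?c (insert b I)\<^esub>)"
      using lin[of "insert b I"] edge_of_section[OF b dist w] edge_of_section[OF b dist
          Bb.M.zero_closed] by auto
    also have "\<dots> = y b" using mz yb w by (simp add: Bb.M.minus_zero)
        (simp add: a_minus_def Bb.M.a_lcomm[of _ "y b"] Bb.M.r_neg)
    finally show ?thesis .
  qed
  have zj: "?m I (insert j I) ?z = y j" if j: "j \<in> T" for j
  proof -
    interpret Bj: lie_n_algebra n K "?c (insert j I)" by (rule lie_n_algebra_cube)
    interpret Bbj: lie_n_algebra n K "?c (insert j (insert b I))" by (rule lie_n_algebra_cube)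
    have bj: "b < j" "j \<notin> I" using j insert by auto
    have later: "?m I (insert j I) (?s v) =
        edge_section xs (insert j I) b (?m (insert b I) (insert j (insert b I)) v)"
      if "v \<in> carrier (?c (insert b I))" for v
      using later_edge_of_section[OF b bj(2,1) xs that] .
    note hom2 = edge_hom[of "insert b I" "insert j (insert b I)" xs, OF subset_insertI]
    have "?m (insert b I) (insert j (insert b I)) (?m I (insert b I) z) =
        ?m (insert j I) (insert j (insert b I)) (?m I (insert j I) z)"
      using z(1) by (subst (1 2) edge_comp) auto
    also have "\<dots> = ?m (insert b I) (insert j (insert b I)) (y b)"
      using z(2)[OF j] insert.prems(4)[of b j] j bj by simp
    finally have "?m (insert b I) (insert j (insert b I)) ?w = \<zero>\<^bsub>?c (insert j (insert b I))\<^esub>"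
      using lie_hom_minus[OF lie_n_algebra_cube lie_n_algebra_cube hom2 yb mz]
        lie_hom_closed[OF hom2 yb] by (simp add: Bbj.M.minus_self)
    then have "?m I (insert j I) (?s ?w) = ?m I (insert j I) (?s \<zero>\<^bsub>?c (insert b I)\<^esub>)"
      using later[OF w] later[OF Bb.M.zero_closed]
        lie_hom_zero[OF lie_n_algebra_cube lie_n_algebra_cube hom2] by simp
    then have "?m I (insert j I) ?z = ?m I (insert j I) z"
      using lin[of "insert j I"] lie_hom_closed[OF edge_hom[OF subset_insertI]
          sc[OF Bb.M.zero_closed], of j]
        lie_hom_closed[OF edge_hom[OF subset_insertI] z(1), of j]
      by (simp add: Bj.M.minus_self subset_insertI)
    then show ?thesis using z(2)[OF j] by simp
  qed
  show ?case using zc zb zj by (intro bexI[of _ ?z]) auto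
qed

text \<open>
  A compatible family on the larger vertices is determined by its values at the vertices
  \<open>insert j I\<close>, and these values are realised by \<open>fill_faces\<close>.
\<close>

lemma cube_extension:
  assumes xs: "sorted_wrt (<) xs" "{1..m} \<subseteq> set xs"
  shows "fold_extension n K m (cube xs) (edge xs)"
proof -
  let ?c = "cube xs" and ?m = "edge xs"
  have "fold_arrow n K m ?c ?m"
    by (rule fold_arrow.intro) (auto simp: lie_n_algebra_cube edge_hom edge_id edge_comp)
  then interpret fold_arrow n K m ?c ?m .
  show ?thesis
  proof
    fix I assume I: "I \<subset> {1..m}"
    let ?T = "{J. I \<subset> J \<and> J \<subseteq> {1..m}}"
    show "(\<lambda>y. \<lambda>J\<in>?T. ?m I J y) ` carrier (?c I) = upper_limit m ?c ?m I"
    proof (intro equalityI subsetI)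
      fix x assume "x \<in> (\<lambda>y. \<lambda>J\<in>?T. ?m I J y) ` carrier (?c I)"
      then obtain y where y: "y \<in> carrier (?c I)" and x: "x = (\<lambda>J\<in>?T. ?m I J y)" by auto
      show "x \<in> upper_limit m ?c ?m I"
        unfolding upper_limit_def
      proof (intro CollectI conjI allI impI)
        show "x \<in> (\<Pi>\<^sub>E J\<in>?T. carrier (?c J))"
          unfolding x restrict_PiE_iff using y edge_closed by auto
        fix J H assume JH: "I \<subset> J \<and> J \<subseteq> H \<and> H \<subseteq> {1..m}"
        then have "I \<subset> H" "J \<subseteq> {1..m}" "I \<subseteq> J" by blast+
        then show "?m J H (x J) = x H" using JH y by (simp add: x edge_comp)
      qed
    next
      fix x assume x: "x \<in> upper_limit m ?c ?m I"
      have xc: "x J \<in> carrier (?c J)" if "I \<subset> J" "J \<subseteq> {1..m}" for J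
        using x that unfolding upper_limit_def by (auto simp: PiE_iff)
      have xe: "x \<in> extensional ?T" using x unfolding upper_limit_def by (auto simp: PiE_iff)
      have xm: "?m J H (x J) = x H" if "I \<subset> J" "J \<subseteq> H" "H \<subseteq> {1..m}" for J H
        using x that unfolding upper_limit_def by auto
      have "\<exists>z\<in>carrier (?c I). \<forall>j\<in>{1..m} - I. ?m I (insert j I) z = x (insert j I)"
      proof (rule fill_faces[OF xs(1)])
        show "{1..m} - I \<subseteq> set xs" using xs by auto
        show "x (insert j I) \<in> carrier (?c (insert j I))" if "j \<in> {1..m} - I" for j
          using that I by (intro xc) auto
        show "?m (insert j I) (insert k (insert j I)) (x (insert j I)) =
            ?m (insert k I) (insert k (insert j I)) (x (insert k I))"
          if "j \<in> {1..m} - I" "k \<in> {1..m} - I" for j k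
          using that I by (subst (1 2) xm) auto
      qed auto
      then obtain z where z: "z \<in> carrier (?c I)"
        and zj: "\<And>j. j \<in> {1..m} - I \<Longrightarrow> ?m I (insert j I) z = x (insert j I)" by auto
      have "?m I J z = x J" if J: "I \<subset> J" "J \<subseteq> {1..m}" for J
      proof -
        obtain j where j: "j \<in> J" "j \<notin> I" using J by auto
        have "?m I J z = ?m (insert j I) J (?m I (insert j I) z)"
          using j J z by (subst edge_comp) auto
        also have "?m I (insert j I) z = x (insert j I)" using j J by (intro zj) auto
        also have "?m (insert j I) J (x (insert j I)) = x J" using j J by (intro xm) auto
        finally show ?thesis .
      qed
      then have "x = (\<lambda>J\<in>?T. ?m I J z)"
        using xe by (intro extensionalityI[of _ ?T]) auto
      then show "x \<in> (\<lambda>y. \<lambda>J\<in>?T. ?m I J y) ` carrier (?c I)" using z by blast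
    qed
  qed
qed

text \<open>
  The edges out of the initial vertex are the faces of the comonad resolution: the direction \<open>x\<close>
  stands at the place where the counit is applied.
\<close>

lemma edge_face:
  assumes "x \<notin> set us" "x \<notin> set vs" "t \<in> carrier (cube (us @ x # vs) {})"
  shows "edge (us @ x # vs) {} {x} t =
    G_pow_map n K (length us) (cube vs {}) (G_counit (cube vs {})) t"
  using assms
proof (induction us arbitrary: t)
  case Nil
  have "edge vs {} {x} = edge vs {} {}" using Nil by (intro comonad_edge_cong) auto
  moreover have "G_counit (cube vs {}) t \<in> carrier (cube vs {})"
    using Nil lie_hom_closed[OF G_counit_hom[OF lie_n_algebra_cube]] by simp
  ultimately show ?case by (simp add: edge_id)
next
  case (Cons u us)
  have eq: "cube (us @ x # vs) {x} = (G_obj n K ^^ length us) (cube vs {})"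
  proof -
    have "cube (x # vs) {x} = cube vs {}" using Cons.prems by (auto intro!: comonad_cube_cong)
    then show ?thesis using Cons.prems by (simp add: comonad_cube_append comonad_cube_funpow)
  qed
  have "G_map n K (cube (us @ x # vs) {x}) (edge (us @ x # vs) {} {x}) t =
      G_map n K (cube (us @ x # vs) {x})
        (G_pow_map n K (length us) (cube vs {}) (G_counit (cube vs {}))) t"
  proof (rule G_map_cong[symmetric])
    show "t \<in> carrier (G_obj n K (cube (us @ x # vs) {}))" using Cons.prems by simp
    show "edge (us @ x # vs) {} {x} s \<in> carrier (cube (us @ x # vs) {x})"
      if "s \<in> carrier (cube (us @ x # vs) {})" for s
      by (rule edge_closed[OF _ that]) simp
  qed (use Cons in simp)
  then show ?case using Cons.prems eq by simp
qed

end

section \<open>Splitting cubes of projective objects\<close>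

lemma (in module) alt_sum_mod:
  assumes B: "submodule B R M" and js: "set js \<subseteq> S"
    and u: "\<And>I. I \<subseteq> S \<Longrightarrow> u I \<in> carrier M" "\<And>I. \<lbrakk>I \<subseteq> S; I \<noteq> {}\<rbrakk> \<Longrightarrow> u I \<in> B"
  shows "alt_sum M js u \<ominus>\<^bsub>M\<^esub> u {} \<in> B"
  using js
proof (induction js)
  case Nil
  show ?case using submodule_zero[OF B] u(1)[of "{}"] by (simp add: M.minus_self)
next
  case (Cons j js)
  let ?a = "alt_sum M js u" and ?b = "alt_sum M js (\<lambda>I. u (insert j I))"
  have b: "?b \<in> B" using Cons.prems u(2) by (intro alt_sum_submodule[OF B, of _ S]) auto
  have cl: "?a \<in> carrier M" "?b \<in> carrier M" "u {} \<in> carrier M"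
    using Cons.prems u(1) b submoduleE(1)[OF B] by (auto intro!: alt_sum_closed[of _ S])
  have "(?a \<ominus>\<^bsub>M\<^esub> ?b) \<ominus>\<^bsub>M\<^esub> u {} = (?a \<ominus>\<^bsub>M\<^esub> u {}) \<ominus>\<^bsub>M\<^esub> ?b"
    using cl by (simp add: a_minus_def M.a_ac)
  then show ?case using submodule_minus[OF B _ b, of "?a \<ominus>\<^bsub>M\<^esub> u {}"] Cons by simp
qed

lemma kernel_meet_map:
  assumes "fold_arrow n K m f \<phi>" "fold_arrow n K m f' \<phi>'" "cube_map n K m f \<phi> f' \<phi>' g"
    and I: "I \<subseteq> {1..m}" and x: "x \<in> kernel_meet f \<phi> I"
  shows "g {} x \<in> kernel_meet f' \<phi>' I"
proof -
  interpret s: fold_arrow n K m f \<phi> by fact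
  interpret t: fold_arrow n K m f' \<phi>' by fact
  note g = cube_mapD[OF assms(3)]
  have xc: "x \<in> carrier (f {})" using x by (simp add: mem_kernel_meet)
  have "\<phi>' {} {i} (g {} x) = \<zero>\<^bsub>f' {i}\<^esub>" if i: "i \<in> I" for i
  proof -
    have i': "{i} \<subseteq> {1..m}" using i I by auto
    have "\<phi>' {} {i} (g {} x) = g {i} (\<phi> {} {i} x)" using g(2)[OF _ i' xc] by simp
    also have "\<phi> {} {i} x = \<zero>\<^bsub>f {i}\<^esub>" using x i by (simp add: mem_kernel_meet)
    also have "g {i} \<zero>\<^bsub>f {i}\<^esub> = \<zero>\<^bsub>f' {i}\<^esub>"
      by (rule lie_hom_zero[OF s.arrow_obj[OF i'] t.arrow_obj[OF i'] g(1)[OF i']])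
    finally show ?thesis .
  qed
  then show ?thesis using lie_hom_closed[OF g(1) xc] by (simp add: mem_kernel_meet)
qed

lemma hopf_denominator_map:
  assumes f: "fold_arrow n K m f \<phi>" and f': "fold_arrow n K m f' \<phi>'"
    and g: "cube_map n K m f \<phi> f' \<phi>' g" and x: "x \<in> hopf_denominator n K m f \<phi>"
  shows "g {} x \<in> hopf_denominator n K m f' \<phi>'"
proof -
  interpret s: fold_arrow n K m f \<phi> by fact
  interpret t: fold_arrow n K m f' \<phi>' by fact
  interpret P: lie_n_algebra n K "f {}" by (rule s.base_algebra)
  have hom: "g {} \<in> lie_hom n K (f {}) (f' {})" using cube_mapD(1)[OF g] by simp
  have "hopf_denominator n K m f \<phi> \<subseteq> {x \<in> carrier (f {}). g {} x \<in> hopf_denominator n K m f' \<phi>'}"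
  proof (rule s.hopf_denominator_least)
    show "lie_ideal n K (f {}) {x \<in> carrier (f {}). g {} x \<in> hopf_denominator n K m f' \<phi>'}"
      by (rule lie_ideal_vimage[OF s.base_algebra t.base_algebra hom t.lie_ideal_hopf_denominator])
    fix ls T
    assume ls: "length ls = n" "\<And>j. j < n \<Longrightarrow> ls ! j \<in> kernel_meet f \<phi> (T j)"
      and T: "\<And>j. j < n \<Longrightarrow> T j \<subseteq> {1..m}" "(\<Union>j<n. T j) = {1..m}"
    have lt: "ls \<in> tuples n (carrier (f {}))" using ls
      by (auto simp: tuples_iff_nth mem_kernel_meet)
    have "bracket (f' {}) (map (g {}) ls) \<in> hopf_denominator n K m f' \<phi>'"
    proof (rule t.bracket_hopf_denominator)
      show "map (g {}) ls ! j \<in> kernel_meet f' \<phi>' (T j)" if "j < n" for j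
        using kernel_meet_map[OF f f' g T(1)[OF that] ls(2)[OF that]] ls(1) that
          by (simp add: nth_map)
      show "length (map (g {}) ls) = n" using ls(1) by simp
      show "(\<Union>j<n. T j) = {1..m}" by (rule T(2))
    qed
    then show "bracket (f {}) ls \<in> {x \<in> carrier (f {}). g {} x \<in> hopf_denominator n K m f' \<phi>'}"
      using lie_hom_bracket[OF hom lt] P.bracket_closed[OF lt] by simp
  qed
  then show ?thesis using x by auto
qed

context ground
begin

lemma retract_of_free_self: "retract_of_free n K X (free_nlie n K X)"
  unfolding retract_of_free_def by (rule bexI[OF _ lie_hom_id], rule bexI[OF _ lie_hom_id]) simp

text \<open>
  If all objects of an extension are retracts of free algebras, the extension splits compatibly
  with brackets, and the alternating sum over the splitting projects onto the intersection of the
  kernels.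
\<close>

lemma split_projection:
  assumes e: "fold_extension n K m e \<psi>"
    and retr: "\<And>J. J \<subseteq> {1..m} \<Longrightarrow> retract_of_free n K (X J) (e J)"
  obtains p where "p \<in> linear_maps K (e {}) (e {})"
    and "\<And>x. x \<in> carrier (e {}) \<Longrightarrow> p x \<in> kernel_meet e \<psi> {1..m}"
    and "\<And>x. x \<in> derived_ideal n K (e {}) \<Longrightarrow> p x \<in> hopf_denominator n K m e \<psi>"
    and "\<And>x. x \<in> kernel_meet e \<psi> {1..m} \<Longrightarrow> p x = x"
    and "\<And>x. \<lbrakk>x \<in> carrier (e {}); \<And>j. j \<in> {1..m} \<Longrightarrow> \<psi> {} {j} x \<in> derived_ideal n K (e {j})\<rbrakk> \<Longrightarrow>
      p x \<ominus>\<^bsub>e {}\<^esub> x \<in> derived_ideal n K (e {})"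
proof -
  interpret ext: fold_extension n K m e \<psi> by (rule e)
  interpret c: cubes n K m e \<psi> e \<psi> by unfold_locales
  interpret Q: lie_n_algebra n K "e {}" by (rule ext.base_algebra)
  let ?U = "{(I, J). I \<subseteq> J \<and> J \<subseteq> {1..m}}" and ?D = "{(I, I) |I. I \<subseteq> {1..m}}"
  have "\<exists>s. c.system ?U s \<and> (\<forall>(I, J)\<in>?D. s I J = (\<lambda>I J x. x) I J)"
  proof (rule c.extend_system)
    show "upclosed_pairs m ?U" "upclosed_pairs m ?D" by (auto simp: upclosed_pairs_def)
    show "c.system ?D (\<lambda>I J x. x)"
      unfolding c.system_def by (auto simp: lie_hom_id sup.absorb2)
    show "retract_of_free n K (X J) (e J)" if "(I, J) \<in> ?U - ?D" for I J using that
      by (intro retr) auto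
  qed auto
  then obtain s where s: "c.system ?U s" and id: "s {} {} = (\<lambda>x. x)" by auto
  define js where "js = sorted_list_of_set {1..m}"
  have js: "set js = {1..m}" by (simp add: js_def)
  let ?p = "c.projection s js" and ?t = "\<lambda>x I. s {} I (\<psi> {} I x)"
  have tc: "?t x I \<in> carrier (e {})" if "I \<subseteq> {1..m}" "x \<in> carrier (e {})" for x I
    by (rule lie_hom_closed[OF c.system_term_hom[OF s js that(1)] that(2)])
  have shom: "s {} I \<in> lie_hom n K (e I) (e {})" if "I \<subseteq> {1..m}" for I
    using c.systemD(1)[OF s, of "{}" I] that by simp
  have t0: "?t x {} = x" if "x \<in> carrier (e {})" for x using ext.arrow_id[of "{}" x] that id by simp
  show thesis
  proof (rule that[OF c.projection_linear[OF s js] c.projection_kernel[OF s js]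
      c.projection_derived[OF s js]])
    fix x assume x: "x \<in> kernel_meet e \<psi> {1..m}"
    then have xc: "x \<in> carrier (e {})" by (simp add: mem_kernel_meet)
    have "?t x I = \<zero>\<^bsub>e {}\<^esub>" if "I \<subseteq> {1..m}" "I \<noteq> {}" for I
      using ext.kernel_meet_vanish[OF x that] lie_hom_zero[OF ext.arrow_obj[OF that(1)]
          ext.base_algebra shom[OF that(1)]]
      by simp
    then have "?p x = ?t x {}" unfolding c.projection_def using js tc[of "{}" x] xc
      by (intro Q.alt_sum_only_empty[of _ "{1..m}"]) auto
    then show "?p x = x" using t0[OF xc] by simp
  next
    fix x assume x: "x \<in> carrier (e {})"
      and xj: "\<And>j. j \<in> {1..m} \<Longrightarrow> \<psi> {} {j} x \<in> derived_ideal n K (e {j})"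
    have "?p x \<ominus>\<^bsub>e {}\<^esub> ?t x {} \<in> derived_ideal n K (e {})"
      unfolding c.projection_def
    proof (rule Q.alt_sum_mod[OF Q.derived_submodule, of _ "{1..m}"])
      fix I assume I: "I \<subseteq> {1..m}" "I \<noteq> {}"
      then obtain j where j: "j \<in> I" by auto
      have "\<psi> {} I x = \<psi> {j} I (\<psi> {} {j} x)" using I j x by (intro ext.arrow_comp[symmetric]) auto
      also have "\<dots> \<in> derived_ideal n K (e I)"
        using I j by (intro derived_ideal_map[OF ext.arrow_obj ext.arrow_obj ext.arrow_map] xj) auto
      finally show "?t x I \<in> derived_ideal n K (e {})"
        using I by (intro derived_ideal_map[OF ext.arrow_obj ext.arrow_obj shom]) auto
    qed (use js tc x in auto)
    then show "?p x \<ominus>\<^bsub>e {}\<^esub> x \<in> derived_ideal n K (e {})" using t0[OF x] by simp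
  qed
qed

end

section \<open>Faces of the comonad resolution as edges of cubes\<close>

text \<open>The lists of directions are kept in closed form.\<close>

declare upt_Suc [simp del]

lemma comonad_cube_filter: "comonad_cube n K A xs I =
    (G_obj n K ^^ length (filter (\<lambda>x. x \<notin> I) xs)) A"
  by (induction xs) auto

context resolution
begin

abbreviation res where "res k \<equiv> cube [Suc 0..<Suc k]"
abbreviation res_map where "res_map k \<equiv> edge [Suc 0..<Suc k]"
abbreviation derived where "derived k \<equiv> derived_ideal n K (res k {})"

lemma res_algebra: "lie_n_algebra n K (res k I)"
  by (rule lie_n_algebra_cube)

lemma res_empty: "res k {} = (G_obj n K ^^ k) B"
  by (simp add: comonad_cube_funpow)

lemma res_single: "j \<in> {1..Suc k} \<Longrightarrow> res (Suc k) {j} = res k {}"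
proof -
  assume j: "j \<in> {1..Suc k}"
  have "length (filter (\<lambda>x. x \<notin> {j}) [Suc 0..<Suc (Suc k)]) = card ({1..Suc k} - {j})"
    by (subst distinct_card[symmetric]) (auto intro!: arg_cong[of _ _ card])
  then show ?thesis using j unfolding res_empty by (simp add: comonad_cube_filter)
qed

text \<open>
  Among the directions \<open>1, \<dots>, k + 1\<close> of the resolution cube, the last one belongs to the
  innermost application of the comonad. The facet at \<open>k + 1\<close> is the resolution cube with \<open>k\<close>
  directions, and the edges in this direction form a map of cubes that ends there. The opposite
  facet has free vertices only.
\<close>

lemma res_facet: "I \<subseteq> {1..k} \<Longrightarrow> res (Suc k) (insert (Suc k) I) = res k I"
proof -
  have "res (Suc k) (insert (Suc k) I) = cube [Suc 0..<Suc k] (insert (Suc k) I)"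
    by (simp add: comonad_cube_append upt_Suc)
  also have "\<dots> = res k I" by (rule comonad_cube_cong) auto
  finally show ?thesis .
qed

lemma res_map_facet: "\<lbrakk>I \<subseteq> J\<rbrakk> \<Longrightarrow> res_map (Suc k) (insert (Suc k) I) (insert (Suc k) J) =
    res_map k I J"
proof -
  assume "I \<subseteq> J"
  have snoc: "[Suc 0..<Suc (Suc k)] = [Suc 0..<Suc k] @ [Suc k]" by (simp add: upt_Suc)
  have "res_map (Suc k) (insert (Suc k) I) (insert (Suc k) J) =
      edge [Suc 0..<Suc k] (insert (Suc k) I) (insert (Suc k) J)"
    unfolding snoc by (rule comonad_edge_snoc) (use \<open>I \<subseteq> J\<close> in auto)
  also have "\<dots> = res_map k I J" by (rule comonad_edge_cong) auto
  finally show ?thesis .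
qed

lemma res_extension: "l \<le> k \<Longrightarrow> fold_extension n K l (res k) (res_map k)"
  by (rule cube_extension[OF sorted_wrt_upt]) auto

lemma res_arrow: "l \<le> k \<Longrightarrow> fold_arrow n K l (res k) (res_map k)"
  using res_extension by (simp add: fold_extension_def)

definition res_generators :: "nat \<Rightarrow> nat set \<Rightarrow> ('k, 'a) univ set" where
  "res_generators k J = (SOME X. res k J = free_nlie n K X)"

lemma res_retract:
  assumes "\<not> {1..k} \<subseteq> J" shows "retract_of_free n K (res_generators k J) (res k J)"
proof -
  have "\<not> set [Suc 0..<Suc k] \<subseteq> J" using assms by (simp add: atLeastLessThanSuc_atLeastAtMost)
  then have "res k J = free_nlie n K (res_generators k J)"
    unfolding res_generators_def by (rule someI_ex[OF cube_free])
  then show ?thesis using retract_of_free_self by (rule ssubst)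
qed

lemma face_hom: "j \<in> {1..Suc k} \<Longrightarrow> res_map (Suc k) {} {j} \<in> lie_hom n K (res (Suc k) {}) (res k {})"
  using edge_hom[of "{}" "{j}" "[Suc 0..<Suc (Suc k)]"] res_single[of j k] by simp

lemma last_face_cube_map:
  "cube_map n K k (res (Suc k)) (res_map (Suc k)) (res k) (res_map k) (\<lambda>I.
    res_map (Suc k) I (insert (Suc k) I))"
  unfolding cube_map_def
proof (intro conjI allI impI ballI)
  fix I assume "I \<subseteq> {1..k}"
  then show "res_map (Suc k) I (insert (Suc k) I) \<in> lie_hom n K (res (Suc k) I) (res k I)"
    using edge_hom[of I "insert (Suc k) I" "[Suc 0..<Suc (Suc k)]"] res_facet
      by (simp add: subset_insertI)
next
  fix I J x assume IJ: "I \<subseteq> J \<and> J \<subseteq> {1..k}" and x: "x \<in> carrier (res (Suc k) I)"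
  have "res_map k I J (res_map (Suc k) I (insert (Suc k) I) x) =
      res_map (Suc k) I (insert (Suc k) J) x"
    unfolding res_map_facet[OF conjunct1[OF IJ], symmetric] using IJ x by (intro edge_comp) auto
  also have "\<dots> = res_map (Suc k) J (insert (Suc k) J) (res_map (Suc k) I J x)"
    using IJ x by (intro edge_comp[symmetric]) auto
  finally show "res_map k I J (res_map (Suc k) I (insert (Suc k) I) x) =
      res_map (Suc k) J (insert (Suc k) J) (res_map (Suc k) I J x)" .
qed

lemma last_face_commute:
  assumes "j \<in> {1..k}" "x \<in> carrier (res (Suc k) {})"
  shows "res_map k {} {j} (res_map (Suc k) {} {Suc k} x) = res_map (Suc k) {j} {j,
      Suc k} (res_map (Suc k) {} {j} x)"
  using cube_mapD(2)[OF last_face_cube_map, of "{}" "{j}" k x] assms by (simp add: insert_commute)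

lemma last_face_kernel:
  assumes "j \<in> {1..k}" "x \<in> carrier (res (Suc k) {})" "res_map (Suc k) {} {j} x = \<zero>\<^bsub>res (Suc k) {j}\<^esub>"
  shows "res_map k {} {j} (res_map (Suc k) {} {Suc k} x) = \<zero>\<^bsub>res k {j}\<^esub>"
proof -
  have "res_map (Suc k) {j} {j, Suc k} \<zero>\<^bsub>res (Suc k) {j}\<^esub> = \<zero>\<^bsub>res (Suc k) {j, Suc k}\<^esub>"
    by (rule lie_hom_zero[OF res_algebra res_algebra edge_hom]) auto
  then show ?thesis using last_face_commute[OF assms(1,2)] assms res_facet[of "{j}" k]
    by (simp add: insert_commute)
qed

text \<open>
  The case of \<open>fill_faces\<close> in which only the last of the prescribed faces is nonzero.
\<close>

lemma lift_last_face:
  assumes d: "d \<in> carrier (res k {})" and T: "T \<subseteq> {1..k}"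
    and dT: "\<And>j. j \<in> T \<Longrightarrow> res_map k {} {j} d = \<zero>\<^bsub>res k {j}\<^esub>"
  shows "\<exists>z\<in>carrier (res (Suc k) {}). res_map (Suc k) {} {Suc k} z = d \<and>
    (\<forall>j\<in>T. res_map (Suc k) {} {j} z = \<zero>\<^bsub>res (Suc k) {j}\<^esub>)"
proof -
  let ?y = "\<lambda>j. if j = Suc k then d else \<zero>\<^bsub>res (Suc k) {j}\<^esub>"
  have zero: "res_map (Suc k) {i} {j, i} \<zero>\<^bsub>res (Suc k) {i}\<^esub> = \<zero>\<^bsub>res (Suc k) {j, i}\<^esub>" for i j
    by (rule lie_hom_zero[OF res_algebra res_algebra edge_hom]) auto
  have zc: "\<zero>\<^bsub>res (Suc k) {j}\<^esub> \<in> carrier (res (Suc k) {j})" for j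
    using lie_n_algebra_module[OF res_algebra]
      by (rule abelian_group.axioms(1)[OF module.axioms(2), THEN abelian_monoid.zero_closed])
  have "\<exists>z\<in>carrier (res (Suc k) {}). \<forall>j\<in>insert (Suc k) T. res_map (Suc k) {} (insert j {}) z = ?y j"
  proof (rule fill_faces)
    show "sorted_wrt (<) [Suc 0..<Suc (Suc k)]" by (rule sorted_wrt_upt)
    show "insert (Suc k) T \<subseteq> set [Suc 0..<Suc (Suc k)]" using T by auto
    show "finite (insert (Suc k) T)" using T by (auto intro: finite_subset)
    show "?y j \<in> carrier (res (Suc k) {j})" if "j \<in> insert (Suc k) T" for j
      using d zc res_single[of "Suc k" k] by auto
    show "res_map (Suc k) {i} {j, i} (?y i) = res_map (Suc k) {j} {j, i} (?y j)"
      if i: "i \<in> insert (Suc k) T" and j: "j \<in> insert (Suc k) T" and ij: "i < j" for i j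
    proof -
      have iT: "i \<in> T" "i \<noteq> Suc k" using i j ij T by auto
      show ?thesis
      proof (cases "j = Suc k")
        case True
        have "res_map (Suc k) {Suc k} {Suc k, i} d = res_map k {} {i} d"
          using res_map_facet[of "{}" "{i}" k] by simp
        then show ?thesis using True iT dT[OF iT(1)] zero[of i "Suc k"] res_facet[of "{i}" k] T
          by auto
      next
        case False
        then show ?thesis using iT zero[of i j] zero[of j i] by (simp add: insert_commute)
      qed
    qed
  qed auto
  then obtain z where z: "z \<in> carrier (res (Suc k) {})"
    and zy: "\<forall>j\<in>insert (Suc k) T. res_map (Suc k) {} (insert j {}) z = ?y j" by (elim bexE)
  have "Suc k \<notin> T" using T by auto
  then show ?thesis using z zy by (intro bexI[OF _ z]) auto
qed

end

section \<open>Homology of the abelianised resolution\<close>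

lemma (in module) coset_eq_self_iff:
  assumes "submodule B R M" "x \<in> carrier M"
  shows "B +>\<^bsub>M\<^esub> x = B \<longleftrightarrow> x \<in> B"
proof -
  interpret B: abelian_subgroup B M by (rule submodule_abelian_subgroup[OF assms(1)])
  show ?thesis using B.a_rcos_const B.a_rcos_self[OF assms(2)] by auto
qed

lemma ab_map_coset:
  assumes A: "lie_n_algebra n K A" and B: "lie_n_algebra n K B" and h: "h \<in> lie_hom n K A B"
    and eq: "\<And>y. y \<in> carrier A \<Longrightarrow> g y = h y" and x: "x \<in> carrier A"
  shows "ab_map n K A B g (derived_ideal n K A +>\<^bsub>A\<^esub> x) = derived_ideal n K B +>\<^bsub>B\<^esub> h x"
proof -
  interpret A: lie_n_algebra n K A by (rule A)
  interpret B: lie_n_algebra n K B by (rule B)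
  show ?thesis unfolding ab_map_def
  proof (rule A.coset_cong_Union[OF A.derived_submodule x])
    fix y assume "y \<in> derived_ideal n K A +>\<^bsub>A\<^esub> x"
    then have y: "y \<in> carrier A" and d: "y \<ominus>\<^bsub>A\<^esub> x \<in> derived_ideal n K A"
      using A.mem_coset_iff[OF A.derived_submodule x] by auto
    have "h y \<ominus>\<^bsub>B\<^esub> h x \<in> derived_ideal n K B"
      using derived_ideal_map[OF A B h d] lie_hom_minus[OF A B h y x] by simp
    then show "derived_ideal n K B +>\<^bsub>B\<^esub> g y = derived_ideal n K B +>\<^bsub>B\<^esub> h x"
      using eq[OF y] B.coset_eq_iff[OF B.derived_submodule] lie_hom_closed[OF h] x y by simp
  qed
qed

context resolution
begin

abbreviation ab_res where
  "ab_res \<equiv> map_simplicial (ab_obj n K) (ab_map n K) (comonad_resolution n K B)"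

abbreviation ab_class where "ab_class k x \<equiv> derived k +>\<^bsub>res k {}\<^esub> x"

lemma sobj_res: "sobj ab_res k = ab_obj n K (res (Suc k) {})"
  unfolding res_empty by (simp add: map_simplicial_def comonad_resolution_def)

lemma carrier_sobj_res: "carrier (sobj ab_res k) = ab_class (Suc k) ` carrier (res (Suc k) {})"
  by (simp add: sobj_res ab_obj_def carrier_quotient_module)

lemma zero_sobj_res: "\<zero>\<^bsub>sobj ab_res k\<^esub> = derived (Suc k)"
  by (simp add: sobj_res ab_obj_def quotient_module_def)

lemma sface_res:
  assumes i: "i \<le> Suc k" and x: "x \<in> carrier (res (Suc (Suc k)) {})"
  shows "sface ab_res (Suc k) i (ab_class (Suc (Suc k)) x) =
    ab_class (Suc k) (res_map (Suc (Suc k)) {} {Suc i} x)"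
proof -
  let ?g = "G_pow_map n K i ((G_obj n K ^^ (Suc k - i)) B)
      (G_counit ((G_obj n K ^^ (Suc k - i)) B))"
  have face: "sface ab_res (Suc k) i =
      ab_map n K (res (Suc (Suc k)) {}) (res (Suc k) {}) ?g"
    unfolding res_empty by (simp add: map_simplicial_def comonad_resolution_def Let_def)
  show ?thesis unfolding face
  proof (rule ab_map_coset[OF res_algebra res_algebra _ _ x])
    show "res_map (Suc (Suc k)) {} {Suc i} \<in> lie_hom n K (res (Suc (Suc k)) {}) (res (Suc k) {})"
      using i by (intro face_hom) auto
    fix y assume y: "y \<in> carrier (res (Suc (Suc k)) {})"
    have split: "[Suc 0..<Suc (Suc (Suc k))] =
        [Suc 0..<Suc i] @ Suc i # [Suc (Suc i)..<Suc (Suc (Suc k))]"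
    proof -
      have "[Suc 0..<Suc (Suc (Suc k))] = [Suc 0..<Suc i] @ [Suc i..<Suc (Suc (Suc k))]"
        using upt_add_eq_append[of "Suc 0" "Suc i" "Suc (Suc k) - i"] i by simp
      then show ?thesis using i by (simp add: upt_conv_Cons)
    qed
    show "?g y = res_map (Suc (Suc k)) {} {Suc i} y"
      using edge_face[of "Suc i" "[Suc 0..<Suc i]" "[Suc (Suc i)..<Suc (Suc (Suc k))]" y] y i
      unfolding split[symmetric] by (simp add: comonad_cube_funpow Suc_diff_le)
  qed
qed

text \<open>
  Membership in the derived ideal means that the class in the abelianised resolution has vanishing
  faces in the directions of \<open>T\<close>.
\<close>

definition relative_cycles :: "nat \<Rightarrow> nat set \<Rightarrow> ('k, 'a) univ set" where
  "relative_cycles k T =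
     {x \<in> carrier (res (Suc k) {}). \<forall>j\<in>T. res_map (Suc k) {} {j} x \<in> derived k}"

lemma moore_res:
  "moore ab_res (Suc k) = ab_class (Suc (Suc k)) ` relative_cycles (Suc k) {1..Suc k}"
proof -
  let ?q = "ab_class (Suc (Suc k))"
  interpret C: lie_n_algebra n K "res (Suc k) {}" by (rule res_algebra)
  have "?q x \<in> moore ab_res (Suc k) \<longleftrightarrow> x \<in> relative_cycles (Suc k) {1..Suc k}"
    if x: "x \<in> carrier (res (Suc (Suc k)) {})" for x
  proof -
    have "?q x \<in> moore ab_res (Suc k) \<longleftrightarrow> (\<forall>i<Suc k. sface ab_res (Suc k) i (?q x) = derived (Suc k))"
      using x by (auto simp: moore_def carrier_sobj_res mem_a_kernel zero_sobj_res)
    also have "\<dots> \<longleftrightarrow> (\<forall>i<Suc k. res_map (Suc (Suc k)) {} {Suc i} x \<in> derived (Suc k))"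
      using x lie_hom_closed[OF face_hom x]
      by (auto simp: sface_res C.coset_eq_self_iff[OF C.derived_submodule])
    also have "\<dots> \<longleftrightarrow> (\<forall>j\<in>{1..Suc k}. res_map (Suc (Suc k)) {} {j} x \<in> derived (Suc k))"
      by (auto simp: Ball_def less_Suc_eq_le) (metis Suc_le_D Suc_le_mono le_imp_less_Suc)
    finally show ?thesis using x by (simp add: relative_cycles_def)
  qed
  moreover have "moore ab_res (Suc k) \<subseteq> ?q ` carrier (res (Suc (Suc k)) {})"
    by (auto simp: moore_def carrier_sobj_res)
  ultimately show ?thesis by (auto simp: relative_cycles_def)
qed

lemma cycles_res:
  "{X \<in> moore ab_res (Suc k). sface ab_res (Suc k) (Suc k) X = \<zero>\<^bsub>sobj ab_res k\<^esub>} =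
    ab_class (Suc (Suc k)) ` relative_cycles (Suc k) {1..Suc (Suc k)}"
proof -
  interpret C: lie_n_algebra n K "res (Suc k) {}" by (rule res_algebra)
  have "sface ab_res (Suc k) (Suc k) (ab_class (Suc (Suc k)) x) = \<zero>\<^bsub>sobj ab_res k\<^esub> \<longleftrightarrow>
      res_map (Suc (Suc k)) {} {Suc (Suc k)} x \<in> derived (Suc k)"
    if x: "x \<in> carrier (res (Suc (Suc k)) {})" for x
    using x lie_hom_closed[OF face_hom x]
    by (simp add: sface_res zero_sobj_res C.coset_eq_self_iff[OF C.derived_submodule])
  moreover have "{1..Suc (Suc k)} = insert (Suc (Suc k)) {1..Suc k}" by auto
  ultimately show ?thesis
    unfolding moore_res by (auto simp: relative_cycles_def)
qed

lemma boundaries_res: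
  "sface ab_res (Suc k) (Suc k) ` moore ab_res (Suc k) =
    (\<lambda>y. ab_class (Suc k) (res_map (Suc (Suc k)) {} {Suc (Suc k)} y)) ` relative_cycles (Suc k)
      {1..Suc k}"
  unfolding moore_res image_image
  by (rule image_cong[OF refl]) (simp add: relative_cycles_def sface_res)

lemma moore_homology_res:
  "moore_homology ab_res (Suc k) = subquotient (ab_obj n K (res (Suc (Suc k)) {}))
    (ab_class (Suc (Suc k)) ` relative_cycles (Suc k) {1..Suc (Suc k)})
    ((\<lambda>y. ab_class (Suc (Suc k)) (res_map (Suc (Suc (Suc k))) {} {Suc (Suc (Suc k))} y))
      ` relative_cycles (Suc (Suc k)) {1..Suc (Suc k)})"
  unfolding moore_homology_def cycles_res[symmetric] boundaries_res[symmetric] sobj_res[symmetric]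
  by simp

end

section \<open>The Hopf formula\<close>

lemma cube_map_compose:
  assumes f: "fold_arrow n K m f \<phi>"
    and g: "cube_map n K m f \<phi> f' \<phi>' g" and h: "cube_map n K m f' \<phi>' f'' \<phi>'' h"
  shows "cube_map n K m f \<phi> f'' \<phi>'' (\<lambda>I x. h I (g I x))"
  unfolding cube_map_def
proof (intro conjI allI impI ballI)
  show "(\<lambda>x. h I (g I x)) \<in> lie_hom n K (f I) (f'' I)" if "I \<subseteq> {1..m}" for I
    by (rule lie_hom_compose[OF cube_mapD(1)[OF g that] cube_mapD(1)[OF h that]])
  fix I J x assume IJ: "I \<subseteq> J \<and> J \<subseteq> {1..m}" and x: "x \<in> carrier (f I)"
  then have I: "I \<subseteq> {1..m}" by auto
  show "\<phi>'' I J (h I (g I x)) = h J (g J (\<phi> I J x))"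
    using cube_mapD(2)[OF h _ _ lie_hom_closed[OF cube_mapD(1)[OF g I] x]] cube_mapD(2)[OF g _ _
        x] IJ
    by simp
qed

lemma cube_map_id: "cube_map n K m f \<phi> f \<phi> (\<lambda>I x. x)"
  by (simp add: cube_map_def lie_hom_id)

lemma (in cubes) cube_map_from_top:
  assumes t: "t \<in> lie_hom n K (f {1..m}) (f' {1..m})"
    and retr: "\<And>J. J \<subset> {1..m} \<Longrightarrow> retract_of_free n K (X J) (f J)"
  shows "\<exists>g. cube_map n K m f \<phi> f' \<phi>' g \<and> g {1..m} = t"
proof -
  have "\<exists>g. cube_map n K m f \<phi> f' \<phi>' g \<and> (\<forall>I. I \<in> {{1..m}} \<and> I \<subseteq> {1..m} \<longrightarrow> g I = (\<lambda>I. t) I)"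
  proof (rule cube_map_extend)
    show "J \<in> {{1..m}}" if "I \<in> {{1..m}}" "I \<subseteq> J" "J \<subseteq> {1..m}" for I J using that by auto
    show "t \<in> lie_hom n K (f I) (f' I)" if "I \<in> {{1..m}}" for I using that t by auto
    show "\<phi>' I J (t x) = t (\<phi> I J x)"
      if "I \<in> {{1..m}}" "I \<subseteq> J" "J \<subseteq> {1..m}" and x: "x \<in> carrier (f I)" for I J x
    proof -
      have I: "I = {1..m}" "J = {1..m}" using that by auto
      show ?thesis using x lie_hom_closed[OF t, of x] unfolding I
        by (simp only: src.arrow_id[OF subset_refl] tgt.arrow_id[OF subset_refl])
    qed
    show "retract_of_free n K (X I) (f I)" if "I \<subseteq> {1..m}" "I \<notin> {{1..m}}" for I
      using that by (intro retr) auto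
  qed simp
  then show ?thesis by auto
qed

context resolution
begin

abbreviation kernels where "kernels m \<equiv> kernel_meet (res m) (res_map m)"
abbreviation last_face where "last_face m \<equiv> res_map (Suc m) {} {Suc m}"
abbreviation denominator where "denominator m \<equiv> hopf_denominator n K m (res m) (res_map m)"

lemma last_face_hom: "last_face m \<in> lie_hom n K (res (Suc m) {}) (res m {})"
  by (rule face_hom) simp

lemma relative_split:
  obtains p where "p \<in> linear_maps K (res (Suc m) {}) (res (Suc m) {})"
    and "\<And>x. x \<in> carrier (res (Suc m) {}) \<Longrightarrow> p x \<in> kernels (Suc m) {1..m}"
    and "\<And>x. x \<in> derived (Suc m) \<Longrightarrow> p x \<in> hopf_denominator n K m (res (Suc m)) (res_map (Suc m))"
    and "\<And>x. x \<in> kernels (Suc m) {1..m} \<Longrightarrow> p x = x"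
    and "\<And>x. x \<in> relative_cycles m {1..m} \<Longrightarrow> p x \<ominus>\<^bsub>res (Suc m) {}\<^esub> x \<in> derived (Suc m)"
proof -
  have r: "retract_of_free n K (res_generators (Suc m) J) (res (Suc m) J)" if "J \<subseteq> {1..m}" for J
  proof (rule res_retract)
    have "Suc m \<in> {1..Suc m}" "Suc m \<notin> {1..m}" by auto
    then show "\<not> {1..Suc m} \<subseteq> J" using that by blast
  qed
  show thesis
  proof (rule split_projection[OF res_extension[of m "Suc m"] r])
    fix p assume p: "p \<in> linear_maps K (res (Suc m) {}) (res (Suc m) {})"
      "\<And>x. x \<in> carrier (res (Suc m) {}) \<Longrightarrow> p x \<in> kernels (Suc m) {1..m}"
      "\<And>x. x \<in> derived (Suc m) \<Longrightarrow> p x \<in> hopf_denominator n K m (res (Suc m)) (res_map (Suc m))"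
      "\<And>x. x \<in> kernels (Suc m) {1..m} \<Longrightarrow> p x = x"
      and pr: "\<And>x. \<lbrakk>x \<in> carrier (res (Suc m) {});
          \<And>j. j \<in> {1..m} \<Longrightarrow> res_map (Suc m) {} {j} x \<in> derived_ideal n K (res (Suc m) {j})\<rbrakk> \<Longrightarrow>
        p x \<ominus>\<^bsub>res (Suc m) {}\<^esub> x \<in> derived (Suc m)"
    have rel: "p x \<ominus>\<^bsub>res (Suc m) {}\<^esub> x \<in> derived (Suc m)" if "x \<in> relative_cycles m {1..m}" for x
      using that res_single[of _ m] by (intro pr) (auto simp: relative_cycles_def)
    show thesis by (rule that[OF p rel])
  qed simp
qed

text \<open>
  The last faces of the elements of the derived ideal whose other faces vanish form an ideal, because
  the last face is surjective. A generator of the denominator is such a last face: its entries are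
  lifted one by one, each with those faces equal to zero that vanish on the entry.
\<close>

lemma denominator_image:
  assumes n1: "d \<in> denominator m"
  shows "\<exists>x. x \<in> derived (Suc m) \<and> x \<in> kernels (Suc m) {1..m} \<and> last_face m x = d"
proof -
  interpret F: fold_arrow n K m "res m" "res_map m" by (rule res_arrow) simp
  interpret E: fold_arrow n K m "res (Suc m)" "res_map (Suc m)" by (rule res_arrow) simp
  interpret P: lie_n_algebra n K "res (Suc m) {}" by (rule res_algebra)
  let ?N = "last_face m ` (derived (Suc m) \<inter> kernels (Suc m) {1..m})"
  have "denominator m \<subseteq> ?N"
  proof (rule F.hopf_denominator_least)
    show "lie_ideal n K (res m {}) ?N"
    proof (rule lie_ideal_image[OF res_algebra res_algebra last_face_hom])
      show "lie_ideal n K (res (Suc m) {}) (derived (Suc m) \<inter> kernels (Suc m) {1..m})"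
        by (rule P.lie_ideal_Int[OF P.lie_ideal_derived E.lie_ideal_kernel_meet]) simp
      show "last_face m ` carrier (res (Suc m) {}) = carrier (res m {})"
      proof
        show "carrier (res m {}) \<subseteq> last_face m ` carrier (res (Suc m) {})"
        proof
          fix d assume "d \<in> carrier (res m {})"
          from lift_last_face[OF this, of "{}"] show "d \<in>
              last_face m ` carrier (res (Suc m) {})" by auto
        qed
      qed (use lie_hom_closed[OF last_face_hom] in blast)
    qed
    fix ls T
    assume ls: "length ls = n" "\<And>j. j < n \<Longrightarrow> ls ! j \<in> kernels m (T j)"
      and T: "\<And>j. j < n \<Longrightarrow> T j \<subseteq> {1..m}" "(\<Union>j<n. T j) = {1..m}"
    have "\<exists>z. z \<in> kernels (Suc m) (T j) \<and> last_face m z = ls ! j" if j: "j < n" for j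
    proof -
      have "ls ! j \<in> carrier (res m {})" using ls(2)[OF j] by (simp add: mem_kernel_meet)
      moreover have "res_map m {} {i} (ls ! j) = \<zero>\<^bsub>res m {i}\<^esub>" if "i \<in> T j" for i
        using ls(2)[OF j] that by (simp add: mem_kernel_meet)
      ultimately obtain z where "z \<in> carrier (res (Suc m) {})" "last_face m z = ls ! j"
        "\<forall>i\<in>T j. res_map (Suc m) {} {i} z = \<zero>\<^bsub>res (Suc m) {i}\<^esub>"
        using lift_last_face[OF _ T(1)[OF j]] by metis
      then show ?thesis by (auto simp: mem_kernel_meet)
    qed
    then obtain z where z: "\<And>j. j < n \<Longrightarrow> z j \<in> kernels (Suc m) (T j)"
      and zt: "\<And>j. j < n \<Longrightarrow> last_face m (z j) = ls ! j" by metis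
    let ?zs = "map z [0..<n]"
    have zs: "?zs \<in> tuples n (carrier (res (Suc m) {}))"
      using z by (auto simp: tuples_iff_nth mem_kernel_meet)
    have "map (last_face m) ?zs = ls" using ls(1) zt by (auto intro!: nth_equalityI)
    then have "last_face m (bracket (res (Suc m) {}) ?zs) = bracket (res m {}) ls"
      using lie_hom_bracket[OF last_face_hom zs] by simp
    moreover have "bracket (res (Suc m) {}) ?zs \<in> kernels (Suc m) {1..m}"
      unfolding mem_kernel_meet
    proof (intro conjI ballI)
      show "bracket (res (Suc m) {}) ?zs \<in> carrier (res (Suc m) {})"
        by (rule P.bracket_closed[OF zs])
      fix i assume i: "i \<in> {1..m}"
      then obtain j where j: "j < n" "i \<in> T j" using T(2) by blast
      interpret R: lie_n_algebra n K "res (Suc m) {i}" by (rule res_algebra)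
      have hom: "res_map (Suc m) {} {i} \<in> lie_hom n K (res (Suc m) {}) (res (Suc m) {i})"
        using i by (intro E.arrow_map) auto
      have zero: "map (res_map (Suc m) {} {i}) ?zs ! j = \<zero>\<^bsub>res (Suc m) {i}\<^esub>"
        using z[OF j(1)] j by (simp add: mem_kernel_meet)
      show "res_map (Suc m) {} {i} (bracket (res (Suc m) {}) ?zs) = \<zero>\<^bsub>res (Suc m) {i}\<^esub>"
        unfolding lie_hom_bracket[OF hom zs]
        by (rule R.bracket_zero[OF tuples_map[OF zs lie_hom_closed[OF hom]] j(1) zero])
    qed
    moreover have "bracket (res (Suc m) {}) ?zs \<in> derived (Suc m)"
      by (rule derived_ideal_bracket[OF zs])
    ultimately show "bracket (res m {}) ls \<in> ?N" by (metis IntI imageI)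
  qed
  then show ?thesis using n1 by blast
qed

text \<open>
  The cube of the first \<open>m\<close> faces has free vertices only. Its projection fixes \<open>x\<close> and maps the
  derived ideal into the denominator of this cube, which the last face maps to \<open>denominator m\<close>.
\<close>

lemma last_face_derived_kernel:
  assumes "x \<in> derived (Suc m)" "x \<in> kernels (Suc m) {1..m}"
  shows "last_face m x \<in> denominator m"
proof -
  obtain p where p: "\<And>x. x \<in> derived (Suc m) \<Longrightarrow> p x \<in>
      hopf_denominator n K m (res (Suc m)) (res_map (Suc m))"
    "\<And>x. x \<in> kernels (Suc m) {1..m} \<Longrightarrow> p x = x" using relative_split[of m] by metis
  have "x \<in> hopf_denominator n K m (res (Suc m)) (res_map (Suc m))" using p assms by metis
  from hopf_denominator_map[OF res_arrow res_arrow last_face_cube_map this]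
  show ?thesis by simp
qed

text \<open>
  The cycles that represent the homology: in each class there is one all of whose faces but the
  last vanish. Its last face is the corresponding element of the Hopf quotient.
\<close>

definition normalised_cycles :: "nat \<Rightarrow> ('k, 'a) univ set" where
  "normalised_cycles m = {x \<in> kernels (Suc m) {1..m}. last_face m x \<in> derived m}"

lemma normalised_cycles_submodule: "submodule (normalised_cycles m) K (res (Suc m) {})"
proof -
  interpret E: fold_arrow n K m "res (Suc m)" "res_map (Suc m)" by (rule res_arrow) simp
  interpret P: lie_n_algebra n K "res (Suc m) {}" by (rule res_algebra)
  interpret Q: lie_n_algebra n K "res m {}" by (rule res_algebra)
  have "normalised_cycles m = kernels (Suc m) {1..m} \<inter> {x \<in> carrier (res (Suc m) {}).
      last_face m x \<in> derived m}"
    by (auto simp: normalised_cycles_def mem_kernel_meet)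
  also have "submodule \<dots> K (res (Suc m) {})"
    by (rule P.submodule_Int[OF E.submodule_kernel_meet[OF subset_refl]
          submodule_vimage[OF P.module_axioms Q.module_axioms lie_hom_linear[OF last_face_hom]
              Q.derived_submodule]])
  finally show ?thesis .
qed

text \<open>
  If the last face of \<open>x\<close> lies in the denominator, it is also the last face of an element of the
  derived ideal; the difference has vanishing faces and hence is a boundary. Conversely a boundary
  modulo the derived ideal is corrected by the projection to an honest boundary.
\<close>

lemma normalised_cycle_boundary_iff:
  assumes x: "x \<in> normalised_cycles m"
  shows "ab_class (Suc m) x \<in>
      (\<lambda>y. ab_class (Suc m) (last_face (Suc m) y)) ` relative_cycles (Suc m) {1..Suc m}
    \<longleftrightarrow> last_face m x \<in> denominator m"
proof -
  interpret P: lie_n_algebra n K "res (Suc m) {}" by (rule res_algebra)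
  interpret Q: lie_n_algebra n K "res m {}" by (rule res_algebra)
  interpret R: lie_n_algebra n K "res (Suc (Suc m)) {}" by (rule res_algebra)
  interpret E: fold_arrow n K m "res (Suc m)" "res_map (Suc m)" by (rule res_arrow) simp
  interpret E': fold_arrow n K "Suc m" "res (Suc m)" "res_map (Suc m)" by (rule res_arrow) simp
  let ?q = "ab_class (Suc m)"
  have xk: "x \<in> kernels (Suc m) {1..m}" and xc: "x \<in> carrier (res (Suc m) {})"
    using x by (auto simp: normalised_cycles_def mem_kernel_meet)
  note der_sub = P.derived_submodule
  have km_sub: "submodule (kernels (Suc m) {1..m}) K (res (Suc m) {})"
    by (rule E.submodule_kernel_meet) simp
  show ?thesis
  proof
    assume "last_face m x \<in> denominator m"
    then obtain x' where x': "x' \<in> derived (Suc m)" "x' \<in> kernels (Suc m) {1..m}"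
        "last_face m x' = last_face m x"
      using denominator_image by metis
    have x'c: "x' \<in> carrier (res (Suc m) {})" using x'(2) by (simp add: mem_kernel_meet)
    let ?d = "x \<ominus>\<^bsub>res (Suc m) {}\<^esub> x'"
    have dk: "?d \<in> kernels (Suc m) {1..m}" by (rule P.submodule_minus[OF km_sub xk x'(2)])
    have dt: "last_face m ?d = \<zero>\<^bsub>res m {}\<^esub>"
      using lie_hom_minus[OF res_algebra res_algebra last_face_hom xc x'c] x'(3)
        lie_hom_closed[OF last_face_hom xc] by (simp add: Q.M.minus_self)
    have "\<exists>y\<in>carrier (res (Suc (Suc m)) {}). last_face (Suc m) y = ?d \<and>
        (\<forall>j\<in>{1..Suc m}. res_map (Suc (Suc m)) {} {j} y = \<zero>\<^bsub>res (Suc (Suc m)) {j}\<^esub>)"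
    proof (rule lift_last_face[OF _ subset_refl])
      show "?d \<in> carrier (res (Suc m) {})" using xc x'c by simp
      show "res_map (Suc m) {} {j} ?d = \<zero>\<^bsub>res (Suc m) {j}\<^esub>" if j: "j \<in> {1..Suc m}" for j
      proof (cases "j = Suc m")
        case True
        then show ?thesis using dt res_single[of "Suc m" m] by simp
      next
        case False
        then show ?thesis using dk j by (simp add: mem_kernel_meet)
      qed
    qed
    then obtain y where y: "y \<in> carrier (res (Suc (Suc m)) {})" "last_face (Suc m) y = ?d"
      and yj: "\<And>j. j \<in> {1..Suc m} \<Longrightarrow> res_map (Suc (Suc m)) {} {j} y = \<zero>\<^bsub>res (Suc (Suc m)) {j}\<^esub>"
        by blast
    have "res_map (Suc (Suc m)) {} {j} y \<in> derived (Suc m)" if "j \<in> {1..Suc m}" for j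
      using yj[OF that] res_single[of j "Suc m"] that P.submodule_zero[OF der_sub] by simp
    then have "y \<in> relative_cycles (Suc m) {1..Suc m}"
      using y by (simp add: relative_cycles_def)
    moreover have "?q x = ?q (last_face (Suc m) y)"
    proof -
      have "x \<ominus>\<^bsub>res (Suc m) {}\<^esub> ?d = x'"
        using xc x'c by (simp add: a_minus_def P.M.minus_add P.M.a_assoc[symmetric] P.M.r_neg)
      then show ?thesis unfolding y(2) using P.coset_eq_iff[OF der_sub xc] xc x'c x'(1) by simp
    qed
    ultimately show "?q x \<in> (\<lambda>y. ?q (last_face (Suc m) y)) ` relative_cycles (Suc m) {1..Suc m}"
      by blast
  next
    assume "?q x \<in> (\<lambda>y. ?q (last_face (Suc m) y)) ` relative_cycles (Suc m) {1..Suc m}"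
    then obtain y where y: "y \<in> relative_cycles (Suc m) {1..Suc m}"
        and qy: "?q x = ?q (last_face (Suc m) y)" by auto
    obtain p where p: "p \<in> linear_maps K (res (Suc (Suc m)) {}) (res (Suc (Suc m)) {})"
      "\<And>x. x \<in> carrier (res (Suc (Suc m)) {}) \<Longrightarrow> p x \<in> kernels (Suc (Suc m)) {1..Suc m}"
      "\<And>x. x \<in> relative_cycles (Suc m) {1..Suc m} \<Longrightarrow>
        p x \<ominus>\<^bsub>res (Suc (Suc m)) {}\<^esub> x \<in> derived (Suc (Suc m))"
      using relative_split[of "Suc m"] by metis
    have yc: "y \<in> carrier (res (Suc (Suc m)) {})" using y by (simp add: relative_cycles_def)
    let ?v = "last_face (Suc m) (p y)"
    have pyc: "p y \<in> carrier (res (Suc (Suc m)) {})" using linear_maps_closed[OF p(1) yc] .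
    have tyc: "last_face (Suc m) y \<in> carrier (res (Suc m) {})"
        and vc: "?v \<in> carrier (res (Suc m) {})"
      using lie_hom_closed[OF last_face_hom] yc pyc by blast+
    have vj: "res_map (Suc m) {} {j} ?v = \<zero>\<^bsub>res (Suc m) {j}\<^esub>" if j: "j \<in> {1..Suc m}" for j
      using p(2)[OF yc] j by (intro last_face_kernel[OF j pyc]) (simp add: mem_kernel_meet)
    have v1: "?v \<ominus>\<^bsub>res (Suc m) {}\<^esub> last_face (Suc m) y \<in> derived (Suc m)"
      using derived_ideal_map[OF res_algebra res_algebra last_face_hom p(3)[OF y]]
        lie_hom_minus[OF res_algebra res_algebra last_face_hom pyc yc] by simp
    have "?q x = ?q ?v" using qy P.coset_eq_iff[OF der_sub vc tyc] v1 by simp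
    then have d: "x \<ominus>\<^bsub>res (Suc m) {}\<^esub> ?v \<in> derived (Suc m)" using P.coset_eq_iff[OF der_sub xc vc]
      by simp
    have vk: "?v \<in> kernels (Suc m) {1..m}" using vj vc by (simp add: mem_kernel_meet)
    have "last_face m (x \<ominus>\<^bsub>res (Suc m) {}\<^esub> ?v) \<in> denominator m"
      by (rule last_face_derived_kernel[OF d P.submodule_minus[OF km_sub xk vk]])
    moreover have "last_face m ?v = \<zero>\<^bsub>res m {}\<^esub>" using vj[of "Suc m"] res_single[of "Suc m" m] by simp
    ultimately show "last_face m x \<in> denominator m"
      using lie_hom_minus[OF res_algebra res_algebra last_face_hom xc vc]
          lie_hom_closed[OF last_face_hom xc]
      by (simp add: Q.M.minus_zero)
  qed
qed

lemma normalised_cycles_represent: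
  assumes "z \<in> relative_cycles m {1..Suc m}"
  shows "\<exists>x\<in>normalised_cycles m.
    ab_class (Suc m) x = ab_class (Suc m) z"
proof -
  interpret P: lie_n_algebra n K "res (Suc m) {}" by (rule res_algebra)
  interpret Q: lie_n_algebra n K "res m {}" by (rule res_algebra)
  have z: "z \<in> relative_cycles m {1..m}" "z \<in> carrier (res (Suc m) {})" "last_face m z \<in> derived m"
    using assms by (auto simp: relative_cycles_def)
  obtain p where p: "p \<in> linear_maps K (res (Suc m) {}) (res (Suc m) {})"
    "\<And>x. x \<in> carrier (res (Suc m) {}) \<Longrightarrow> p x \<in> kernels (Suc m) {1..m}"
    "\<And>x. x \<in> relative_cycles m {1..m} \<Longrightarrow> p x \<ominus>\<^bsub>res (Suc m) {}\<^esub> x \<in> derived (Suc m)"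
    using relative_split[of m] by metis
  have pc: "p z \<in> carrier (res (Suc m) {})" by (rule linear_maps_closed[OF p(1) z(2)])
  have "last_face m (p z) \<ominus>\<^bsub>res m {}\<^esub> last_face m z \<in> derived m"
    using derived_ideal_map[OF res_algebra res_algebra last_face_hom p(3)[OF z(1)]]
      lie_hom_minus[OF res_algebra res_algebra last_face_hom pc z(2)] by simp
  then have "(last_face m (p z) \<ominus>\<^bsub>res m {}\<^esub> last_face m z) \<oplus>\<^bsub>res m {}\<^esub> last_face m z \<in> derived m"
    using z(3) Q.submoduleE(5)[OF Q.derived_submodule] by blast
  moreover have "(last_face m (p z) \<ominus>\<^bsub>res m {}\<^esub> last_face m z) \<oplus>\<^bsub>res m {}\<^esub> last_face m z =
      last_face m (p z)"
    using lie_hom_closed[OF last_face_hom pc] lie_hom_closed[OF last_face_hom z(2)]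
    by (simp add: a_minus_def Q.M.a_assoc Q.M.l_neg)
  ultimately have "p z \<in> normalised_cycles m" using p(2)[OF z(2)]
    by (simp add: normalised_cycles_def)
  moreover have "ab_class (Suc m) (p z) = ab_class (Suc m) z"
    using P.coset_eq_iff[OF P.derived_submodule pc z(2)] p(3)[OF z(1)] by simp
  ultimately show ?thesis by blast
qed

text \<open>
  The normalised cycles map onto the homology and, by the last face followed by \<open>a\<close>, onto the
  subquotient of \<open>N\<close>.
\<close>

lemma homology_isomorphic_subquotient:
  assumes m: "m = Suc k" and N: "module K N" and D: "submodule D K N" and C: "C \<subseteq> carrier N"
    and a: "a \<in> linear_maps K (res m {}) N"
    and aC: "\<And>x. \<lbrakk>x \<in> derived m; x \<in> kernels m {1..m}\<rbrakk> \<Longrightarrow> a x \<in> C"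
    and surj: "\<And>c. c \<in> C \<Longrightarrow> \<exists>x. x \<in> derived m \<and> x \<in> kernels m {1..m} \<and> a x \<ominus>\<^bsub>N\<^esub> c \<in> D"
    and ker: "\<And>x. \<lbrakk>x \<in> derived m; x \<in> kernels m {1..m}\<rbrakk> \<Longrightarrow> a x \<in> D \<longleftrightarrow> x \<in> denominator m"
  shows "linearly_isomorphic K (moore_homology (ab_res) m) (subquotient N C D)"
proof -
  interpret P: lie_n_algebra n K "res (Suc m) {}" by (rule res_algebra)
  interpret R: lie_n_algebra n K "res (Suc (Suc m)) {}" by (rule res_algebra)
  interpret E: fold_arrow n K "Suc m" "res (Suc (Suc m))" "res_map (Suc (Suc m))"
    by (rule res_arrow) simp
  let ?V = "ab_obj n K (res (Suc m) {})"
  let ?q = "ab_class (Suc m)"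
  let ?W = "res (Suc m) {} \<lparr>carrier := normalised_cycles m\<rparr>"
  let ?Z = "?q ` relative_cycles m {1..Suc m}"
  let ?B = "(\<lambda>y. ?q (last_face (Suc m) y)) ` relative_cycles (Suc m) {1..Suc m}"
  have H: "moore_homology (ab_res) m = subquotient ?V ?Z ?B"
    unfolding m by (rule moore_homology_res)
  have V: "module K ?V" unfolding ab_obj_def
    by (rule module_quotient[OF P.module_axioms P.derived_submodule])
  have q: "?q \<in> linear_maps K (res (Suc m) {}) ?V"
    unfolding ab_obj_def by (rule quotient_module_linear[OF P.module_axioms P.derived_submodule])
  have W: "module K ?W"
    by (rule submodule.submodule_is_module[OF normalised_cycles_submodule P.module_axioms])
  have Wc: "x \<in> carrier (res (Suc m) {})" "x \<in> kernels (Suc m) {1..m}" "last_face m x \<in> derived m"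
    if "x \<in> normalised_cycles m" for x
    using that by (auto simp: normalised_cycles_def mem_kernel_meet)
  have Wk: "last_face m x \<in> kernels m {1..m}" if "x \<in> normalised_cycles m" for x
    using kernel_meet_map[OF res_arrow res_arrow last_face_cube_map subset_refl Wc(2)[OF that]]
      by simp
  have restr: "h \<in> linear_maps K ?W M" if "h \<in> linear_maps K (res (Suc m) {}) M" for h M
    using that Wc(1) by (auto simp: linear_maps_def)
  have at: "(\<lambda>x. a (last_face m x)) \<in> linear_maps K (res (Suc m) {}) N"
    using lie_hom_linear[OF last_face_hom[of m]] a by (auto simp: linear_maps_def Pi_iff)
  have B: "submodule ?B K ?V"
  proof -
    have "relative_cycles (Suc m) {1..Suc m} =
        carrier (res (Suc (Suc m)) {}) \<inter> (\<Inter>j\<in>{1..Suc m}. {x \<in> carrier (res (Suc (Suc m)) {}).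
            res_map (Suc (Suc m)) {} {j} x \<in> derived (Suc m)})"
      by (auto simp: relative_cycles_def)
    also have "\<dots> =
        \<Inter> (insert (carrier (res (Suc (Suc m)) {})) ((\<lambda>j. {x \<in> carrier (res (Suc (Suc m)) {}).
            res_map (Suc (Suc m)) {} {j} x \<in> derived (Suc m)}) ` {1..Suc m}))"
      by simp
    also have "lie_ideal n K (res (Suc (Suc m)) {}) \<dots>"
      using R.lie_ideal_carrier
      by (intro R.lie_ideal_Inter)
        (auto intro!: lie_ideal_vimage[OF res_algebra res_algebra face_hom P.lie_ideal_derived])
    finally have "submodule (relative_cycles (Suc m) {1..Suc m}) K (res (Suc (Suc m)) {})"
      by (simp add: lie_ideal_def)
    moreover have "(\<lambda>y. ?q (last_face (Suc m) y)) \<in> linear_maps K (res (Suc (Suc m)) {}) ?V"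
      using lie_hom_linear[OF last_face_hom[of "Suc m"]] q by (auto simp: linear_maps_def Pi_iff)
    ultimately show ?thesis by (intro submodule_image[OF R.module_axioms V])
  qed
  show ?thesis unfolding H
  proof (rule linearly_isomorphic_subquotients[OF W V N B D restr[OF q] restr[OF at] _ C])
    show "?Z \<subseteq> carrier ?V" using linear_maps_closed[OF q] by (auto simp: relative_cycles_def)
    fix x assume "x \<in> carrier ?W"
    then have x: "x \<in> normalised_cycles m" by simp
    show "?q x \<in> ?Z"
    proof (rule imageI)
      show "x \<in> relative_cycles m {1..Suc m}"
        unfolding relative_cycles_def
      proof (intro CollectI conjI ballI)
        show "x \<in> carrier (res (Suc m) {})" by (rule Wc(1)[OF x])
        fix j assume j: "j \<in> {1..Suc m}"
        interpret Q: lie_n_algebra n K "res m {}" by (rule res_algebra)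
        show "res_map (Suc m) {} {j} x \<in> derived m"
        proof (cases "j = Suc m")
          case True
          then show ?thesis using Wc(3)[OF x] by simp
        next
          case False
          then have "res_map (Suc m) {} {j} x = \<zero>\<^bsub>res (Suc m) {j}\<^esub>"
            using Wc(2)[OF x] j by (simp add: mem_kernel_meet)
          then show ?thesis using Q.submodule_zero[OF Q.derived_submodule] res_single[OF j] by simp
        qed
      qed
    qed
    show "a (last_face m x) \<in> C" by (rule aC[OF Wc(3)[OF x] Wk[OF x]])
    show "?q x \<in> ?B \<longleftrightarrow> a (last_face m x) \<in> D"
      using normalised_cycle_boundary_iff[OF x] ker[OF Wc(3)[OF x] Wk[OF x]] by simp
  next
    fix X assume "X \<in> ?Z"
    then obtain z where z: "z \<in> relative_cycles m {1..Suc m}" "X = ?q z" by auto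
    then obtain x where x: "x \<in> normalised_cycles m" "?q x = X"
      using normalised_cycles_represent by metis
    interpret V: module K ?V by (rule V)
    have "X \<in> carrier ?V" using linear_maps_closed[OF q Wc(1)[OF x(1)]] x(2) by simp
    then have "?q x \<ominus>\<^bsub>?V\<^esub> X \<in> ?B" using x(2) V.submodule_zero[OF B] by (simp add: V.M.minus_self)
    then show "\<exists>x\<in>carrier ?W. ?q x \<ominus>\<^bsub>?V\<^esub> X \<in> ?B" using x(1) by auto
  next
    fix c assume "c \<in> C"
    then obtain d where d: "d \<in> derived m" "d \<in> kernels m {1..m}" "a d \<ominus>\<^bsub>N\<^esub> c \<in> D" using surj by blast
    have dc: "d \<in> carrier (res m {})" using d(2) by (simp add: mem_kernel_meet)
    have dj: "res_map m {} {j} d = \<zero>\<^bsub>res m {j}\<^esub>" if "j \<in> {1..m}" for j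
      using d(2) that by (simp add: mem_kernel_meet)
    obtain x where "x \<in> carrier (res (Suc m) {})" "last_face m x = d"
      "\<forall>j\<in>{1..m}. res_map (Suc m) {} {j} x = \<zero>\<^bsub>res (Suc m) {j}\<^esub>"
      using lift_last_face[OF dc subset_refl dj] by blast
    then have "x \<in> normalised_cycles m" "last_face m x = d"
      using d(1) by (auto simp: normalised_cycles_def mem_kernel_meet)
    then show "\<exists>x\<in>carrier ?W. a (last_face m x) \<ominus>\<^bsub>N\<^esub> c \<in> D" using d(3) by auto
  qed
qed

end

theorem theorem4p2:
  fixes n m :: nat and K :: "('k, 'r) ring_scheme" and L :: "('k, 'a) nlie"
    and f :: "nat set \<Rightarrow> ('k, 'a) nlie" and \<phi> :: "nat set \<Rightarrow> nat set \<Rightarrow> 'a \<Rightarrow> 'a"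
  assumes "n \<ge> 2"
    and "field K" and "ring_characteristic K \<noteq> 2"
    and "m \<ge> 1"
    and "fold_presentation n K m f \<phi> L"
  shows "linearly_isomorphic K
    (comonad_homology n K (ab_obj n K) (ab_map n K) (m + 1) L)
    (hopf_quotient n K m f \<phi>)"
proof -
  interpret F: fold_presentation n K m f \<phi> L by fact
  interpret ground n K by (rule ground.intro[OF assms(2)]) (unfold_locales, use assms(1) in simp)
  have L: "lie_n_algebra n K L" using F.arrow_obj[of "{1..m}"] F.presented by simp
  interpret R: resolution n K "elem_copy L"
    by (intro resolution.intro resolution_axioms.intro ground_axioms lie_n_algebra_elem_copy[OF L])
  let ?c = "R.res m" and ?m = "R.res_map m"
  interpret C: fold_extension n K m ?c ?m by (rule R.res_extension) simp
  interpret FC: cubes n K m f \<phi> ?c ?m by unfold_locales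
  interpret CF: cubes n K m ?c ?m f \<phi> by unfold_locales
  interpret FF: cubes n K m f \<phi> f \<phi> by unfold_locales
  interpret CC: cubes n K m ?c ?m ?c ?m by unfold_locales
  have retrC: "retract_of_free n K (R.res_generators m J) (?c J)" if "J \<subset> {1..m}" for J
    using that by (intro R.res_retract) auto
  have retrF: "retract_of_free n K (carrier (elem_copy (f J)) :: ('k, 'a) univ set) (f J)"
      if "J \<subset> {1..m}" for J
    using that by (intro projective_retract_of_free F.projective F.arrow_obj) auto
  have ctop: "?c {1..m} = elem_copy L"
    by (simp add: comonad_cube_filter atLeastLessThanSuc_atLeastAtMost)
  have ftop: "f {1..m} = L" by (rule F.presented)
  obtain g where g: "cube_map n K m ?c ?m f \<phi> g" and gtop: "g {1..m} = the_Elem"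
    using CF.cube_map_from_top[of the_Elem "R.res_generators m", OF _ retrC] the_Elem_hom[of n K L]
    unfolding ctop ftop by blast
  obtain h where h: "cube_map n K m f \<phi> ?c ?m h" and htop: "h {1..m} = Elem"
    using FC.cube_map_from_top[of Elem "\<lambda>J. carrier (elem_copy (f J))", OF _ retrF] Elem_hom[OF L]
    unfolding ctop ftop by blast
  let ?SF = "hopf_denominator n K m f \<phi>" and ?SC = "hopf_denominator n K m ?c ?m"
  \<comment> \<open>The maps compose to the identity at the terminal vertex, hence up to the denominators.\<close>
  have gh: "g {} (h {} x) \<ominus>\<^bsub>f {}\<^esub> x \<in> ?SF"
    if "x \<in> derived_ideal n K (f {})" "x \<in> kernel_meet f \<phi> {1..m}" for x
    by (rule FF.cube_maps_homotopic[OF cube_map_compose[OF F.fold_arrow_axioms h g] cube_map_id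
        _ retrF that])
      (simp only: gtop htop univ.sel)
  have hg: "h {} (g {} x) \<ominus>\<^bsub>?c {}\<^esub> x \<in> ?SC"
    if "x \<in> derived_ideal n K (?c {})" "x \<in> kernel_meet ?c ?m {1..m}" for x
    by (rule CC.cube_maps_homotopic[OF cube_map_compose[OF C.fold_arrow_axioms g h] cube_map_id
        _ retrC that])
      (simp only: gtop htop ctop, auto simp: elem_copy_def)
  interpret Q: lie_n_algebra n K "f {}" by (rule F.base_algebra)
  interpret P: lie_n_algebra n K "?c {}" by (rule C.base_algebra)
  have ghom: "g {} \<in> lie_hom n K (?c {}) (f {})" and hhom: "h {} \<in> lie_hom n K (f {}) (?c {})"
    using cube_mapD(1)[OF g, of "{}"] cube_mapD(1)[OF h, of "{}"] by auto
  note gD = derived_ideal_map[OF C.base_algebra F.base_algebra ghom]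
  note hD = derived_ideal_map[OF F.base_algebra C.base_algebra hhom]
  note gK = kernel_meet_map[OF C.fold_arrow_axioms F.fold_arrow_axioms g subset_refl]
  note hK = kernel_meet_map[OF F.fold_arrow_axioms C.fold_arrow_axioms h subset_refl]
  let ?N = "derived_ideal n K (f {}) \<inter> kernel_meet f \<phi> {1..m}"
  have "linearly_isomorphic K (moore_homology R.ab_res m) (subquotient (f {}) ?N ?SF)"
  proof (rule R.homology_isomorphic_subquotient[of m "m - 1" "f {}" ?SF ?N "g {}"])
    show "m = Suc (m - 1)" using assms(4) by simp
    show "?N \<subseteq> carrier (f {})" by (auto simp: mem_kernel_meet)
    fix x assume x: "x \<in> derived_ideal n K (?c {})" "x \<in> kernel_meet ?c ?m {1..m}"
    show "g {} x \<in> ?N" using gD gK x by blast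
    have xc: "x \<in> carrier (?c {})" using x(2) by (simp add: mem_kernel_meet)
    have hgc: "h {} (g {} x) \<in> carrier (?c {})"
      using lie_hom_closed[OF hhom lie_hom_closed[OF ghom xc]] .
    show "g {} x \<in> ?SF \<longleftrightarrow> x \<in> ?SC"
    proof
      assume "x \<in> ?SC"
      then show "g {} x \<in> ?SF"
        by (rule hopf_denominator_map[OF C.fold_arrow_axioms F.fold_arrow_axioms g])
    next
      assume "g {} x \<in> ?SF"
      then have "h {} (g {} x) \<in> ?SC"
        by (rule hopf_denominator_map[OF F.fold_arrow_axioms C.fold_arrow_axioms h])
      from P.submodule_minus[OF C.submodule_hopf_denominator this hg[OF x]]
      show "x \<in> ?SC" using xc hgc
        by (simp add: a_minus_def P.M.minus_add P.M.a_assoc[symmetric] P.M.r_neg)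
    qed
  next
    fix c assume c: "c \<in> ?N"
    then show "\<exists>x. x \<in> derived_ideal n K (?c {}) \<and> x \<in> kernel_meet ?c ?m {1..m} \<and>
        g {} x \<ominus>\<^bsub>f {}\<^esub> c \<in> ?SF"
      using hD hK gh by blast
  qed (use Q.module_axioms F.submodule_hopf_denominator lie_hom_linear[OF ghom] in auto)
  then show ?thesis
    by (simp add: comonad_homology_def hopf_quotient_def hopf_denominator_def derived_ideal_def)
qed

end
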